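(* Let $G$ be a finitely generated non-nilpotent meta-$\mathfrak{Nil}$-Hamiltonian group which has a torsion-free soluble subgroup of finite index. Then: (i) $G'$ is finite and $G$ is soluble; (ii) $G$ is center-by-finite, i.e. $|G:Z(G)|$ is finite; (iii) $G$ is polycyclic and $\mathrm{Fit}(G)$ is nilpotent of finite index in $G$; (iv) there are only finitely many maximal subgroups $M$ of $G$ with $G=MG'$, and each such $M$ is nilpotent.
   Context: A group $G$ is meta-$\mathfrak{Nil}$-Hamiltonian if every non-nilpotent subgroup of $G$ is normal in $G$. $Z(G)$ is the center and $\mathrm{Fit}(G)$ the Fitting subgroup (generated by all nilpotent normal subgroups) of $G$. *)

theory Defs
  imports "HOL-Algebra.Algebra"
begin

text \<open>Commutators [a,b] = a b a^-1 b^-1 (same convention as the library's derived subgroup).\<close>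
definition comm_set :: "('a, 'b) monoid_scheme \<Rightarrow> 'a set \<Rightarrow> 'a set \<Rightarrow> 'a set" where
  "comm_set G A B = (\<Union>a\<in>A. \<Union>b\<in>B. {a \<otimes>\<^bsub>G\<^esub> b \<otimes>\<^bsub>G\<^esub> inv\<^bsub>G\<^esub> a \<otimes>\<^bsub>G\<^esub> inv\<^bsub>G\<^esub> b})"

fun lower_central :: "('a, 'b) monoid_scheme \<Rightarrow> nat \<Rightarrow> 'a set" where
  "lower_central G 0 = carrier G"
| "lower_central G (Suc n) = generate G (comm_set G (lower_central G n) (carrier G))"

definition nilpotent_grp :: "('a, 'b) monoid_scheme \<Rightarrow> bool" where
  "nilpotent_grp G \<longleftrightarrow> (\<exists>n. lower_central G n = {\<one>\<^bsub>G\<^esub>})"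

definition center :: "('a, 'b) monoid_scheme \<Rightarrow> 'a set" where
  "center G = {z \<in> carrier G. \<forall>g\<in>carrier G. z \<otimes>\<^bsub>G\<^esub> g = g \<otimes>\<^bsub>G\<^esub> z}"

definition fitting :: "('a, 'b) monoid_scheme \<Rightarrow> 'a set" where
  "fitting G = generate G (\<Union>{N. N \<lhd> G \<and> nilpotent_grp (G\<lparr>carrier := N\<rparr>)})"

definition finitely_generated :: "('a, 'b) monoid_scheme \<Rightarrow> bool" where
  "finitely_generated G \<longleftrightarrow> (\<exists>S. finite S \<and> S \<subseteq> carrier G \<and> generate G S = carrier G)"

definition finite_index :: "('a, 'b) monoid_scheme \<Rightarrow> 'a set \<Rightarrow> bool" where
  "finite_index G H \<longleftrightarrow> finite (rcosets\<^bsub>G\<^esub> H)"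

definition torsion_free :: "('a, 'b) monoid_scheme \<Rightarrow> bool" where
  "torsion_free G \<longleftrightarrow> (\<forall>x\<in>carrier G. \<forall>n::nat. n > 0 \<longrightarrow> x [^]\<^bsub>G\<^esub> n = \<one>\<^bsub>G\<^esub> \<longrightarrow> x = \<one>\<^bsub>G\<^esub>)"

definition cyclic_grp :: "('a, 'b) monoid_scheme \<Rightarrow> bool" where
  "cyclic_grp G \<longleftrightarrow> (\<exists>g\<in>carrier G. generate G {g} = carrier G)"

text \<open>Polycyclic: a subnormal series with cyclic factors (mirrors solvable_seq).\<close>
inductive polycyclic_seq :: "('a, 'b) monoid_scheme \<Rightarrow> 'a set \<Rightarrow> bool" for G where
  unity: "polycyclic_seq G {\<one>\<^bsub>G\<^esub>}"
| extension: "\<lbrakk> polycyclic_seq G K; K \<lhd> (G\<lparr>carrier := H\<rparr>); subgroup H G;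
                cyclic_grp ((G\<lparr>carrier := H\<rparr>) Mod K) \<rbrakk> \<Longrightarrow> polycyclic_seq G H"

definition polycyclic :: "('a, 'b) monoid_scheme \<Rightarrow> bool" where
  "polycyclic G \<longleftrightarrow> polycyclic_seq G (carrier G)"

definition maximal_subgroup :: "'a set \<Rightarrow> ('a, 'b) monoid_scheme \<Rightarrow> bool" where
  "maximal_subgroup M G \<longleftrightarrow> subgroup M G \<and> M \<noteq> carrier G \<and>
     (\<forall>H. subgroup H G \<longrightarrow> M \<subseteq> H \<longrightarrow> H = M \<or> H = carrier G)"

definition meta_nil_hamiltonian :: "('a, 'b) monoid_scheme \<Rightarrow> bool" where
  "meta_nil_hamiltonian G \<longleftrightarrow>
     (\<forall>H. subgroup H G \<longrightarrow> \<not> nilpotent_grp (G\<lparr>carrier := H\<rparr>) \<longrightarrow> H \<lhd> G)"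

end

theory Submission
  imports Defs "HOL-Computational_Algebra.Polynomial" "HOL-Computational_Algebra.Primes"
begin

text \<open>
  Let \<open>N\<close> be the torsion-free soluble normal core of finite index. The finite group \<open>G / N\<close> is
  soluble: if all its proper subgroups are nilpotent this is Schmidt's theorem, and otherwise a
  proper non-nilpotent subgroup is normal with Dedekind quotient.

  For an abelian normal section \<open>A\<close> and \<open>x \<in> G\<close>, testing the hypothesis on the subgroups \<open>B\<langle>x\<rangle>\<close> with
  \<open>B\<close> a \<open>\<langle>x\<rangle>\<close>-submodule of \<open>A\<close> shows that a cyclic \<open>\<langle>x\<rangle>\<close>-submodule is unipotent up to a finite
  simple module. Hence conjugation closures \<open>\<langle>a\<rangle>\<^sup>x\<close> are finitely generated, which makes the finitely
  generated soluble group \<open>G\<close> polycyclic, and all elements act unipotently on torsion-free abelian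
  normal subgroups. Noetherian induction with the transfer map then yields a finite term \<open>F\<close> of the
  lower central series. As \<open>G\<close> is not nilpotent, some \<open>x\<close> acts non-nilpotently on \<open>F\<close>, and
  normality of the subgroups \<open>F\<langle>x c\<rangle>\<close>, \<open>c \<in> N\<close>, forces \<open>N\<close> into the centre. Everything else follows
  from \<open>N\<close> being torsion-free, central and of finite index.
\<close>

section \<open>Maximal ideals of the integral Laurent polynomial ring\<close>

text \<open>A finitely generated soluble group need not be polycyclic, as the wreath product of two
  infinite cyclic groups shows, so all finiteness has to be extracted from the hypothesis, which is
  silent about nilpotent subgroups. It is made to speak by elements \<open>m\<close>,
  \<open>x\<close> whose commutators \<open>[m, x, ..., x]\<close> never become trivial: every
  subgroup containing both is then normal. For an element \<open>a\<close> of an abelian section on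
  which \<open>x\<close> does not act unipotently, this makes every Laurent polynomial in
  \<open>x\<close> outside the annihilator of \<open>[a, x, x]\<close> invertible modulo that
  annihilator. In either case \<open>a\<close> is killed by an integer polynomial with leading and
  constant coefficient 1. Both ends matter, because the span of finitely many conjugates has to be
  stable under \<open>x\<close> and under its inverse. The torsion-free subgroup serves in two ways:
  it meets every finite subgroup trivially, and whether an element of \<open>G\<close> has finite
  order is decided by the single power whose exponent is the index.\<close>

lemma pseudo_division:
  fixes f g :: "int poly"
  assumes "g \<noteq> 0"
  shows "\<exists>n q r. smult (lead_coeff g ^ n) f = g * q + r \<and> (r = 0 \<or> degree r < degree g)"
proof -
  obtain q r where qr: "pseudo_divmod f g = (q, r)" by force
  show ?thesis using pseudo_divmod[OF assms qr] by blast
qed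

lemma degree_diff_lead_less:
  fixes g :: "int poly"
  assumes "degree g > 0"
  shows "degree (g - monom (lead_coeff g) (degree g)) < degree g"
proof -
  have "degree (g - monom (lead_coeff g) (degree g)) \<le> degree g - 1"
  proof (rule degree_le, intro allI impI)
    fix i assume "i > degree g - 1"
    then have "i \<ge> degree g" using assms by simp
    then show "coeff (g - monom (lead_coeff g) (degree g)) i = 0"
      by (cases "i = degree g") (auto simp: coeff_eq_0)
  qed
  then show ?thesis using assms by simp
qed

text \<open>Since \<open>I\<close> is saturated with respect to the variable, it stands for an ideal of the Laurent
  polynomial ring; \<open>inverse\<close> says that the quotient is a field. A field that is finitely generated as
  a ring is finite, and \<open>inverse_one_minus\<close> makes the variable algebraic over the prime field, so
  only this one-variable case is needed.\<close>
locale laurent_maximal_ideal =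
  fixes I :: "int poly set"
  assumes add: "g \<in> I \<Longrightarrow> h \<in> I \<Longrightarrow> g + h \<in> I"
    and mult: "g \<in> I \<Longrightarrow> q * g \<in> I"
    and pCons_0: "pCons 0 g \<in> I \<Longrightarrow> g \<in> I"
    and one_notin: "1 \<notin> I"
    and inverse: "w \<notin> I \<Longrightarrow> \<exists>k q. monom 1 k - q * w \<in> I"
    and inverse_one_minus: "\<exists>k q. monom 1 k - q * [:1, -1:] \<in> I"
begin

lemma diff: "g \<in> I \<Longrightarrow> h \<in> I \<Longrightarrow> g - h \<in> I"
  using add[of g "-1 * h"] mult[of h "-1"] by simp

lemma smult: "g \<in> I \<Longrightarrow> smult c g \<in> I"
  using mult[of g "[:c:]"] by simp

lemma monom_mult_cancel: "monom 1 k * g \<in> I \<Longrightarrow> g \<in> I"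
proof (induction k)
  case 0
  then show ?case by (simp add: monom_0)
next
  case (Suc k)
  then show ?case using pCons_0[of "monom 1 k * g"] by (simp add: monom_Suc)
qed

text \<open>Evaluation at 1 kills the multiples of \<open>[:1, -1:]\<close> and sends every
  \<open>monom 1 k\<close> to 1. Besides a nonzero element of \<open>I\<close>, this gives in
  \<open>monic_mem\<close> an element that is nonzero modulo a prime.\<close>

lemma poly_one_eq_one: "\<exists>g\<in>I. poly g 1 = 1"
proof -
  obtain k q where "monom 1 k - q * [:1, -1:] \<in> I" using inverse_one_minus by blast
  moreover have "poly (monom 1 k - q * [:1, -1:]) 1 = 1" by (simp add: poly_monom)
  ultimately show ?thesis by blast
qed

text \<open>Let \<open>c\<close>, \<open>e\<close> be the extreme coefficients of a nonzero element of least degree \<open>d\<close>. Modulo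
  \<open>I\<close>, every Laurent polynomial times a power of \<open>c * e\<close> has degree below \<open>d\<close>; if \<open>d > 0\<close>, minimality
  prevents a prime not dividing \<open>c * e\<close> from being invertible.\<close>
lemma const_mem: "\<exists>m::int. m > 0 \<and> [:m:] \<in> I"
proof -
  have "\<exists>g. g \<in> I \<and> g \<noteq> 0" using poly_one_eq_one by force
  then obtain g where g: "g \<in> I" "g \<noteq> 0"
    and min: "\<And>h. h \<in> I \<Longrightarrow> h \<noteq> 0 \<Longrightarrow> degree g \<le> degree h"
    using ex_has_least_nat[of "\<lambda>g. g \<in> I \<and> g \<noteq> 0" _ degree] by blast
  have "degree g = 0"
  proof (rule ccontr)
    assume d: "degree g \<noteq> 0"
    obtain c g1 where c: "g = pCons c g1" by (rule pCons_cases)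
    have g1: "g1 \<noteq> 0" using d c by auto
    have c0: "c \<noteq> 0"
    proof
      assume "c = 0"
      then have "g1 \<in> I" using g c pCons_0 by blast
      then show False using min[of g1] g1 c by simp
    qed
    define e where "e = lead_coeff g"
    have e0: "e \<noteq> 0" using g by (simp add: e_def)
    obtain p :: nat where p: "Factorial_Ring.prime p" "p > nat \<bar>c * e\<bar>" using bigger_prime by blast
    have "[:int p:] \<notin> I" using min[of "[:int p:]"] d p by force
    then obtain k q where kq: "monom 1 k - q * [:int p:] \<in> I" using inverse by blast
    have ring_id: "a * b - m * x * (- y * z) = a * (b - m * z) + (m * z) * (a + x * y)"
      and ring_id': "a - (x * y) * z = (a - b * y) + y * (b - x * z)"
      for a b m x y z :: "int poly"
      by (simp_all add: algebra_simps)
    \<comment> \<open>Modulo \<open>I\<close> the constant \<open>c\<close> is \<open>- g1\<close>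
      times the variable, so multiplying by \<open>c ^ k\<close> absorbs the power
      \<open>monom 1 k\<close> left by \<open>inverse\<close>.\<close>
    have "\<exists>s. [:c ^ k:] - monom 1 k * s \<in> I"
    proof (induction k)
      case 0
      have "[:c ^ 0:] - monom 1 0 * 1 = 0 * g" by (simp add: monom_0 one_pCons)
      then show ?case using mult[OF g(1), of 0] by metis
    next
      case (Suc k)
      then obtain s where s: "[:c ^ k:] - monom 1 k * s \<in> I" by blast
      have X: "monom 1 (Suc k) = monom 1 k * [:0, 1::int:]" by (simp add: monom_Suc)
      have G: "g = [:c:] + [:0, 1:] * g1" by (simp add: c)
      have C: "[:c ^ Suc k:] = [:c:] * [:c ^ k:]" by simp
      have "[:c ^ Suc k:] - monom 1 (Suc k) * (- g1 * s) = [:c:] * ([:c ^ k:] - monom 1 k * s) + (monom 1 k * s) * g"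
        unfolding X C by (subst G, rule ring_id)
      then show ?case using add[OF mult[OF s] mult[OF g(1)]] by metis
    qed
    then obtain s where s: "[:c ^ k:] - monom 1 k * s \<in> I" by blast
    have "[:c ^ k:] - (q * s) * [:int p:] = ([:c ^ k:] - monom 1 k * s) + s * (monom 1 k - q * [:int p:])"
      by (rule ring_id')
    then have 1: "[:c ^ k:] - (q * s) * [:int p:] \<in> I" using add[OF s mult[OF kq]] by metis
    obtain n q' r where r: "Polynomial.smult (e ^ n) (q * s) = g * q' + r" "r = 0 \<or> degree r < degree g"
      unfolding e_def using pseudo_division[OF g(2)] by blast
    \<comment> \<open>The relation saying that \<open>p\<close> divides \<open>c ^ k\<close> modulo
      \<open>I\<close>, reduced by \<open>g\<close>. Its degree is below the minimum, so it is an
      identity of polynomials, and its constant coefficient contradicts the choice of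
      \<open>p\<close>.\<close>
    define h where "h = [:e ^ n * c ^ k:] - Polynomial.smult (int p) r"
    have "h = Polynomial.smult (e ^ n) ([:c ^ k:] - (q * s) * [:int p:]) + (Polynomial.smult (int p) q') * g"
    proof -
      have "Polynomial.smult (e ^ n) ([:c ^ k:] - (q * s) * [:int p:])
          = [:e ^ n * c ^ k:] - Polynomial.smult (e ^ n) (q * s) * [:int p:]"
        by (simp add: smult_diff_right mult.commute)
      then show ?thesis unfolding r h_def by (simp add: algebra_simps smult_add_right)
    qed
    then have "h \<in> I" using add[OF smult[OF 1] mult[OF g(1)]] by metis
    moreover have "degree h < degree g"
      unfolding h_def using r(2) d by (intro degree_diff_less) (auto intro: le_less_trans[OF degree_smult_le])
    ultimately have "h = 0" using min[of h] by force
    then have "coeff h 0 = 0" by simp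
    then have "e ^ n * c ^ k = int p * coeff r 0" by (simp add: h_def)
    then have "int p dvd e ^ n * c ^ k" by simp
    then have "int p dvd e \<or> int p dvd c"
      using p(1) prime_dvd_power prime_dvd_multD by (metis prime_nat_int_transfer)
    then have "int p dvd c * e" by auto
    then have "int p \<le> \<bar>c * e\<bar>" using c0 e0 by (simp add: zdvd_imp_le)
    then show False using p(2) by linarith
  qed
  then obtain m where m: "g = [:m:]" by (rule degree_eq_zeroE)
  then have "m \<noteq> 0" using g by auto
  moreover have "[:\<bar>m\<bar>:] \<in> I" using g m smult[of g "-1"] by (auto simp: abs_if)
  ultimately show ?thesis by (intro exI[of _ "\<bar>m\<bar>"]) auto
qed

text \<open>Take the least positive constant in \<open>I\<close>. A proper factor \<open>a\<close>
  of it lies outside \<open>I\<close>, hence is invertible up to a power of the variable; cancelling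
  it puts the cofactor \<open>b\<close> into \<open>I\<close>, below the minimum.\<close>

lemma prime_mem: "\<exists>p::int. Factorial_Ring.prime p \<and> [:p:] \<in> I"
proof -
  define m where "m = (LEAST m. m > 0 \<and> [:int m:] \<in> I)"
  have ex: "\<exists>m::nat. m > 0 \<and> [:int m:] \<in> I"
    using const_mem by (metis zero_less_imp_eq_int)
  have m: "m > 0" "[:int m:] \<in> I" using LeastI_ex[OF ex] by (auto simp: m_def)
  have min: "m \<le> n" if "n > 0" "[:int n:] \<in> I" for n using Least_le[of _ n] that unfolding m_def by auto
  have "m \<noteq> 1" using one_notin m by (auto simp: one_pCons)
  have "Factorial_Ring.prime m"
  proof (rule ccontr)
    assume "\<not> Factorial_Ring.prime m"
    then obtain a b where ab: "m = a * b" "a > 1" "b > 1"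
      using m \<open>m \<noteq> 1\<close> by (metis One_nat_def Suc_lessI bot_nat_0.not_eq_extremum dvdE mult_0_right mult_cancel1 mult_is_0 nat_mult_1_right prime_nat_iff nat_neq_iff less_one)
    then have "[:int a:] \<notin> I" using min[of a] by fastforce
    then obtain k q where kq: "monom 1 k - q * [:int a:] \<in> I" using inverse by blast
    have "monom 1 k * [:int b:] = [:int b:] * (monom 1 k - q * [:int a:]) + q * [:int m:]"
      by (simp add: ab algebra_simps smult_diff_right)
    then have "[:int b:] \<in> I" using add[OF mult[OF kq] mult[OF m(2)]] monom_mult_cancel by metis
    then show False using min[of b] ab by fastforce
  qed
  then show ?thesis using m(2) by (intro exI[of _ "int m"]) simp
qed

text \<open>Work over the field with \<open>p\<close> elements, with an element of \<open>I\<close>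
  of least degree that is nonzero modulo \<open>p\<close>. Its leading coefficient is prime to
  \<open>p\<close>, since otherwise the leading term could be dropped; so is its constant
  coefficient, since otherwise it could be dropped and the rest divided by the variable. Bezout then
  turns either coefficient into 1 by adding a multiple of \<open>p\<close>.\<close>

lemma monic_mem: "\<exists>g\<in>I. lead_coeff g = 1"
  and const_one_mem: "\<exists>g\<in>I. coeff g 0 = 1"
proof -
  obtain p :: int where p: "Factorial_Ring.prime p" "[:p:] \<in> I" using prime_mem by blast
  let ?P = "\<lambda>g. g \<in> I \<and> (\<exists>i. \<not> p dvd coeff g i)"
  obtain g0 where g0: "g0 \<in> I" "poly g0 1 = 1" using poly_one_eq_one by blast
  have "\<exists>i. \<not> p dvd coeff g0 i"
  proof (rule ccontr)
    assume "\<not> ?thesis"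
    then have "p dvd poly g0 1" unfolding poly_altdef by (intro dvd_sum) auto
    then show False using g0 p by (metis not_prime_unit)
  qed
  then have ex: "?P g0" using g0 by blast
  obtain g where g: "?P g" and min: "\<And>h. ?P h \<Longrightarrow> degree g \<le> degree h"
    using ex_has_least_nat[of ?P, OF ex, of degree] by blast
  have pI: "monom (v * p) n \<in> I" for v n
    using mult[OF p(2), of "monom v n"] by (simp add: smult_monom mult.commute)
  have bez: "\<exists>u v. u * c + v * p = 1" if "\<not> p dvd c" for c
    using prime_imp_coprime[OF p(1) that] bezout_int[of c p] by (metis coprime_commute coprime_imp_gcd_eq_1)
  have "\<not> p dvd lead_coeff g"
  proof
    assume d: "p dvd lead_coeff g"
    obtain i where i: "\<not> p dvd coeff g i" using g by blast
    then have "i \<noteq> degree g" using d by auto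
    then have deg: "degree g > 0" using i le_degree[of g i] by (cases "coeff g i = 0") auto
    let ?h = "g - monom (lead_coeff g) (degree g)"
    have "?h \<in> I" using diff g pI d by (metis dvd_def mult.commute)
    moreover have "\<not> p dvd coeff ?h i" using i \<open>i \<noteq> degree g\<close> by simp
    ultimately show False using min[of ?h] degree_diff_lead_less[OF deg] by fastforce
  qed
  then obtain u v where uv: "u * lead_coeff g + v * p = 1" using bez by blast
  let ?h = "Polynomial.smult u g + monom (v * p) (degree g)"
  have "coeff ?h (degree g) = 1" using uv by simp
  moreover have "degree ?h \<le> degree g"
    by (intro degree_add_le degree_smult_le degree_monom_le)
  ultimately have "lead_coeff ?h = 1"
    by (metis dual_order.antisym le_degree zero_neq_one)
  then show "\<exists>g\<in>I. lead_coeff g = 1" using add[OF smult pI] g by blast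
  have "\<not> p dvd coeff g 0"
  proof
    assume d: "p dvd coeff g 0"
    obtain c g1 where c: "g = pCons c g1" by (rule pCons_cases)
    then obtain v where v: "c = v * p" using d by (metis coeff_pCons_0 dvdE mult.commute)
    have "pCons 0 g1 = g - monom (v * p) 0" by (simp add: c v monom_0)
    then have "g1 \<in> I" using diff g pI pCons_0 by metis
    moreover obtain i where i: "\<not> p dvd coeff g i" using g by blast
    then obtain j where "i = Suc j" using d by (metis not0_implies_Suc)
    then have "\<not> p dvd coeff g1 j" using i c by simp
    ultimately have "degree g \<le> degree g1" using min by blast
    moreover have "g1 \<noteq> 0" using \<open>\<not> p dvd coeff g1 j\<close> by auto
    ultimately show False using c by simp
  qed
  then obtain u v where uv: "u * coeff g 0 + v * p = 1" using bez by blast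
  let ?h = "Polynomial.smult u g + monom (v * p) 0"
  have "coeff ?h 0 = 1" using uv by simp
  then show "\<exists>g\<in>I. coeff g 0 = 1" using add[OF smult pI] g by blast
qed

text \<open>Shifting the monic \<open>g\<close> beyond the degree of \<open>h\<close> leaves the
  leading coefficient to \<open>g\<close> and the constant coefficient to \<open>h\<close>.\<close>

lemma monic_const_one_mem: "\<exists>g\<in>I. lead_coeff g = 1 \<and> coeff g 0 = 1"
proof -
  obtain g where g: "g \<in> I" "lead_coeff g = 1" using monic_mem by blast
  obtain h where h: "h \<in> I" "coeff h 0 = 1" using const_one_mem by blast
  define n where "n = Suc (degree h)"
  let ?f = "monom 1 n * g + h"
  have g0: "g \<noteq> 0" using g by auto
  have deg: "degree (monom 1 n * g) = n + degree g"
    using g0 by (simp add: degree_mult_eq degree_monom_eq)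
  then have "degree h < degree (monom 1 n * g)" by (simp add: n_def)
  then have "lead_coeff ?f = lead_coeff (monom 1 n * g)" by (metis add.commute lead_coeff_add_le)
  also have "\<dots> = 1" by (simp add: lead_coeff_mult degree_monom_eq g)
  finally have "lead_coeff ?f = 1" .
  moreover have "coeff ?f 0 = 1" using h by (simp add: mult_monom coeff_monom_mult n_def)
  ultimately show ?thesis using add[OF mult[OF g(1)] h(1)] by blast
qed

end

section \<open>Iterated commutator subgroups and nilpotency\<close>

definition cmt :: "('a, 'b) monoid_scheme \<Rightarrow> 'a \<Rightarrow> 'a \<Rightarrow> 'a" where
  "cmt G a b = a \<otimes>\<^bsub>G\<^esub> b \<otimes>\<^bsub>G\<^esub> inv\<^bsub>G\<^esub> a \<otimes>\<^bsub>G\<^esub> inv\<^bsub>G\<^esub> b"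

text \<open>The commutator \<open>[m, x, ..., x]\<close> with \<open>n\<close> entries
  \<open>x\<close>.\<close>

definition engel :: "('a, 'b) monoid_scheme \<Rightarrow> 'a \<Rightarrow> nat \<Rightarrow> 'a \<Rightarrow> 'a" where
  "engel G x n m = ((\<lambda>m. cmt G m x) ^^ n) m"

text \<open>\<open>icomm G L K n\<close> is \<open>[L, K, ..., K]\<close> with \<open>n\<close> factors \<open>K\<close>; the lower central series of a
  subgroup \<open>H\<close> is \<open>icomm G H H\<close>.\<close>
fun icomm :: "('a, 'b) monoid_scheme \<Rightarrow> 'a set \<Rightarrow> 'a set \<Rightarrow> nat \<Rightarrow> 'a set" where
  "icomm G L K 0 = L"
| "icomm G L K (Suc n) = generate G (comm_set G (icomm G L K n) K)"

text \<open>A subgroup only if \<open>x\<close> normalizes \<open>B\<close>.\<close>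
definition cyc_ext :: "('a, 'b) monoid_scheme \<Rightarrow> 'a set \<Rightarrow> 'a \<Rightarrow> 'a set" where
  "cyc_ext G B x = {b \<otimes>\<^bsub>G\<^esub> x [^]\<^bsub>G\<^esub> j | b j. b \<in> B \<and> (j::int) \<in> UNIV}"

lemma comm_set_eq: "comm_set G A B = {cmt G a b | a b. a \<in> A \<and> b \<in> B}"
  by (auto simp: comm_set_def cmt_def)

lemma engel_0 [simp]: "engel G x 0 m = m"
  and engel_Suc: "engel G x (Suc n) m = cmt G (engel G x n m) x"
  by (simp_all add: engel_def)

lemma lower_central_eq_icomm: "lower_central G n = icomm G (carrier G) (carrier G) n"
  by (induction n) auto

context group
begin

lemma cancel_inv_left [simp]:
  "x \<in> carrier G \<Longrightarrow> y \<in> carrier G \<Longrightarrow> x \<otimes> (inv x \<otimes> y) = y"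
  "x \<in> carrier G \<Longrightarrow> y \<in> carrier G \<Longrightarrow> inv x \<otimes> (x \<otimes> y) = y"
  by (simp_all add: m_assoc[symmetric])

lemma cmt_closed [simp, intro]: "a \<in> carrier G \<Longrightarrow> b \<in> carrier G \<Longrightarrow> cmt G a b \<in> carrier G"
  by (simp add: cmt_def)

lemma cmt_mult_eq: "a \<in> carrier G \<Longrightarrow> b \<in> carrier G \<Longrightarrow> cmt G a b \<otimes> (b \<otimes> a) = a \<otimes> b"
  by (simp add: cmt_def m_assoc)

lemma cmt_eq_one_iff: "a \<in> carrier G \<Longrightarrow> b \<in> carrier G \<Longrightarrow> cmt G a b = \<one> \<longleftrightarrow> a \<otimes> b = b \<otimes> a"
  by (metis cmt_closed cmt_mult_eq l_cancel_one m_closed r_cancel_one)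

lemma cmt_inv: "a \<in> carrier G \<Longrightarrow> b \<in> carrier G \<Longrightarrow> inv (cmt G a b) = cmt G b a"
  by (simp add: cmt_def inv_mult_group m_assoc)

lemma cmt_one [simp]: "a \<in> carrier G \<Longrightarrow> cmt G a \<one> = \<one>" "a \<in> carrier G \<Longrightarrow> cmt G \<one> a = \<one>"
  by (simp_all add: cmt_def)

lemma conj_cmt:
  "a \<in> carrier G \<Longrightarrow> b \<in> carrier G \<Longrightarrow> g \<in> carrier G \<Longrightarrow>
   g \<otimes> cmt G a b \<otimes> inv g = cmt G (g \<otimes> a \<otimes> inv g) (g \<otimes> b \<otimes> inv g)"
  by (simp add: cmt_def inv_mult_group m_assoc)

lemma engel_closed [simp, intro]: "x \<in> carrier G \<Longrightarrow> m \<in> carrier G \<Longrightarrow> engel G x n m \<in> carrier G"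
  by (induction n) (auto simp: engel_Suc)

lemma normal_conj: "N \<lhd> G \<Longrightarrow> g \<in> carrier G \<Longrightarrow> n \<in> N \<Longrightarrow> g \<otimes> n \<otimes> inv g \<in> N"
  by (simp add: normal.inv_op_closed2)

lemma normal_conj': "N \<lhd> G \<Longrightarrow> g \<in> carrier G \<Longrightarrow> n \<in> N \<Longrightarrow> inv g \<otimes> n \<otimes> g \<in> N"
  by (simp add: normal.inv_op_closed1)

lemma cmt_in_normal:
  assumes "N \<lhd> G" "n \<in> N" "g \<in> carrier G"
  shows "cmt G n g \<in> N" "cmt G g n \<in> N"
proof -
  interpret N: normal N G by fact
  have n: "n \<in> carrier G" using assms by simp
  have "cmt G n g = n \<otimes> (g \<otimes> inv n \<otimes> inv g)" using n assms by (simp add: cmt_def m_assoc)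
  then show *: "cmt G n g \<in> N" using assms normal_conj[OF assms(1) assms(3), of "inv n"] by simp
  have "cmt G g n = inv (cmt G n g)" using n assms by (simp add: cmt_inv)
  then show "cmt G g n \<in> N" using * by simp
qed

lemma comm_set_incl: "A \<subseteq> carrier G \<Longrightarrow> B \<subseteq> carrier G \<Longrightarrow> comm_set G A B \<subseteq> carrier G"
  by (auto simp: comm_set_eq)

lemma icomm_incl: "L \<subseteq> carrier G \<Longrightarrow> K \<subseteq> carrier G \<Longrightarrow> icomm G L K n \<subseteq> carrier G"
proof (induction n)
  case (Suc n)
  then show ?case using generate_incl[OF comm_set_incl] by simp
qed simp

lemma icomm_subgroup: "subgroup L G \<Longrightarrow> K \<subseteq> carrier G \<Longrightarrow> subgroup (icomm G L K n) G"
  using generate_is_subgroup[OF comm_set_incl[OF icomm_incl]] subgroup.subset[of L G] by (cases n) simp_all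

lemma icomm_mono:
  assumes "L \<subseteq> L'" "K \<subseteq> K'" shows "icomm G L K n \<subseteq> icomm G L' K' n"
proof (induction n)
  case (Suc n)
  then have "comm_set G (icomm G L K n) K \<subseteq> comm_set G (icomm G L' K' n) K'"
    using assms unfolding comm_set_eq by blast
  then show ?case by (simp add: mono_generate)
qed (use assms in simp)

lemma icomm_add: "icomm G L K (m + n) = icomm G (icomm G L K m) K n"
  by (induction n) auto

lemma cmt_in_icomm: "a \<in> icomm G L K n \<Longrightarrow> b \<in> K \<Longrightarrow> cmt G a b \<in> icomm G L K (Suc n)"
  unfolding icomm.simps comm_set_eq by (rule generate.incl) blast

lemma engel_in_icomm: "m \<in> L \<Longrightarrow> x \<in> K \<Longrightarrow> engel G x n m \<in> icomm G L K n"
proof (induction n)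
  case (Suc n)
  then show ?case unfolding engel_Suc using cmt_in_icomm by blast
qed simp

lemma icomm_normal:
  assumes "L \<lhd> G" "K \<lhd> G" shows "icomm G L K n \<lhd> G"
proof (induction n)
  case (Suc n)
  have sub: "icomm G L K n \<subseteq> carrier G" "K \<subseteq> carrier G"
    using Suc assms by (meson normal_imp_subgroup subgroup.subset)+
  show ?case unfolding icomm.simps
  proof (rule normal_generateI)
    show "comm_set G (icomm G L K n) K \<subseteq> carrier G" using sub by (rule comm_set_incl)
    fix h g assume "h \<in> comm_set G (icomm G L K n) K" and g: "g \<in> carrier G"
    then obtain a b where ab: "h = cmt G a b" "a \<in> icomm G L K n" "b \<in> K" by (auto simp: comm_set_eq)
    then have "a \<in> carrier G" "b \<in> carrier G" using sub by auto
    then have "g \<otimes> h \<otimes> inv g = cmt G (g \<otimes> a \<otimes> inv g) (g \<otimes> b \<otimes> inv g)"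
      using ab g by (simp add: conj_cmt)
    then show "g \<otimes> h \<otimes> inv g \<in> comm_set G (icomm G L K n) K"
      using normal_conj[OF Suc g ab(2)] normal_conj[OF assms(2) g ab(3)] by (auto simp: comm_set_eq)
  qed
qed (use assms in simp)

lemma icomm_Suc_subset:
  assumes "subgroup L G" "K \<subseteq> carrier G" "\<And>a b. a \<in> L \<Longrightarrow> b \<in> K \<Longrightarrow> cmt G a b \<in> L"
  shows "icomm G L K (Suc n) \<subseteq> icomm G L K n"
proof (induction n)
  case 0
  have "comm_set G L K \<subseteq> L" using assms(3) by (auto simp: comm_set_eq)
  then show ?case using generate_subgroup_incl[OF _ assms(1)] by simp
next
  case (Suc n)
  have "comm_set G (icomm G L K (Suc n)) K \<subseteq> comm_set G (icomm G L K n) K"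
    using Suc unfolding comm_set_eq by blast
  then show ?case unfolding icomm.simps by (rule mono_generate)
qed

lemma icomm_antimono:
  assumes "subgroup L G" "K \<subseteq> carrier G" "\<And>a b. a \<in> L \<Longrightarrow> b \<in> K \<Longrightarrow> cmt G a b \<in> L" "m \<le> n"
  shows "icomm G L K n \<subseteq> icomm G L K m"
  using lift_Suc_antimono_le[of "icomm G L K", OF icomm_Suc_subset[OF assms(1-3)] assms(4)] by simp

lemma subgroup_cmt: "subgroup H G \<Longrightarrow> a \<in> H \<Longrightarrow> b \<in> H \<Longrightarrow> cmt G a b \<in> H"
  by (simp add: cmt_def subgroup.m_closed subgroup.m_inv_closed)

lemma icomm_Suc_subsetI:
  assumes "subgroup L' G" "\<And>a b. a \<in> icomm G L K n \<Longrightarrow> b \<in> K \<Longrightarrow> cmt G a b \<in> L'"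
  shows "icomm G L K (Suc n) \<subseteq> L'"
proof -
  have "comm_set G (icomm G L K n) K \<subseteq> L'" using assms(2) by (auto simp: comm_set_eq)
  then show ?thesis using generate_subgroup_incl[OF _ assms(1)] by simp
qed

lemma one_in_icomm: "subgroup L G \<Longrightarrow> K \<subseteq> carrier G \<Longrightarrow> \<one> \<in> icomm G L K n"
  using icomm_subgroup subgroup.one_closed by blast

text \<open>Nilpotency of a subgroup is defined in the restricted structure; computing the series in
  \<open>G\<close> makes series of different subgroups comparable.\<close>

lemma lower_central_subgroup_eq:
  assumes "subgroup H G" shows "lower_central (G\<lparr>carrier := H\<rparr>) n = icomm G H H n"
proof (induction n)
  case (Suc n)
  have s: "icomm G H H n \<subseteq> H"
    using icomm_antimono[OF assms _ subgroup_cmt[OF assms], where m = 0 and n = n] subgroup.subset[OF assms] by simp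
  have "comm_set (G\<lparr>carrier := H\<rparr>) (icomm G H H n) H = comm_set G (icomm G H H n) H"
    unfolding comm_set_def using s assms by (auto simp: m_inv_consistent subsetD)
  moreover have "comm_set G (icomm G H H n) H \<subseteq> H"
    using s subgroup_cmt[OF assms] by (auto simp: comm_set_eq)
  ultimately show ?case using Suc generate_consistent[OF _ assms] by simp
qed simp

lemma nilpotent_subgroup_iff:
  "subgroup H G \<Longrightarrow> nilpotent_grp (G\<lparr>carrier := H\<rparr>) \<longleftrightarrow> (\<exists>n. icomm G H H n = {\<one>})"
  by (simp add: nilpotent_grp_def lower_central_subgroup_eq)

lemma nilpotent_iff: "nilpotent_grp G \<longleftrightarrow> (\<exists>n. icomm G (carrier G) (carrier G) n = {\<one>})"
  by (simp add: nilpotent_grp_def lower_central_eq_icomm)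

lemma nilpotent_subgroup_mono:
  assumes "subgroup H G" "subgroup K G" "K \<subseteq> H" "nilpotent_grp (G\<lparr>carrier := H\<rparr>)"
  shows "nilpotent_grp (G\<lparr>carrier := K\<rparr>)"
proof -
  obtain n where "icomm G H H n = {\<one>}" using assms nilpotent_subgroup_iff by blast
  then have "icomm G K K n \<subseteq> {\<one>}" using icomm_mono[OF assms(3) assms(3), of n] by simp
  then have "icomm G K K n = {\<one>}"
    using one_in_icomm[OF assms(2) subgroup.subset[OF assms(2)]] by blast
  then show ?thesis using assms nilpotent_subgroup_iff by blast
qed

lemma not_nilpotent_if_engel:
  assumes "subgroup H G" "x \<in> H" "m \<in> H" "\<And>n. engel G x n m \<noteq> \<one>"
  shows "\<not> nilpotent_grp (G\<lparr>carrier := H\<rparr>)"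
proof
  assume "nilpotent_grp (G\<lparr>carrier := H\<rparr>)"
  then obtain n where "icomm G H H n = {\<one>}" using nilpotent_subgroup_iff[OF assms(1)] by blast
  then show False using engel_in_icomm[OF assms(3,2), of n] assms(4)[of n] by simp
qed

section \<open>Extensions of a subgroup by the powers of an element\<close>

lemma cyc_extI: "b \<in> B \<Longrightarrow> b \<otimes> x [^] (j::int) \<in> cyc_ext G B x"
  by (auto simp: cyc_ext_def)

lemma cyc_extE:
  assumes "y \<in> cyc_ext G B x"
  obtains b and j :: int where "b \<in> B" "y = b \<otimes> x [^] j"
  using assms by (auto simp: cyc_ext_def)

lemma int_pow_conj:
  assumes "x \<in> carrier G" "g \<in> carrier G"
  shows "g \<otimes> x [^] (j::int) \<otimes> inv g = (g \<otimes> x \<otimes> inv g) [^] j"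
proof -
  have n: "g \<otimes> x [^] (n::nat) \<otimes> inv g = (g \<otimes> x \<otimes> inv g) [^] n" for n
  proof (induction n)
    case (Suc n)
    have "g \<otimes> x [^] Suc n \<otimes> inv g = (g \<otimes> x [^] n \<otimes> inv g) \<otimes> (g \<otimes> x \<otimes> inv g)"
      using assms by (simp add: m_assoc)
    then show ?case by (simp add: Suc)
  qed (use assms in simp)
  have "g \<otimes> inv (x [^] (k::nat)) \<otimes> inv g = inv (g \<otimes> x [^] k \<otimes> inv g)" for k
    using assms by (simp add: inv_mult_group m_assoc)
  then show ?thesis using n assms
    by (cases j rule: int_cases2) (simp_all add: int_pow_int int_pow_neg_int)
qed

lemma int_pow_normalizes:
  assumes "subgroup B G" "x \<in> carrier G" "\<And>b. b \<in> B \<Longrightarrow> x \<otimes> b \<otimes> inv x \<in> B"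
    "\<And>b. b \<in> B \<Longrightarrow> inv x \<otimes> b \<otimes> x \<in> B" "b \<in> B"
  shows "x [^] (j::int) \<otimes> b \<otimes> inv (x [^] j) \<in> B"
proof -
  have c: "b \<in> carrier G" if "b \<in> B" for b by (rule subgroup.mem_carrier[OF assms(1) that])
  have 1: "x [^] (n::nat) \<otimes> b \<otimes> inv (x [^] n) \<in> B" if "b \<in> B" for n b
    using that
  proof (induction n arbitrary: b)
    case (Suc n)
    have "x [^] Suc n \<otimes> b \<otimes> inv (x [^] Suc n) = x [^] n \<otimes> (x \<otimes> b \<otimes> inv x) \<otimes> inv (x [^] n)"
      using Suc.prems assms c by (simp add: inv_mult_group m_assoc)
    then show ?case using Suc assms by simp
  qed (use c in simp)
  have 2: "inv (x [^] (n::nat)) \<otimes> b \<otimes> x [^] n \<in> B" if "b \<in> B" for n b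
    using that
  proof (induction n arbitrary: b)
    case (Suc n)
    have "inv (x [^] Suc n) \<otimes> b \<otimes> (x [^] Suc n) = inv x \<otimes> (inv (x [^] n) \<otimes> b \<otimes> (x [^] n)) \<otimes> x"
      using Suc.prems assms c by (simp add: inv_mult_group m_assoc)
    then show ?case using Suc assms by simp
  qed (use c in simp)
  show ?thesis using 1[OF assms(5)] 2[OF assms(5)] assms(2)
    by (cases j rule: int_cases2) (simp_all add: int_pow_int int_pow_neg_int)
qed

lemma cyc_ext_subgroup:
  assumes "subgroup B G" "x \<in> carrier G" "\<And>b. b \<in> B \<Longrightarrow> x \<otimes> b \<otimes> inv x \<in> B"
    "\<And>b. b \<in> B \<Longrightarrow> inv x \<otimes> b \<otimes> x \<in> B"
  shows "subgroup (cyc_ext G B x) G"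
proof -
  interpret B: subgroup B G by fact
  note [simp] = assms(2)
  have cj: "x [^] (j::int) \<otimes> b \<otimes> inv (x [^] j) \<in> B" if "b \<in> B" for j b
    using int_pow_normalizes[OF assms that] by blast
  show ?thesis
  proof (rule subgroupI)
    show "cyc_ext G B x \<subseteq> carrier G" by (auto simp: cyc_ext_def)
    show "cyc_ext G B x \<noteq> {}" using cyc_extI[OF B.one_closed] by blast
  next
    fix a assume "a \<in> cyc_ext G B x"
    then obtain b and j :: int where a: "b \<in> B" "a = b \<otimes> x [^] j" by (rule cyc_extE)
    have "inv a = (x [^] (-j) \<otimes> inv b \<otimes> inv (x [^] (-j))) \<otimes> x [^] (-j)"
      using a by (simp add: inv_mult_group m_assoc int_pow_neg)
    then show "inv a \<in> cyc_ext G B x" using cyc_extI[OF cj[of "inv b" "-j"]] a by simp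
  next
    fix a a' assume "a \<in> cyc_ext G B x" "a' \<in> cyc_ext G B x"
    then obtain b b' and j j' :: int where a: "b \<in> B" "a = b \<otimes> x [^] j" "b' \<in> B" "a' = b' \<otimes> x [^] j'"
      by (auto elim!: cyc_extE)
    have "a \<otimes> a' = (b \<otimes> (x [^] j \<otimes> b' \<otimes> inv (x [^] j))) \<otimes> x [^] (j + j')"
      using a by (simp add: m_assoc int_pow_mult)
    then show "a \<otimes> a' \<in> cyc_ext G B x" using cyc_extI[OF B.m_closed[OF a(1) cj[OF a(3)]]] by metis
  qed
qed

lemma cyc_ext_incl:
  assumes "subgroup B G" "x \<in> carrier G" shows "B \<subseteq> cyc_ext G B x" "x \<in> cyc_ext G B x"
proof -
  show "B \<subseteq> cyc_ext G B x"
  proof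
    fix b assume "b \<in> B"
    then show "b \<in> cyc_ext G B x" using cyc_extI[of b B x 0] subgroup.mem_carrier[OF assms(1)] by simp
  qed
  show "x \<in> cyc_ext G B x"
    using cyc_extI[OF subgroup.one_closed[OF assms(1)], of x 1] assms(2) by simp
qed

lemma derived_eq_generate_cmt: "derived G H = generate G {cmt G a b | a b. a \<in> H \<and> b \<in> H}"
  unfolding derived_def by (rule arg_cong[of _ _ "generate G"]) (auto simp: cmt_def)

lemma cmt_in_derived: "a \<in> H \<Longrightarrow> b \<in> H \<Longrightarrow> cmt G a b \<in> derived G H"
  unfolding derived_eq_generate_cmt by (auto intro: generate.incl)

lemma derived_subsetI:
  "subgroup K G \<Longrightarrow> (\<And>a b. a \<in> H \<Longrightarrow> b \<in> H \<Longrightarrow> cmt G a b \<in> K) \<Longrightarrow> derived G H \<subseteq> K"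
  unfolding derived_eq_generate_cmt by (rule generate_subgroup_incl) auto

lemma normal_sub: "N \<lhd> G \<Longrightarrow> subgroup N G" "N \<lhd> G \<Longrightarrow> N \<subseteq> carrier G"
  using normal_imp_subgroup subgroup.subset by blast+

end

section \<open>Images of iterated commutators\<close>

context group_hom
begin

lemma hom_cmt: "a \<in> carrier G \<Longrightarrow> b \<in> carrier G \<Longrightarrow> h (cmt G a b) = cmt H (h a) (h b)"
  by (simp add: cmt_def)

lemma hom_engel: "x \<in> carrier G \<Longrightarrow> m \<in> carrier G \<Longrightarrow> h (engel G x n m) = engel H (h x) n (h m)"
  by (induction n) (auto simp: engel_Suc hom_cmt)

lemma icomm_img:
  assumes "L \<subseteq> carrier G" "K \<subseteq> carrier G"
  shows "icomm H (h ` L) (h ` K) n = h ` icomm G L K n"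
proof (induction n)
  case (Suc n)
  have s: "icomm G L K n \<subseteq> carrier G" by (rule G.icomm_incl[OF assms])
  have "comm_set H (h ` icomm G L K n) (h ` K) = h ` comm_set G (icomm G L K n) K"
  proof -
    have *: "h (cmt G a b) = cmt H (h a) (h b)" if "a \<in> icomm G L K n" "b \<in> K" for a b
      using that s assms by (intro hom_cmt) auto
    show ?thesis
    proof (intro subset_antisym subsetI)
      fix y assume "y \<in> comm_set H (h ` icomm G L K n) (h ` K)"
      then obtain a b where ab: "y = cmt H (h a) (h b)" "a \<in> icomm G L K n" "b \<in> K"
        unfolding comm_set_eq by blast
      then show "y \<in> h ` comm_set G (icomm G L K n) K"
        unfolding comm_set_eq *[OF ab(2,3), symmetric] ab(1) by blast
    next
      fix y assume "y \<in> h ` comm_set G (icomm G L K n) K"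
      then obtain a b where ab: "y = h (cmt G a b)" "a \<in> icomm G L K n" "b \<in> K"
        unfolding comm_set_eq by blast
      then show "y \<in> comm_set H (h ` icomm G L K n) (h ` K)"
        unfolding comm_set_eq *[OF ab(2,3)] ab(1) by blast
    qed
  qed
  then show ?case
    using Suc generate_img[of "comm_set G (icomm G L K n) K"] G.comm_set_incl[OF s assms(2)] by simp
qed simp

lemma nilpotent_img:
  assumes "subgroup K G" "nilpotent_grp (G\<lparr>carrier := K\<rparr>)"
  shows "nilpotent_grp (H\<lparr>carrier := h ` K\<rparr>)"
proof -
  obtain n where n: "icomm G K K n = {\<one>}" using assms G.nilpotent_subgroup_iff by blast
  have "K \<subseteq> carrier G" using assms subgroup.subset by blast
  then have "icomm H (h ` K) (h ` K) n = {\<one>\<^bsub>H\<^esub>}" using icomm_img[of K K n] n by simp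
  then show ?thesis using H.nilpotent_subgroup_iff subgroup_img_is_subgroup[OF assms(1)] by blast
qed

end

section \<open>Conjugation modules\<close>

text \<open>Action of integer polynomials on an abelian subgroup normalized by \<open>x\<close>, the variable acting as
  conjugation by \<open>x\<close>. The operator \<open>m \<mapsto> [m, x]\<close> is then \<open>T = 1 - X\<close>.\<close>
definition pact :: "('a, 'b) monoid_scheme \<Rightarrow> 'a \<Rightarrow> int poly \<Rightarrow> 'a \<Rightarrow> 'a" where
  "pact G x p b = fold_coeffs (\<lambda>c y. b [^]\<^bsub>G\<^esub> c \<otimes>\<^bsub>G\<^esub> (x \<otimes>\<^bsub>G\<^esub> y \<otimes>\<^bsub>G\<^esub> inv\<^bsub>G\<^esub> x)) p \<one>\<^bsub>G\<^esub>"

lemma (in group) generate_conj_closed: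
  assumes "S \<subseteq> carrier G" "g \<in> carrier G" "\<And>y. y \<in> S \<Longrightarrow> g \<otimes> y \<otimes> inv g \<in> generate G S"
    "y \<in> generate G S"
  shows "g \<otimes> y \<otimes> inv g \<in> generate G S"
proof -
  note sub = generate_is_subgroup[OF assms(1)]
  have c: "y \<in> carrier G" if "y \<in> generate G S" for y using subgroup.mem_carrier[OF sub that] .
  show ?thesis using assms(4)
  proof (induction rule: generate.induct)
    case one
    then show ?case using assms(2) by (simp add: generate.one)
  next
    case (incl h)
    then show ?case using assms(3) by simp
  next
    case (inv h)
    have "g \<otimes> inv h \<otimes> inv g = inv (g \<otimes> h \<otimes> inv g)"
      using inv assms(1,2) by (auto simp: inv_mult_group m_assoc)
    then show ?case using subgroup.m_inv_closed[OF sub assms(3)[OF inv]] by simp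
  next
    case (eng h1 h2)
    have "g \<otimes> (h1 \<otimes> h2) \<otimes> inv g = (g \<otimes> h1 \<otimes> inv g) \<otimes> (g \<otimes> h2 \<otimes> inv g)"
      using c[OF eng(1)] c[OF eng(2)] assms(2) by (simp add: m_assoc)
    then show ?case using eng(3,4) by (simp add: generate.eng)
  qed
qed

locale conj_module = group G for G (structure) +
  fixes A and x
  assumes A_subgroup: "subgroup A G"
    and x_carrier [simp]: "x \<in> carrier G"
    and A_comm: "a \<in> A \<Longrightarrow> b \<in> A \<Longrightarrow> a \<otimes> b = b \<otimes> a"
    and conj_in: "a \<in> A \<Longrightarrow> x \<otimes> a \<otimes> inv x \<in> A"
    and conj_in': "a \<in> A \<Longrightarrow> inv x \<otimes> a \<otimes> x \<in> A"
begin

abbreviation "cx a \<equiv> x \<otimes> a \<otimes> inv x"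
abbreviation "pa \<equiv> pact G x"
abbreviation "T \<equiv> [:1, -1::int:]"

lemma A_carrier [simp]: "a \<in> A \<Longrightarrow> a \<in> carrier G"
  using subgroup.mem_carrier[OF A_subgroup] .

lemma A_mult [simp]: "a \<in> A \<Longrightarrow> b \<in> A \<Longrightarrow> a \<otimes> b \<in> A"
  and A_inv [simp]: "a \<in> A \<Longrightarrow> inv a \<in> A"
  and A_one [simp]: "\<one> \<in> A"
  and A_pow [simp]: "a \<in> A \<Longrightarrow> a [^] (j::int) \<in> A"
  using subgroup.m_closed[OF A_subgroup] subgroup.m_inv_closed[OF A_subgroup]
    subgroup.one_closed[OF A_subgroup] subgroup_int_pow_closed[OF A_subgroup] by auto

lemma A_swap:
  assumes "a \<in> A" "b \<in> A" "c \<in> A" "d \<in> A"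
  shows "(a \<otimes> b) \<otimes> (c \<otimes> d) = (a \<otimes> c) \<otimes> (b \<otimes> d)"
proof -
  have "b \<otimes> c = c \<otimes> b" using A_comm assms by blast
  then have "a \<otimes> (b \<otimes> c) \<otimes> d = a \<otimes> (c \<otimes> b) \<otimes> d" by simp
  then show ?thesis using assms by (simp add: m_assoc)
qed

lemma cx_mult: "a \<in> A \<Longrightarrow> b \<in> A \<Longrightarrow> cx (a \<otimes> b) = cx a \<otimes> cx b"
  by (simp add: m_assoc)

lemma cx_inj: "a \<in> A \<Longrightarrow> cx a = \<one> \<Longrightarrow> a = \<one>"
  using A_carrier x_carrier by (metis inv_closed inv_equality inv_inv l_cancel_one m_closed r_inv inv_solve_right)

lemma pact_0 [simp]: "pa 0 b = \<one>"
  by (simp add: pact_def)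

lemma pact_pCons: "b \<in> A \<Longrightarrow> pa (pCons c p) b = b [^] c \<otimes> cx (pa p b)"
proof (cases "p = 0")
  case True
  assume "b \<in> A"
  then show ?thesis using True
    by (cases "c = 0") (simp_all add: pact_def fold_coeffs_pCons_coeff_not_0_eq)
next
  case False
  then show ?thesis by (simp add: pact_def fold_coeffs_pCons_not_0_0_eq)
qed

lemma pact_in [simp]: "b \<in> A \<Longrightarrow> pa p b \<in> A"
  by (induction p) (simp_all add: pact_pCons conj_in)

lemma pact_add:
  assumes "b \<in> A" shows "pa (p + q) b = pa p b \<otimes> pa q b"
proof (induction p q rule: poly_induct2)
  case (pCons c p d q)
  have "pa (pCons c p + pCons d q) b = (b [^] c \<otimes> b [^] d) \<otimes> (cx (pa p b) \<otimes> cx (pa q b))"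
    using assms pCons by (simp add: pact_pCons int_pow_mult m_assoc)
  also have "\<dots> = (b [^] c \<otimes> cx (pa p b)) \<otimes> (b [^] d \<otimes> cx (pa q b))"
    using assms by (intro A_swap) (auto simp: conj_in)
  finally show ?case using assms by (simp add: pact_pCons)
qed simp

lemma pact_const [simp]: "b \<in> A \<Longrightarrow> pa [:c:] b = b [^] c"
  by (simp add: pact_pCons)

lemma pact_one [simp]: "b \<in> A \<Longrightarrow> pa 1 b = b"
  unfolding one_pCons by simp

lemma pact_pCons_0: "b \<in> A \<Longrightarrow> pa (pCons 0 p) b = cx (pa p b)"
  by (simp add: pact_pCons conj_in)

lemma pact_smult:
  assumes "b \<in> A" shows "pa (smult c p) b = pa p b [^] c"
proof (induction p)
  case (pCons d p)
  have comm: "b [^] d \<otimes> cx (pa p b) = cx (pa p b) \<otimes> b [^] d"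
    using assms by (intro A_comm) (auto simp: conj_in)
  have "pa (smult c (pCons d p)) b = b [^] (d * c) \<otimes> cx (pa p b [^] c)"
    using assms pCons by (simp add: pact_pCons mult.commute)
  also have "\<dots> = (b [^] d) [^] c \<otimes> cx (pa p b) [^] c"
    using assms by (simp add: int_pow_pow int_pow_conj)
  also have "\<dots> = (b [^] d \<otimes> cx (pa p b)) [^] c"
    using assms comm by (intro int_pow_mult_distrib[symmetric]) auto
  finally show ?case using assms by (simp add: pact_pCons)
qed simp

lemma pact_mult:
  assumes "b \<in> A" shows "pa (p * q) b = pa p (pa q b)"
proof (induction p)
  case (pCons c p)
  have "pa (pCons c p * q) b = pa (smult c q) b \<otimes> pa (pCons 0 (p * q)) b"
    using assms by (simp add: pact_add)
  then show ?case using assms pCons by (simp add: pact_smult pact_pCons)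
qed simp

lemma pact_diff_eq_one:
  assumes "b \<in> A" "pa p b = pa q b" shows "pa (p - q) b = \<one>"
proof -
  have "pa (p - q) b \<otimes> pa q b = pa q b" using assms pact_add[of b "p - q" q] by simp
  then show ?thesis using assms(1) by simp
qed

lemma pact_of_one [simp]: "pa p \<one> = \<one>"
  by (induction p) (simp_all add: pact_pCons)

lemma pact_uminus: "b \<in> A \<Longrightarrow> pa (- p) b = inv (pa p b)"
  using pact_smult[of b "-1" p] by (simp add: int_pow_neg)

lemma pact_hom:
  assumes "b \<in> A" "c \<in> A" shows "pa p (b \<otimes> c) = pa p b \<otimes> pa p c"
proof (induction p)
  case (pCons d p)
  have "pa (pCons d p) (b \<otimes> c) = (b [^] d \<otimes> c [^] d) \<otimes> (cx (pa p b) \<otimes> cx (pa p c))"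
    using assms pCons int_pow_mult_distrib[OF A_comm[OF assms], of d] by (simp add: pact_pCons cx_mult)
  also have "\<dots> = (b [^] d \<otimes> cx (pa p b)) \<otimes> (c [^] d \<otimes> cx (pa p c))"
    using assms by (intro A_swap) (auto simp: conj_in)
  finally show ?case using assms by (simp add: pact_pCons)
qed simp

lemma pact_inv: "b \<in> A \<Longrightarrow> pa p (inv b) = inv (pa p b)"
  using pact_hom[of b "inv b" p] by (metis A_carrier A_inv inv_comm inv_equality pact_in pact_of_one r_inv)

lemma pact_cx: "b \<in> A \<Longrightarrow> pa p (cx b) = cx (pa p b)"
proof -
  assume b: "b \<in> A"
  have "cx b = pa [:0, 1:] b" using b by (simp add: pact_pCons)
  then show ?thesis using b by (metis pact_mult mult.commute mult_pCons_left pact_pCons_0 smult_0_left add_0 mult_1 one_pCons)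
qed

lemma pact_monom: "b \<in> A \<Longrightarrow> pa (monom 1 k) b = x [^] k \<otimes> b \<otimes> inv (x [^] k)"
proof (induction k arbitrary: b)
  case 0
  then show ?case by (simp add: monom_0)
next
  case (Suc k)
  have "pa (monom 1 (Suc k)) b = pa (monom 1 k) (cx b)"
    using Suc.prems by (simp add: monom_Suc pact_pCons_0 pact_cx)
  also have "\<dots> = x [^] k \<otimes> cx b \<otimes> inv (x [^] k)" using Suc conj_in by blast
  finally show ?case using Suc.prems by (simp add: m_assoc inv_mult_group)
qed

lemma cmt_eq_pact: "b \<in> A \<Longrightarrow> cmt G b x = pa T b"
  by (simp add: pact_pCons cmt_def int_pow_neg m_assoc)

lemma engel_eq_pact: "b \<in> A \<Longrightarrow> engel G x n b = pa (T ^ n) b"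
proof (induction n)
  case (Suc n)
  then show ?case by (simp add: engel_Suc cmt_eq_pact pact_mult del: mult_pCons_left)
qed simp

text \<open>If the module \<open>S\<close> spanned by \<open>w a\<close> extends to a non-nilpotent group \<open>S\<langle>x\<rangle>\<close>, this group is
  normal, so it contains \<open>[a, x]\<close>; applying \<open>T\<close> once more removes the possible overlap of \<open>\<langle>x\<rangle>\<close>
  with \<open>A\<close>.\<close>
lemma not_nilpotent_span:
  assumes meta: "meta_nil_hamiltonian G" and a: "a \<in> A"
    and ne: "\<And>n. pa (T ^ n * w) a \<noteq> \<one>"
  shows "\<exists>k p. pa (monom 1 k * T ^ 2) a = pa (p * T * w) a"
proof -
  \<comment> \<open>The Laurent submodule generated by \<open>w a\<close>, described without
    negative powers: some shift of \<open>y\<close> is a polynomial multiple of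
    \<open>w a\<close>.\<close>
  define S where "S = {y \<in> A. \<exists>k p. pa (monom 1 k) y = pa (p * w) a}"
  have S: "subgroup S G"
  proof (rule subgroupI)
    show "S \<subseteq> carrier G" by (auto simp: S_def)
    have "pa (monom 1 0) \<one> = pa (0 * w) a" by simp
    then have "\<one> \<in> S" using A_one unfolding S_def by blast
    then show "S \<noteq> {}" by blast
  next
    fix y assume "y \<in> S"
    then obtain k p where y: "y \<in> A" "pa (monom 1 k) y = pa (p * w) a" by (auto simp: S_def)
    have "pa (monom 1 k) (inv y) = pa (- p * w) a" using a y by (simp add: pact_inv pact_uminus)
    then show "inv y \<in> S" using A_inv[OF y(1)] unfolding S_def by blast
  next
    fix y z assume "y \<in> S" "z \<in> S"
    then obtain k p l q where y: "y \<in> A" "pa (monom 1 k) y = pa (p * w) a"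
      and z: "z \<in> A" "pa (monom 1 l) z = pa (q * w) a" by (auto simp: S_def)
    have m: "monom 1 (k + l) = monom 1 l * monom (1::int) k" "monom 1 (k + l) = monom 1 k * monom (1::int) l"
      by (simp_all add: mult_monom add.commute)
    have "pa (monom 1 (k + l)) (y \<otimes> z) = pa (monom 1 l) (pa (monom 1 k) y) \<otimes> pa (monom 1 k) (pa (monom 1 l) z)"
      unfolding pact_hom[OF y(1) z(1)] pact_mult[OF y(1), symmetric] pact_mult[OF z(1), symmetric]
        m(1)[symmetric] m(2)[symmetric] ..
    also have "\<dots> = pa ((monom 1 l * p + monom 1 k * q) * w) a"
      using a y z by (simp add: pact_mult[symmetric] pact_add ring_distribs mult.assoc)
    finally show "y \<otimes> z \<in> S" using A_mult[OF y(1) z(1)] unfolding S_def by blast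
  qed
  have SA: "S \<subseteq> A" by (auto simp: S_def)
  have Sc: "cx y \<in> S" if yS: "y \<in> S" for y
  proof -
    obtain k p where y: "y \<in> A" "pa (monom 1 k) y = pa (p * w) a" using yS by (auto simp: S_def)
    have "pa (monom 1 k) (cx y) = pa (pCons 0 p * w) a" using a y by (simp add: pact_cx pact_pCons_0)
    then show ?thesis using y conj_in unfolding S_def by blast
  qed
  have Sc': "inv x \<otimes> y \<otimes> x \<in> S" if yS: "y \<in> S" for y
  proof -
    obtain k p where y: "y \<in> A" "pa (monom 1 k) y = pa (p * w) a" using yS by (auto simp: S_def)
    have y': "inv x \<otimes> y \<otimes> x \<in> A" using y conj_in' by blast
    have "pa (monom 1 (Suc k)) (inv x \<otimes> y \<otimes> x) = pa (monom 1 k) (cx (inv x \<otimes> y \<otimes> x))"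
      using y' by (simp add: monom_Suc pact_pCons_0 pact_cx)
    also have "cx (inv x \<otimes> y \<otimes> x) = y" using y by (simp add: m_assoc)
    finally show ?thesis using y(2) y' unfolding S_def by auto
  qed
  let ?H = "cyc_ext G S x"
  have H: "subgroup ?H G" by (rule cyc_ext_subgroup[OF S x_carrier Sc Sc'])
  have wa: "pa w a \<in> S"
  proof -
    have "pa (monom 1 0) (pa w a) = pa (1 * w) a" using a by (simp add: monom_0)
    then show ?thesis using pact_in[OF a] unfolding S_def by blast
  qed
  have "\<not> nilpotent_grp (G\<lparr>carrier := ?H\<rparr>)"
  proof (rule not_nilpotent_if_engel[OF H, of x "pa w a"])
    show "engel G x n (pa w a) \<noteq> \<one>" for n
      using ne[of n] a by (simp add: engel_eq_pact pact_mult)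
  qed (use cyc_ext_incl[OF S x_carrier] wa in auto)
  then have "?H \<lhd> G" using meta H unfolding meta_nil_hamiltonian_def by blast
  then have "cmt G a x \<in> ?H" using cmt_in_normal(2)[OF _ cyc_ext_incl(2)[OF S x_carrier]] a by simp
  then obtain s and j :: int where s: "s \<in> S" "cmt G a x = s \<otimes> x [^] j" by (rule cyc_extE)
  have sA: "s \<in> A" using s SA by auto
  have com: "x [^] j \<otimes> x = x \<otimes> x [^] j"
    using int_pow_mult[of x j 1] int_pow_mult[of x 1 j] by (simp add: add.commute)
  have "cmt G (s \<otimes> x [^] j) x = s \<otimes> (x [^] j \<otimes> x) \<otimes> inv (x [^] j) \<otimes> inv s \<otimes> inv x"
    using sA by (simp add: cmt_def inv_mult_group m_assoc)
  also have "\<dots> = cmt G s x" unfolding com using sA by (simp add: cmt_def m_assoc)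
  finally have "cmt G (cmt G a x) x = cmt G s x" using s by simp
  then have 1: "pa (T ^ 2) a = pa T s"
    unfolding cmt_eq_pact[OF a] cmt_eq_pact[OF pact_in[OF a]] cmt_eq_pact[OF sA]
      power2_eq_square pact_mult[OF a] .
  obtain k p where k: "pa (monom 1 k) s = pa (p * w) a" using s by (auto simp: S_def)
  have "pa (monom 1 k * T ^ 2) a = pa (monom 1 k * T) s" 
    by (simp only: pact_mult[OF a] pact_mult[OF sA] 1)
  also have "\<dots> = pa (T * (p * w)) a"
    by (simp only: mult.commute[of "monom 1 k"] pact_mult[OF a, of T] pact_mult[OF sA] k)
  also have "T * (p * w) = p * T * w" by (simp only: mult.left_commute mult.assoc)
  finally show ?thesis by blast
qed

text \<open>Passing from \<open>a\<close> to \<open>[a, x, x]\<close> absorbs the factor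
  \<open>T ^ 2\<close> of \<open>not_nilpotent_span\<close>. That lemma with \<open>w = 1\<close>
  makes \<open>T\<close> invertible up to a power of the variable, so \<open>T\<close> can be
  cancelled in the annihilator. Hence no \<open>T ^ n * w\<close> with \<open>w\<close> outside the
  annihilator lies in it, and the lemma applies to every such \<open>w\<close>.\<close>

lemma laurent_annihilator:
  assumes meta: "meta_nil_hamiltonian G" and a: "a \<in> A" and ne: "\<And>n. engel G x n a \<noteq> \<one>"
  shows "laurent_maximal_ideal {g. pa g (engel G x 2 a) = \<one>}"
proof -
  define b where "b = engel G x 2 a"
  have bT: "b = pa (T ^ 2) a" using a by (simp only: b_def engel_eq_pact)
  then have b: "b \<in> A" using a by simp
  define I where "I = {g. pa g b = \<one>}"
  have add: "g + h \<in> I" if "g \<in> I" "h \<in> I" for g h using that b by (simp add: I_def pact_add)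
  have mult: "q * g \<in> I" if "g \<in> I" for g q using that b by (simp add: I_def pact_mult)
  have pC: "g \<in> I" if "pCons 0 g \<in> I" for g
    using that b cx_inj by (simp add: I_def pact_pCons_0)
  have monC: "g \<in> I" if "monom 1 k * g \<in> I" for g k
    using that
  proof (induction k)
    case (Suc k)
    then show ?case using pC[of "monom 1 k * g"] by (simp add: monom_Suc)
  qed (simp add: monom_0)
  have pb: "pa g b = pa (g * T ^ 2) a" for g using a by (simp only: bT pact_mult)
  have key: "\<exists>k p. monom 1 k - p * T * w \<in> I" if "\<And>n. pa (T ^ n * w) b \<noteq> \<one>" for w
  proof -
    have "pa (T ^ n * (w * T ^ 2)) a \<noteq> \<one>" for n using that[of n] by (simp only: pb mult.assoc) simp
    then obtain k p where "pa (monom 1 k * T ^ 2) a = pa (p * T * (w * T ^ 2)) a"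
      using not_nilpotent_span[OF meta a] by blast
    then have "pa (monom 1 k) b = pa (p * T * w) b" by (simp only: pb mult.assoc)
    then show ?thesis using b pact_diff_eq_one unfolding I_def by blast
  qed
  have "pa (T ^ n * 1) b \<noteq> \<one>" for n
    using ne[of "n + 2"] a unfolding engel_eq_pact[OF a] pb mult_1_right by (simp only: power_add not_False_eq_True)
  then obtain k p where unit: "monom 1 k - p * T \<in> I" using key[of 1] by auto
  have Tc: "g \<in> I" if "T * g \<in> I" for g
  proof -
    have "m * g = g * (m - p * t) + p * (t * g)" for m t :: "int poly" by (simp add: algebra_simps)
    then have "monom 1 k * g = g * (monom 1 k - p * T) + p * (T * g)" .
    then show ?thesis using add[OF mult[OF unit] mult[OF that]] monC by metis
  qed
  have Tn: "g \<in> I" if "T ^ n * g \<in> I" for g n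
    using that
  proof (induction n)
    case (Suc n)
    then show ?case using Tc[of "T ^ n * g"] by (simp only: power_Suc mult.assoc)
  qed simp
  have "laurent_maximal_ideal I"
  proof
    show "1 \<notin> I" using ne[of 2] b by (simp add: I_def b_def)
    show "\<exists>k q. monom 1 k - q * w \<in> I" if "w \<notin> I" for w
      using key[of w] Tn[of _ w] that unfolding I_def by blast
    show "\<exists>k q. monom 1 k - q * T \<in> I" using unit by blast
  qed (use add mult pC in auto)
  then show ?thesis by (simp add: I_def b_def)
qed

text \<open>The torsion alternative is the positive constant contained in a maximal annihilator; it
  collapses when the module is torsion-free.\<close>

lemma engel_eventually_trivial_or_torsion:
  assumes meta: "meta_nil_hamiltonian G" and a: "a \<in> A"
  shows "(\<exists>n. engel G x n a = \<one>) \<or> (\<exists>m::int. m > 0 \<and> engel G x 2 a [^] m = \<one>)"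
proof (cases "\<exists>n. engel G x n a = \<one>")
  case False
  then interpret laurent_maximal_ideal "{g. pa g (engel G x 2 a) = \<one>}"
    using laurent_annihilator[OF meta a] by blast
  have "engel G x 2 a \<in> A" using a by (simp only: engel_eq_pact pact_in)
  then show ?thesis using const_mem by auto
qed simp

text \<open>The polynomial is a power of \<open>T * T\<close> in the unipotent case, and otherwise
  \<open>T * T\<close> times an element of the annihilator of \<open>[a, x, x]\<close>. The leading
  coefficient of \<open>T\<close> is -1, which is why \<open>T\<close> is squared in the first
  case.\<close>

lemma pact_monic:
  assumes meta: "meta_nil_hamiltonian G" and a: "a \<in> A"
  shows "\<exists>g. lead_coeff g = 1 \<and> coeff g 0 = 1 \<and> pa g a = \<one>"
proof (cases "\<exists>n. engel G x n a = \<one>")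
  case True
  then obtain n where n: "pa (T ^ n) a = \<one>" using a by (auto simp: engel_eq_pact)
  have "pa ((T ^ n) * (T ^ n)) a = \<one>" using n a by (simp only: pact_mult pact_of_one)
  then have "pa ((T * T) ^ n) a = \<one>" by (simp only: power_mult_distrib)
  moreover have "lead_coeff ((T * T) ^ n) = 1" unfolding lead_coeff_power by simp
  moreover have "coeff ((T * T) ^ n) 0 = 1" unfolding coeff_0_power by simp
  ultimately show ?thesis by blast
next
  case False
  then interpret laurent_maximal_ideal "{g. pa g (engel G x 2 a) = \<one>}"
    using laurent_annihilator[OF meta a] by blast
  obtain g where g: "lead_coeff g = 1" "coeff g 0 = 1" "pa g (engel G x 2 a) = \<one>"
    using monic_const_one_mem by auto
  have "pa (g * (T * T)) a = \<one>"
    using g(3) a by (simp only: engel_eq_pact pact_mult power2_eq_square)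
  moreover have "lead_coeff (g * (T * T)) = 1" using g(1) unfolding lead_coeff_mult by simp
  moreover have "coeff (g * (T * T)) 0 = 1" using g(2) unfolding coeff_mult_0 by simp
  ultimately show ?thesis by blast
qed

lemma pact_in_span:
  assumes "subgroup S G" "a \<in> A" "\<And>i. i < n \<Longrightarrow> pa (monom 1 i) a \<in> S"
    "\<And>i. i \<ge> n \<Longrightarrow> coeff p i = 0"
  shows "pa p a \<in> S"
  using assms(3,4)
proof (induction n arbitrary: p)
  case 0
  then have "p = 0" by (simp add: poly_eq_iff)
  then show ?case using subgroup.one_closed[OF assms(1)] by simp
next
  case (Suc n)
  let ?q = "p - monom (coeff p n) n"
  have q: "coeff ?q i = 0" if "i \<ge> n" for i
    using that Suc.prems(2)[of i] by (cases "i = n") auto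
  have "pa ?q a \<in> S" by (rule Suc.IH[OF Suc.prems(1) q]) simp_all
  moreover have "pa (monom (coeff p n) n) a \<in> S"
  proof -
    have "monom (coeff p n) n = smult (coeff p n) (monom 1 n)" by (simp add: smult_monom)
    then show ?thesis
      using assms(2) Suc.prems(1)[of n] subgroup_int_pow_closed[OF assms(1)] by (simp add: pact_smult)
  qed
  moreover have "pa p a = pa ?q a \<otimes> pa (monom (coeff p n) n) a"
    using pact_add[OF assms(2), of ?q "monom (coeff p n) n"] by simp
  ultimately show ?case using subgroup.m_closed[OF assms(1)] by simp
qed

text \<open>The leading coefficient 1 expresses high conjugates of \<open>a\<close> by lower ones;
  the constant coefficient 1 expresses \<open>a\<close> by its further conjugates, which takes care
  of the inverse of \<open>x\<close>.\<close>

lemma conj_orbit_finitely_generated: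
  assumes meta: "meta_nil_hamiltonian G" and a: "a \<in> A"
  shows "\<exists>d::nat. \<forall>y\<in>{x [^] i \<otimes> a \<otimes> inv (x [^] i) | i. i \<le> d}.
     x \<otimes> y \<otimes> inv x \<in> generate G {x [^] i \<otimes> a \<otimes> inv (x [^] i) | i. i \<le> d} \<and>
     inv x \<otimes> y \<otimes> x \<in> generate G {x [^] i \<otimes> a \<otimes> inv (x [^] i) | i. i \<le> d}"
proof -
  obtain g where g: "lead_coeff g = 1" "coeff g 0 = 1" "pa g a = \<one>"
    using pact_monic[OF assms] by blast
  define d where "d = degree g"
  let ?E = "{x [^] i \<otimes> a \<otimes> inv (x [^] i) | i. i \<le> d}"
  have E: "?E = {pa (monom 1 i) a | i. i \<le> d}" using a by (simp add: pact_monom)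
  have "?E \<subseteq> carrier G" using a by auto
  then have S: "subgroup (generate G ?E) G" by (rule generate_is_subgroup)
  have mon: "pa (monom 1 n) a \<in> generate G ?E" for n
  proof (induction n rule: less_induct)
    case (less n)
    show ?case
    proof (cases "n \<le> d")
      case True
      then show ?thesis unfolding E by (intro generate.incl) blast
    next
      case False
      \<comment> \<open>The shifted multiple of \<open>g\<close> kills \<open>a\<close> and cancels
        the top coefficient, so only lower conjugates remain.\<close>
      let ?q = "monom 1 n - monom 1 (n - d) * g"
      have "coeff ?q i = 0" if "i \<ge> n" for i
      proof -
        have "i = n \<or> i - (n - d) > degree g" using that False d_def by linarith
        then show ?thesis using that False g(1) by (auto simp: coeff_monom_mult d_def coeff_eq_0)
      qed
      then have "pa ?q a \<in> generate G ?E" using pact_in_span[OF S a less] by blast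
      moreover have "pa (monom 1 n) a = pa ?q a \<otimes> pa (monom 1 (n - d) * g) a"
        using pact_add[OF a, of ?q "monom 1 (n - d) * g"] by simp
      ultimately show ?thesis using a g(3) by (simp add: pact_mult)
    qed
  qed
  have all: "pa p a \<in> generate G ?E" for p
    using pact_in_span[OF S a mon, of "Suc (degree p)" p] by (simp add: coeff_eq_0)
  have "cx y \<in> generate G ?E \<and> inv x \<otimes> y \<otimes> x \<in> generate G ?E" if yE: "y \<in> ?E" for y
  proof -
    obtain i where i: "y = pa (monom 1 i) a" using yE unfolding E by blast
    have 1: "cx y \<in> generate G ?E" using all[of "pCons 0 (monom 1 i)"] a i by (simp add: pact_pCons_0)
    obtain h where h: "g = pCons 1 h" using g(2) by (metis coeff_pCons_0 pCons_cases)
    have sh: "inv x \<otimes> cx z \<otimes> x = z" if "z \<in> A" for z using that by (simp add: m_assoc)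
    have "inv x \<otimes> y \<otimes> x \<in> generate G ?E"
    proof (cases i)
      case 0
      \<comment> \<open>Since \<open>g\<close> is 1 plus the variable times \<open>h\<close>, the
        element \<open>a\<close> is the conjugate by \<open>x\<close> of \<open>pa (- h) a\<close>;
        conjugating back stays in the span.\<close>
      have "a \<otimes> cx (pa h a) = \<one>" using g(3) a h by (simp add: pact_pCons)
      then have "a = inv (cx (pa h a))"
        using a by (intro inv_equality[symmetric]) (auto simp: conj_in)
      then have "a = cx (pa (- h) a)"
        using a by (simp add: pact_uminus inv_mult_group m_assoc)
      then have "inv x \<otimes> a \<otimes> x = pa (- h) a" using sh[of "pa (- h) a"] a by simp
      then show ?thesis using all[of "- h"] i 0 a by (simp add: monom_0)
    next
      case (Suc k)
      then have "y = cx (pa (monom 1 k) a)" using i a by (simp add: monom_Suc pact_pCons_0)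
      then show ?thesis using sh[of "pa (monom 1 k) a"] all[of "monom 1 k"] a by simp
    qed
    with 1 show ?thesis by blast
  qed
  then show ?thesis by blast
qed

end

section \<open>Finite generation of conjugation closures\<close>

definition conj_closure :: "('a, 'b) monoid_scheme \<Rightarrow> 'a \<Rightarrow> 'a \<Rightarrow> 'a set" where
  "conj_closure G x y =
     generate G {x [^]\<^bsub>G\<^esub> j \<otimes>\<^bsub>G\<^esub> y \<otimes>\<^bsub>G\<^esub> inv\<^bsub>G\<^esub> (x [^]\<^bsub>G\<^esub> j) | j. (j::int) \<in> UNIV}"

text \<open>The conjugation closure of \<open>y\<close> under \<open>x\<close> is finitely generated modulo \<open>B\<close>, with generators
  inside the closure itself.\<close>
definition fg_conj_mod :: "('a, 'b) monoid_scheme \<Rightarrow> 'a set \<Rightarrow> 'a \<Rightarrow> 'a \<Rightarrow> bool" where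
  "fg_conj_mod G B x y \<longleftrightarrow> (\<exists>F. finite F \<and> y \<in> F \<and> F \<subseteq> conj_closure G x y \<and>
     (\<forall>f\<in>F. x \<otimes>\<^bsub>G\<^esub> f \<otimes>\<^bsub>G\<^esub> inv\<^bsub>G\<^esub> x \<in> generate G (F \<union> B) \<and>
            inv\<^bsub>G\<^esub> x \<otimes>\<^bsub>G\<^esub> f \<otimes>\<^bsub>G\<^esub> x \<in> generate G (F \<union> B)))"

definition fgs :: "('a, 'b) monoid_scheme \<Rightarrow> 'a set \<Rightarrow> bool" where
  "fgs G H \<longleftrightarrow> (\<exists>S. finite S \<and> S \<subseteq> carrier G \<and> generate G S = H)"

text \<open>A polycyclic series without factor groups: that \<open>H\<close> is cyclic over
  \<open>K\<close> is expressed by products \<open>k t ^ j\<close>, so subgroups and images are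
  handled by computing with elements.\<close>

inductive pcs :: "('a, 'b) monoid_scheme \<Rightarrow> 'a set \<Rightarrow> bool" for G where
  trivial: "pcs G {\<one>\<^bsub>G\<^esub>}"
| step: "\<lbrakk> pcs G K; subgroup H G; K \<subseteq> H;
    \<And>h k. h \<in> H \<Longrightarrow> k \<in> K \<Longrightarrow> h \<otimes>\<^bsub>G\<^esub> k \<otimes>\<^bsub>G\<^esub> inv\<^bsub>G\<^esub> h \<in> K; t \<in> H; H \<subseteq> cyc_ext G K t \<rbrakk> \<Longrightarrow> pcs G H"

lemma int_subgroup_principal:
  fixes J :: "int set"
  assumes "0 \<in> J" "\<And>a b. a \<in> J \<Longrightarrow> b \<in> J \<Longrightarrow> a - b \<in> J"
  shows "\<exists>m\<in>J. \<forall>j\<in>J. m dvd j"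
proof (cases "J = {0}")
  case False
  then obtain a where a: "a \<in> J" "a \<noteq> 0" using assms(1) by blast
  have "\<bar>a\<bar> \<in> J" using assms(2)[OF assms(1) a(1)] a(1) by (simp add: abs_if)
  then have "\<exists>n. 0 < n \<and> int n \<in> J" using a(2) by (intro exI[of _ "nat \<bar>a\<bar>"]) simp
  then obtain n where n: "0 < n" "int n \<in> J" and min: "\<And>k. 0 < k \<Longrightarrow> int k \<in> J \<Longrightarrow> n \<le> k"
    using exists_least_iff[of "\<lambda>n. 0 < n \<and> int n \<in> J"] by (metis not_le)
  have mul: "int n * int k \<in> J" for k
  proof (induction k)
    case (Suc k)
    have "int n * int k - (0 - int n) \<in> J" using assms(2)[OF Suc assms(2)[OF assms(1) n(2)]] .
    then show ?case by (simp add: algebra_simps)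
  qed (use assms(1) in simp)
  have mulz: "int n * k \<in> J" for k
    using mul[of "nat k"] assms(2)[OF assms(1) mul[of "nat (- k)"]] by (cases "k \<ge> 0") auto
  have "int n dvd j" if "j \<in> J" for j
  proof (rule ccontr)
    assume nd: "\<not> int n dvd j"
    have "j - int n * (j div int n) = j mod int n" by (simp add: minus_mult_div_eq_mod)
    then have "j mod int n \<in> J" using assms(2)[OF that mulz] by metis
    moreover have "j mod int n \<noteq> 0" using nd by (simp add: dvd_eq_mod_eq_0)
    moreover have "0 \<le> j mod int n" "j mod int n < int n" using n(1) by simp_all
    ultimately show False using min[of "nat (j mod int n)"] by auto
  qed
  then show ?thesis using n(2) by blast
qed simp

section \<open>Preimages, images and quotients\<close>

lemma (in group_hom) vimage_subgroup:
  assumes "subgroup K H" shows "subgroup {g \<in> carrier G. h g \<in> K} G"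
proof (rule G.subgroupI)
  show "{g \<in> carrier G. h g \<in> K} \<noteq> {}" using subgroup.one_closed[OF assms] by auto
qed (use subgroup.m_closed[OF assms] subgroup.m_inv_closed[OF assms] in auto)

lemma (in group_hom) vimage_normal:
  assumes "K \<lhd> H" shows "{g \<in> carrier G. h g \<in> K} \<lhd> G"
proof (rule G.normal_invI[OF vimage_subgroup[OF normal_imp_subgroup[OF assms]]])
  fix x g assume "x \<in> carrier G" "g \<in> {g \<in> carrier G. h g \<in> K}"
  then show "x \<otimes> g \<otimes> inv x \<in> {g \<in> carrier G. h g \<in> K}"
    using H.normal_conj[OF assms, of "h x" "h g"] by simp
qed

lemma (in group_hom) normal_img:
  assumes "h ` carrier G = carrier H" "N \<lhd> G" shows "h ` N \<lhd> H"
proof (rule H.normal_invI)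
  show "subgroup (h ` N) H" by (rule subgroup_img_is_subgroup[OF G.normal_sub(1)[OF assms(2)]])
  fix y k assume "y \<in> carrier H" "k \<in> h ` N"
  then obtain g n where g: "g \<in> carrier G" "y = h g" and n: "n \<in> N" "k = h n" using assms(1) by blast
  then have nc: "n \<in> carrier G" using G.normal_sub(2)[OF assms(2)] by blast
  have "y \<otimes>\<^bsub>H\<^esub> k \<otimes>\<^bsub>H\<^esub> inv\<^bsub>H\<^esub> y = h (g \<otimes> n \<otimes> inv g)" using g n nc by simp
  then show "y \<otimes>\<^bsub>H\<^esub> k \<otimes>\<^bsub>H\<^esub> inv\<^bsub>H\<^esub> y \<in> h ` N" using G.normal_conj[OF assms(2) g(1) n(1)] by simp
qed

text \<open>The preimage of a non-nilpotent subgroup maps onto it, so it is itself non-nilpotent and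
  hence normal.\<close>

lemma (in group_hom) meta_nil_hamiltonian_img:
  assumes surj: "h ` carrier G = carrier H" and meta: "meta_nil_hamiltonian G"
  shows "meta_nil_hamiltonian H"
  unfolding meta_nil_hamiltonian_def
proof (intro allI impI)
  fix K assume K: "subgroup K H" "\<not> nilpotent_grp (H\<lparr>carrier := K\<rparr>)"
  let ?P = "{g \<in> carrier G. h g \<in> K}"
  have P: "subgroup ?P G" by (rule vimage_subgroup[OF K(1)])
  have im: "h ` ?P = K" using surj subgroup.subset[OF K(1)] by auto
  then have "\<not> nilpotent_grp (G\<lparr>carrier := ?P\<rparr>)" using nilpotent_img[OF P] K(2) by auto
  then have "?P \<lhd> G" using meta P unfolding meta_nil_hamiltonian_def by blast
  then show "K \<lhd> H" using normal_img[OF surj, of ?P] im by simp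
qed

lemma (in group_hom) hom_eq_iff:
  assumes "a \<in> carrier G" "b \<in> carrier G"
  shows "h a = h b \<longleftrightarrow> h (a \<otimes> inv b) = \<one>\<^bsub>H\<^esub>"
proof
  assume "h (a \<otimes> inv b) = \<one>\<^bsub>H\<^esub>"
  then have "h ((a \<otimes> inv b) \<otimes> b) = h b" using assms by (simp only: hom_mult[of "a \<otimes> inv b" b] G.m_closed G.inv_closed) simp
  then show "h a = h b" using assms by (simp add: G.m_assoc)
qed (use assms in simp)

lemma (in group) quotient_hom:
  assumes "N \<lhd> G"
  shows "group_hom G (G Mod N) (\<lambda>a. N #> a)" "(\<lambda>a. N #> a) ` carrier G = carrier (G Mod N)"
    "a \<in> carrier G \<Longrightarrow> N #> a = \<one>\<^bsub>G Mod N\<^esub> \<longleftrightarrow> a \<in> N"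
proof -
  interpret N: normal N G by fact
  show "group_hom G (G Mod N) (\<lambda>a. N #> a)"
    using N.r_coset_hom_Mod N.factorgroup_is_group by (simp add: group_hom_def group_hom_axioms_def)
  show "(\<lambda>a. N #> a) ` carrier G = carrier (G Mod N)" by (simp add: carrier_FactGroup)
  show "a \<in> carrier G \<Longrightarrow> N #> a = \<one>\<^bsub>G Mod N\<^esub> \<longleftrightarrow> a \<in> N"
    using coset_join1[OF _ _ N.subgroup_axioms, of a] coset_join2[OF _ N.subgroup_axioms, of a] by auto
qed

lemma (in group) quotient_eq_iff:
  assumes "N \<lhd> G" "a \<in> carrier G" "b \<in> carrier G"
  shows "N #> a = N #> b \<longleftrightarrow> a \<otimes> inv b \<in> N"
proof -
  interpret q: group_hom G "G Mod N" "\<lambda>a. N #> a" using quotient_hom(1)[OF assms(1)] .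
  show ?thesis
    using q.hom_eq_iff[OF assms(2,3)] quotient_hom(3)[OF assms(1), of "a \<otimes> inv b"] assms(2,3) by simp
qed

context group
begin

lemma conj_orbit_incl: "x \<in> carrier G \<Longrightarrow> y \<in> carrier G \<Longrightarrow> {x [^] j \<otimes> y \<otimes> inv (x [^] j) | j. (j::int) \<in> UNIV} \<subseteq> carrier G"
  by auto

lemma conj_closure_subgroup: "x \<in> carrier G \<Longrightarrow> y \<in> carrier G \<Longrightarrow> subgroup (conj_closure G x y) G"
  unfolding conj_closure_def by (rule generate_is_subgroup[OF conj_orbit_incl])

lemma conj_closure_orbit: "x [^] (j::int) \<otimes> y \<otimes> inv (x [^] j) \<in> conj_closure G x y"
  unfolding conj_closure_def by (rule generate.incl) blast

lemma conj_closure_self: "x \<in> carrier G \<Longrightarrow> y \<in> carrier G \<Longrightarrow> y \<in> conj_closure G x y"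
  using conj_closure_orbit[of x 0 y] by simp

lemma conj_closure_conj:
  assumes "x \<in> carrier G" "y \<in> carrier G" "z \<in> conj_closure G x y"
  shows "x [^] (k::int) \<otimes> z \<otimes> inv (x [^] k) \<in> conj_closure G x y"
  unfolding conj_closure_def
proof (rule generate_conj_closed[OF conj_orbit_incl[OF assms(1,2)]])
  show "x [^] k \<in> carrier G" using assms by simp
  show "z \<in> generate G {x [^] j \<otimes> y \<otimes> inv (x [^] j) | j. (j::int) \<in> UNIV}"
    using assms(3) unfolding conj_closure_def .
  fix w assume "w \<in> {x [^] j \<otimes> y \<otimes> inv (x [^] j) | j. (j::int) \<in> UNIV}"
  then obtain j :: int where j: "w = x [^] j \<otimes> y \<otimes> inv (x [^] j)" by blast
  have "x [^] k \<otimes> w \<otimes> inv (x [^] k) = x [^] (k + j) \<otimes> y \<otimes> inv (x [^] (k + j))"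
    using assms j by (simp add: int_pow_mult inv_mult_group m_assoc)
  then show "x [^] k \<otimes> w \<otimes> inv (x [^] k) \<in> generate G {x [^] j \<otimes> y \<otimes> inv (x [^] j) | j. (j::int) \<in> UNIV}"
    using conj_closure_orbit[of x "k + j" y] unfolding conj_closure_def by simp
qed

lemma conj_closure_conj_one:
  assumes "x \<in> carrier G" "y \<in> carrier G" "z \<in> conj_closure G x y"
  shows "x \<otimes> z \<otimes> inv x \<in> conj_closure G x y" "inv x \<otimes> z \<otimes> x \<in> conj_closure G x y"
  using conj_closure_conj[OF assms, of 1] conj_closure_conj[OF assms, of "-1"] assms(1)
  by (simp_all add: int_pow_neg)

lemma conj_closure_least:
  assumes "x \<in> carrier G" "subgroup S G" "y \<in> S" "\<And>b. b \<in> S \<Longrightarrow> x \<otimes> b \<otimes> inv x \<in> S"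
    "\<And>b. b \<in> S \<Longrightarrow> inv x \<otimes> b \<otimes> x \<in> S"
  shows "conj_closure G x y \<subseteq> S"
  unfolding conj_closure_def using int_pow_normalizes[OF assms(2,1,4,5,3)]
  by (intro generate_subgroup_incl[OF _ assms(2)]) auto

text \<open>\<open>B\<close> becomes an abelian normal subgroup of \<open>G Mod C\<close>, where
  \<open>conj_orbit_finitely_generated\<close> applies. The conjugates of \<open>b\<close> by
  \<open>x ^ i\<close>, \<open>i\<close> up to \<open>d\<close>, lift its generators, and lifting
  the relations costs only elements of \<open>C\<close>.\<close>

lemma fg_conj_mod_abelian:
  assumes meta: "meta_nil_hamiltonian G" and B: "B \<lhd> G" and C: "C \<lhd> G"
    and ab: "\<And>a b. a \<in> B \<Longrightarrow> b \<in> B \<Longrightarrow> cmt G a b \<in> C" and x: "x \<in> carrier G" and b: "b \<in> B"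
  shows "fg_conj_mod G C x b"
proof -
  define h where "h = (\<lambda>a. C #> a)"
  define Q where "Q = G Mod C"
  interpret q: group_hom G Q h using quotient_hom(1)[OF C] unfolding h_def Q_def .
  have surj: "h ` carrier G = carrier Q" using quotient_hom(2)[OF C] unfolding h_def Q_def .
  have ker: "h g = \<one>\<^bsub>Q\<^esub>" if "g \<in> C" for g
    using quotient_hom(3)[OF C, of g] normal_sub(2)[OF C] that unfolding h_def Q_def by blast
  have Bc: "a \<in> carrier G" if "a \<in> B" for a using normal_sub(2)[OF B] that by blast
  have Q: "conj_module Q (h ` B) (h x)"
  proof (rule conj_module.intro[OF q.H.is_group conj_module_axioms.intro])
    show "subgroup (h ` B) Q" using q.subgroup_img_is_subgroup[OF normal_sub(1)[OF B]] .
    show "h x \<in> carrier Q" using x by simp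
    show "a \<otimes>\<^bsub>Q\<^esub> b = b \<otimes>\<^bsub>Q\<^esub> a" if a: "a \<in> h ` B" and b: "b \<in> h ` B" for a b
    proof -
      obtain a' b' where a': "a' \<in> B" "a = h a'" and b': "b' \<in> B" "b = h b'" using a b by blast
      have "h (cmt G a' b') = \<one>\<^bsub>Q\<^esub>"
        using ker[OF ab[OF a'(1) b'(1)]] .
      then show ?thesis using a' b' Bc q.H.cmt_eq_one_iff[of a b] q.hom_cmt[of a' b'] by simp
    qed
    show "h x \<otimes>\<^bsub>Q\<^esub> a \<otimes>\<^bsub>Q\<^esub> inv\<^bsub>Q\<^esub> h x \<in> h ` B" if a: "a \<in> h ` B" for a
    proof -
      obtain a' where a': "a' \<in> B" "a = h a'" using a by blast
      have "h x \<otimes>\<^bsub>Q\<^esub> a \<otimes>\<^bsub>Q\<^esub> inv\<^bsub>Q\<^esub> h x = h (x \<otimes> a' \<otimes> inv x)" using x a' Bc by simp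
      then show ?thesis using normal_conj[OF B x a'(1)] by blast
    qed
    show "inv\<^bsub>Q\<^esub> h x \<otimes>\<^bsub>Q\<^esub> a \<otimes>\<^bsub>Q\<^esub> h x \<in> h ` B" if a: "a \<in> h ` B" for a
    proof -
      obtain a' where a': "a' \<in> B" "a = h a'" using a by blast
      have "inv\<^bsub>Q\<^esub> h x \<otimes>\<^bsub>Q\<^esub> a \<otimes>\<^bsub>Q\<^esub> h x = h (inv x \<otimes> a' \<otimes> x)" using x a' Bc by simp
      then show ?thesis using normal_conj'[OF B x a'(1)] by blast
    qed
  qed
  interpret Q: conj_module Q "h ` B" "h x" by (rule Q)
  have metaQ: "meta_nil_hamiltonian Q" by (rule q.meta_nil_hamiltonian_img[OF surj meta])
  have hb: "h b \<in> h ` B" using b by blast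
  let ?E = "\<lambda>d. {h x [^]\<^bsub>Q\<^esub> i \<otimes>\<^bsub>Q\<^esub> h b \<otimes>\<^bsub>Q\<^esub> inv\<^bsub>Q\<^esub> (h x [^]\<^bsub>Q\<^esub> i) | i. i \<le> d}"
  obtain d :: nat where d: "\<And>y. y \<in> ?E d \<Longrightarrow>
      h x \<otimes>\<^bsub>Q\<^esub> y \<otimes>\<^bsub>Q\<^esub> inv\<^bsub>Q\<^esub> h x \<in> generate Q (?E d)
      \<and> inv\<^bsub>Q\<^esub> h x \<otimes>\<^bsub>Q\<^esub> y \<otimes>\<^bsub>Q\<^esub> h x \<in> generate Q (?E d)"
    using Q.conj_orbit_finitely_generated[OF metaQ hb] by blast
  define F where "F = (\<lambda>i. x [^] i \<otimes> b \<otimes> inv (x [^] i)) ` {..d}"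
  have Fc: "F \<subseteq> carrier G" using x Bc[OF b] unfolding F_def by auto
  have "h (x [^] i \<otimes> b \<otimes> inv (x [^] i)) = h x [^]\<^bsub>Q\<^esub> i \<otimes>\<^bsub>Q\<^esub> h b \<otimes>\<^bsub>Q\<^esub> inv\<^bsub>Q\<^esub> (h x [^]\<^bsub>Q\<^esub> i)" for i :: nat
    using x Bc[OF b] by (simp add: q.hom_nat_pow)
  then have hF: "h ` F = ?E d" unfolding F_def image_image by auto
  have lift: "g \<in> generate G (F \<union> C)" if g: "g \<in> carrier G" "h g \<in> generate Q (?E d)" for g
  proof -
    have "h g \<in> h ` generate G F" using g(2) q.generate_img[OF Fc] hF by simp
    then obtain u where u: "u \<in> generate G F" "h g = h u" by blast
    have uc: "u \<in> carrier G" using generate_in_carrier[OF Fc u(1)] .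
    have "g \<otimes> inv u \<in> C" using quotient_eq_iff[OF C g(1) uc] u(2) unfolding h_def by simp
    then have 1: "g \<otimes> inv u \<in> generate G (F \<union> C)" by (simp add: generate.incl)
    have 2: "u \<in> generate G (F \<union> C)" using mono_generate[of F "F \<union> C"] u(1) by blast
    have "g = (g \<otimes> inv u) \<otimes> u" using g uc by (simp add: m_assoc)
    then show ?thesis using generate.eng[OF 1 2] by simp
  qed
  show ?thesis unfolding fg_conj_mod_def
  proof (intro exI[of _ F] conjI ballI)
    show "finite F" by (simp add: F_def)
    show "b \<in> F" unfolding F_def using Bc[OF b] by (intro image_eqI[of _ _ 0]) auto
    show "F \<subseteq> conj_closure G x b"
    proof
      fix f assume "f \<in> F"
      then obtain i :: nat where "f = x [^] i \<otimes> b \<otimes> inv (x [^] i)" unfolding F_def by blast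
      then show "f \<in> conj_closure G x b" using conj_closure_orbit[of x "int i" b] by (simp add: int_pow_int)
    qed
  next
    fix f assume f: "f \<in> F"
    then have fc: "f \<in> carrier G" and hf: "h f \<in> ?E d" using Fc hF by blast+
    show "x \<otimes> f \<otimes> inv x \<in> generate G (F \<union> C)" using lift[of "x \<otimes> f \<otimes> inv x"] d[OF hf] x fc by simp
    show "inv x \<otimes> f \<otimes> x \<in> generate G (F \<union> C)" using lift[of "inv x \<otimes> f \<otimes> x"] d[OF hf] x fc by simp
  qed
qed

lemma generate_Un_normal:
  assumes "F \<subseteq> carrier G" "B \<lhd> G" "g \<in> generate G (F \<union> B)"
  shows "\<exists>u\<in>generate G F. \<exists>b\<in>B. g = u \<otimes> b"
proof -
  interpret B: normal B G by fact
  note subF = generate_is_subgroup[OF assms(1)]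
  have c: "u \<in> carrier G" if "u \<in> generate G F" for u using generate_in_carrier[OF assms(1) that] .
  have FB: "F \<union> B \<subseteq> carrier G" using assms(1) B.subset by blast
  show ?thesis using assms(3)
  proof (induction rule: generate.induct)
    case one
    have "\<one> = \<one> \<otimes> \<one>" by simp
    then show ?case using generate.one[of G F] B.one_closed by blast
  next
    case (incl h)
    then show ?case
    proof
      assume "h \<in> F"
      then have "h = h \<otimes> \<one>" "h \<in> generate G F" using assms(1) by (auto intro: generate.incl)
      then show ?thesis using B.one_closed by blast
    next
      assume "h \<in> B"
      then have "h = \<one> \<otimes> h" "h \<in> B" by auto
      then show ?thesis using generate.one[of G F] by blast
    qed
  next
    case (inv h)
    then show ?case
    proof
      assume "h \<in> F"
      then have "inv h = inv h \<otimes> \<one>" "inv h \<in> generate G F" using assms(1) by (auto intro: generate.inv)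
      then show ?thesis using B.one_closed by blast
    next
      assume "h \<in> B"
      then have "inv h = \<one> \<otimes> inv h" "inv h \<in> B" by auto
      then show ?thesis using generate.one[of G F] by blast
    qed
  next
    case (eng h1 h2)
    then obtain u b v e where h: "u \<in> generate G F" "b \<in> B" "h1 = u \<otimes> b" "v \<in> generate G F" "e \<in> B" "h2 = v \<otimes> e" by blast
    have "h1 \<otimes> h2 = (u \<otimes> v) \<otimes> ((inv v \<otimes> b \<otimes> v) \<otimes> e)" using h c B.subset by (simp add: m_assoc)
    moreover have "(inv v \<otimes> b \<otimes> v) \<otimes> e \<in> B" using h c normal_conj'[OF assms(2), of v b] by simp
    ultimately show ?case using generate.eng[OF h(1,4)] by blast
  qed
qed

text \<open>The finitely many relations modulo \<open>B\<close> leave finitely many correction terms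
  in \<open>B\<close>. As the generators lie in the closure of \<open>y\<close>, so do the
  corrections, and so do their own conjugation closures. Adjoining generators of the latter modulo
  \<open>C\<close> turns the relations into relations modulo \<open>C\<close>.\<close>

lemma fg_conj_mod_step:
  assumes meta: "meta_nil_hamiltonian G" and B: "B \<lhd> G" and C: "C \<lhd> G"
    and ab: "\<And>a b. a \<in> B \<Longrightarrow> b \<in> B \<Longrightarrow> cmt G a b \<in> C" and x: "x \<in> carrier G" and y: "y \<in> carrier G"
    and fg: "fg_conj_mod G B x y"
  shows "fg_conj_mod G C x y"
proof -
  obtain F where F: "finite F" "y \<in> F" "F \<subseteq> conj_closure G x y"
    and cl: "\<And>f. f \<in> F \<Longrightarrow> x \<otimes> f \<otimes> inv x \<in> generate G (F \<union> B)"
      "\<And>f. f \<in> F \<Longrightarrow> inv x \<otimes> f \<otimes> x \<in> generate G (F \<union> B)"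
    using fg unfolding fg_conj_mod_def by blast
  note Y = conj_closure_subgroup[OF x y]
  have Fc: "F \<subseteq> carrier G" using F(3) subgroup.subset[OF Y] by blast
  have gF: "generate G F \<subseteq> conj_closure G x y" by (rule generate_subgroup_incl[OF F(3) Y])
  have Bc: "b \<in> carrier G" if "b \<in> B" for b using normal_sub(2)[OF B] that by blast
  have dec: "\<exists>b. b \<in> B \<inter> conj_closure G x y \<and> g \<otimes> inv b \<in> generate G F"
    if g: "g \<in> generate G (F \<union> B)" "g \<in> conj_closure G x y" for g
  proof -
    obtain u b where u: "u \<in> generate G F" "b \<in> B" "g = u \<otimes> b" using generate_Un_normal[OF Fc B g(1)] by blast
    have uc: "u \<in> carrier G" using generate_in_carrier[OF Fc u(1)] .
    have "b = inv u \<otimes> g" using u Bc uc by simp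
    then have "b \<in> conj_closure G x y"
      using subgroup.m_closed[OF Y subgroup.m_inv_closed[OF Y] g(2)] gF u(1) by blast
    moreover have "g \<otimes> inv b = u" using u Bc uc by (simp add: m_assoc)
    ultimately show ?thesis using u by blast
  qed
  have "\<exists>b. b \<in> B \<inter> conj_closure G x y \<and> (x \<otimes> f \<otimes> inv x) \<otimes> inv b \<in> generate G F" if "f \<in> F" for f
    using dec[OF cl(1)[OF that]] conj_closure_conj_one(1)[OF x y] F(3) that by blast
  then obtain p where p: "\<And>f. f \<in> F \<Longrightarrow> p f \<in> B \<inter> conj_closure G x y"
    "\<And>f. f \<in> F \<Longrightarrow> (x \<otimes> f \<otimes> inv x) \<otimes> inv (p f) \<in> generate G F" by metis
  have "\<exists>b. b \<in> B \<inter> conj_closure G x y \<and> (inv x \<otimes> f \<otimes> x) \<otimes> inv b \<in> generate G F" if "f \<in> F" for f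
    using dec[OF cl(2)[OF that]] conj_closure_conj_one(2)[OF x y] F(3) that by blast
  then obtain q where q: "\<And>f. f \<in> F \<Longrightarrow> q f \<in> B \<inter> conj_closure G x y"
    "\<And>f. f \<in> F \<Longrightarrow> (inv x \<otimes> f \<otimes> x) \<otimes> inv (q f) \<in> generate G F" by metis
  define P where "P = p ` F \<union> q ` F"
  have P: "finite P" "P \<subseteq> B" "P \<subseteq> conj_closure G x y" using p q F(1) unfolding P_def by auto
  have "\<forall>b\<in>P. \<exists>E. finite E \<and> b \<in> E \<and> E \<subseteq> conj_closure G x b \<and>
     (\<forall>f\<in>E. x \<otimes> f \<otimes> inv x \<in> generate G (E \<union> C) \<and> inv x \<otimes> f \<otimes> x \<in> generate G (E \<union> C))"
    using fg_conj_mod_abelian[OF meta B C ab x] P(2) unfolding fg_conj_mod_def by blast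
  then obtain E where E: "\<And>b. b \<in> P \<Longrightarrow> finite (E b)" "\<And>b. b \<in> P \<Longrightarrow> b \<in> E b"
    "\<And>b. b \<in> P \<Longrightarrow> E b \<subseteq> conj_closure G x b"
    "\<And>b f. b \<in> P \<Longrightarrow> f \<in> E b \<Longrightarrow> x \<otimes> f \<otimes> inv x \<in> generate G (E b \<union> C) \<and> inv x \<otimes> f \<otimes> x \<in> generate G (E b \<union> C)"
    by (metis (no_types, lifting))
  define F' where "F' = F \<union> (\<Union>b\<in>P. E b)"
  have EY: "E b \<subseteq> conj_closure G x y" if "b \<in> P" for b
    using E(3)[OF that] conj_closure_least[OF x Y, of b] conj_closure_conj_one[OF x y] P(3) that by blast
  have F'Y: "F' \<subseteq> conj_closure G x y" using EY F(3) unfolding F'_def by blast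
  have PF': "P \<subseteq> F'" using E(2) unfolding F'_def by blast
  have m: "generate G F \<subseteq> generate G (F' \<union> C)" "\<And>b. b \<in> P \<Longrightarrow> generate G (E b \<union> C) \<subseteq> generate G (F' \<union> C)"
    by (auto intro!: mono_generate simp: F'_def)
  have re: "g \<in> generate G (F' \<union> C)" if g: "g \<in> carrier G" "b \<in> P" "g \<otimes> inv b \<in> generate G F" for g b
  proof -
    have "g = (g \<otimes> inv b) \<otimes> b" using g P(2) Bc by (simp add: m_assoc subsetD)
    moreover have "b \<in> generate G (F' \<union> C)" using PF' g(2) by (auto intro: generate.incl)
    ultimately show ?thesis using generate.eng[of "g \<otimes> inv b" G "F' \<union> C" b] m(1) g(3) by auto
  qed
  show ?thesis unfolding fg_conj_mod_def
  proof (intro exI[of _ F'] conjI ballI)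
    show "finite F'" using F(1) P(1) E(1) by (simp add: F'_def)
    show "y \<in> F'" using F(2) by (simp add: F'_def)
    show "F' \<subseteq> conj_closure G x y" by (rule F'Y)
  next
    fix f assume "f \<in> F'"
    then consider "f \<in> F" | b where "b \<in> P" "f \<in> E b" unfolding F'_def by blast
    note cs = this
    show "x \<otimes> f \<otimes> inv x \<in> generate G (F' \<union> C)"
    proof (cases rule: cs)
      case 1
      then show ?thesis using re[of "x \<otimes> f \<otimes> inv x" "p f"] p(2) x Fc by (auto simp: P_def)
    next
      case 2
      then show ?thesis using E(4) m(2) by blast
    qed
    show "inv x \<otimes> f \<otimes> x \<in> generate G (F' \<union> C)"
    proof (cases rule: cs)
      case 1
      then show ?thesis using re[of "inv x \<otimes> f \<otimes> x" "q f"] q(2) x Fc by (auto simp: P_def)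
    next
      case 2
      then show ?thesis using E(4) m(2) by blast
    qed
  qed
qed

lemma derived_funpow_normal: "(derived G ^^ n) (carrier G) \<lhd> G"
  by (induction n) (simp_all add: normal_self derived_is_normal)

text \<open>The modulus descends along the derived series: modulo the whole group the set
  \<open>{y}\<close> is enough, and each step lowers the modulus by one term until it is
  trivial.\<close>

lemma solvable_fg_conj:
  assumes meta: "meta_nil_hamiltonian G" and sol: "solvable G" and x: "x \<in> carrier G" and y: "y \<in> carrier G"
  shows "fgs G (conj_closure G x y)"
proof -
  have "fg_conj_mod G ((derived G ^^ n) (carrier G)) x y" for n
  proof (induction n)
    case 0
    have "generate G ({y} \<union> carrier G) = carrier G"
      using generate_incl[of "{y} \<union> carrier G"] y generate.incl[of _ "{y} \<union> carrier G" G] by auto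
    then show ?case unfolding fg_conj_mod_def
      using conj_closure_self[OF x y] x y by (intro exI[of _ "{y}"]) auto
  next
    case (Suc n)
    show ?case
      by (rule fg_conj_mod_step[OF meta derived_funpow_normal derived_funpow_normal _ x y Suc])
        (simp add: cmt_in_derived)
  qed
  moreover obtain n where "(derived G ^^ n) (carrier G) = {\<one>}"
    using sol solvable_iff_trivial_derived_seq by blast
  ultimately have "fg_conj_mod G {\<one>} x y" by metis
  then obtain F where F: "finite F" "y \<in> F" "F \<subseteq> conj_closure G x y"
    and cl: "\<And>f. f \<in> F \<Longrightarrow> x \<otimes> f \<otimes> inv x \<in> generate G (F \<union> {\<one>})"
      "\<And>f. f \<in> F \<Longrightarrow> inv x \<otimes> f \<otimes> x \<in> generate G (F \<union> {\<one>})"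
    unfolding fg_conj_mod_def by blast
  note Y = conj_closure_subgroup[OF x y]
  have Fc: "F \<subseteq> carrier G" using F(3) subgroup.subset[OF Y] by blast
  note S = generate_is_subgroup[OF Fc]
  have "F \<union> {\<one>} \<subseteq> generate G F" by (auto intro: generate.incl generate.one)
  then have le: "generate G (F \<union> {\<one>}) \<subseteq> generate G F" by (rule generate_subgroup_incl[OF _ S])
  have "conj_closure G x y \<subseteq> generate G F"
  proof (rule conj_closure_least[OF x S generate.incl[OF F(2)]])
    fix b assume b: "b \<in> generate G F"
    show "x \<otimes> b \<otimes> inv x \<in> generate G F"
      using generate_conj_closed[OF Fc x _ b] cl(1) le by blast
    show "inv x \<otimes> b \<otimes> x \<in> generate G F"
      using generate_conj_closed[OF Fc inv_closed[OF x] _ b] cl(2) le x by auto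
  qed
  moreover have "generate G F \<subseteq> conj_closure G x y" by (rule generate_subgroup_incl[OF F(3) Y])
  ultimately show ?thesis using F(1) Fc unfolding fgs_def by blast
qed

end

section \<open>Polycyclic series\<close>

context group
begin

lemma fgs_subgroup: "fgs G H \<Longrightarrow> subgroup H G"
  unfolding fgs_def using generate_is_subgroup by blast

lemma pcs_subgroup: "pcs G H \<Longrightarrow> subgroup H G"
  by (induction rule: pcs.induct) (simp_all add: triv_subgroup)

text \<open>Write each generator of \<open>H\<close> as \<open>k t ^ j\<close> with \<open>k\<close>
  in \<open>K\<close>. The conjugation closures under \<open>t\<close> of these \<open>k\<close>,
  together with a generator of the powers of \<open>t\<close> in \<open>K\<close>, generate a
  finitely generated \<open>L\<close> inside \<open>K\<close> normalized by \<open>t\<close>, and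
  \<open>H\<close> is covered by the products \<open>l t ^ j\<close>. Such a product lies in
  \<open>K\<close> only if \<open>t ^ j\<close> does, and then it lies in \<open>L\<close>.\<close>

lemma fgs_descend:
  assumes restrained: "\<And>x y. x \<in> carrier G \<Longrightarrow> y \<in> carrier G \<Longrightarrow> fgs G (conj_closure G x y)"
    and H: "fgs G H" and K: "subgroup K G" "K \<subseteq> H" "\<And>h k. h \<in> H \<Longrightarrow> k \<in> K \<Longrightarrow> h \<otimes> k \<otimes> inv h \<in> K"
    and t: "t \<in> H" and HK: "H \<subseteq> cyc_ext G K t"
  shows "fgs G K"
proof -
  note Hs = fgs_subgroup[OF H]
  have tc: "t \<in> carrier G" using subgroup.mem_carrier[OF Hs t] .
  have Kc: "k \<in> carrier G" if "k \<in> K" for k using subgroup.mem_carrier[OF K(1) that] .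
  have tK: "t \<otimes> k \<otimes> inv t \<in> K" "inv t \<otimes> k \<otimes> t \<in> K" if "k \<in> K" for k
    using K(3)[OF t that] K(3)[OF subgroup.m_inv_closed[OF Hs t] that] tc by simp_all
  obtain S where S: "finite S" "S \<subseteq> carrier G" "generate G S = H" using H unfolding fgs_def by blast
  have SH: "S \<subseteq> H" using S(3) generate.incl[of _ S G] by blast
  have "\<exists>k. k \<in> K \<and> (\<exists>j::int. s = k \<otimes> t [^] j)" if s: "s \<in> S" for s
  proof -
    have "s \<in> cyc_ext G K t" using SH HK s by blast
    then show ?thesis by (elim cyc_extE) blast
  qed
  then obtain f where f: "\<And>s. s \<in> S \<Longrightarrow> f s \<in> K" "\<And>s. s \<in> S \<Longrightarrow> \<exists>j::int. s = f s \<otimes> t [^] j" by metis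
  \<comment> \<open>The exponent \<open>m\<close> is 0 when 0 is the only exponent that
    occurs.\<close>
  have "\<exists>m\<in>{j::int. t [^] j \<in> K}. \<forall>j\<in>{j::int. t [^] j \<in> K}. m dvd j"
  proof (rule int_subgroup_principal)
    show "0 \<in> {j::int. t [^] j \<in> K}" using subgroup.one_closed[OF K(1)] by simp
    fix a b :: int assume "a \<in> {j. t [^] j \<in> K}" "b \<in> {j. t [^] j \<in> K}"
    then show "a - b \<in> {j. t [^] j \<in> K}"
      using int_pow_diff[OF tc] subgroup.m_closed[OF K(1)] subgroup.m_inv_closed[OF K(1)] by simp
  qed
  then obtain m :: int where m: "t [^] m \<in> K" "\<And>j::int. t [^] j \<in> K \<Longrightarrow> m dvd j" by blast
  have "\<forall>s\<in>S. \<exists>F. finite F \<and> F \<subseteq> carrier G \<and> generate G F = conj_closure G t (f s)"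
    using restrained[OF tc Kc[OF f(1)]] unfolding fgs_def by blast
  then obtain F where F: "\<And>s. s \<in> S \<Longrightarrow> finite (F s)" "\<And>s. s \<in> S \<Longrightarrow> F s \<subseteq> carrier G"
    "\<And>s. s \<in> S \<Longrightarrow> generate G (F s) = conj_closure G t (f s)" by metis
  define E where "E = insert (t [^] m) (\<Union>s\<in>S. F s)"
  have Ec: "E \<subseteq> carrier G" using F(2) tc unfolding E_def by auto
  note L = generate_is_subgroup[OF Ec]
  have FE: "conj_closure G t (f s) \<subseteq> generate G E" if "s \<in> S" for s
    using mono_generate[of "F s" E] F(3)[OF that] that unfolding E_def by blast
  have cK: "conj_closure G t (f s) \<subseteq> K" if "s \<in> S" for s
    by (rule conj_closure_least[OF tc K(1) f(1)[OF that] tK])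
  have Fin: "F s \<subseteq> conj_closure G t (f s)" if "s \<in> S" for s
    using F(3)[OF that] generate.incl[of _ "F s" G] by blast
  have LK: "generate G E \<subseteq> K"
    by (rule generate_subgroup_incl[OF _ K(1)]) (use cK Fin m in \<open>auto simp: E_def\<close>)
  have tm: "t \<otimes> t [^] m \<otimes> inv t = t [^] m" "inv t \<otimes> t [^] m \<otimes> t = t [^] m"
    using int_pow_conj[OF tc tc, of m] int_pow_conj[OF tc inv_closed[OF tc], of m] tc by (simp_all add: m_assoc)
  have tL: "t \<otimes> y \<otimes> inv t \<in> generate G E" if y: "y \<in> generate G E" for y
  proof (rule generate_conj_closed[OF Ec tc _ y])
    fix y assume "y \<in> E"
    then consider "y = t [^] m" | s where "s \<in> S" "y \<in> F s" unfolding E_def by blast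
    then show "t \<otimes> y \<otimes> inv t \<in> generate G E"
    proof cases
      case 1
      then show ?thesis using tm(1) by (auto intro!: generate.incl simp: E_def)
    next
      case 2
      then show ?thesis
        using conj_closure_conj_one(1)[OF tc Kc[OF f(1)[OF 2(1)]], of y] Fin[OF 2(1)] FE[OF 2(1)] by blast
    qed
  qed
  have tL': "inv t \<otimes> y \<otimes> t \<in> generate G E" if y: "y \<in> generate G E" for y
  proof -
    have "inv t \<otimes> y \<otimes> inv (inv t) \<in> generate G E"
    proof (rule generate_conj_closed[OF Ec inv_closed[OF tc] _ y])
      fix y assume "y \<in> E"
      then consider "y = t [^] m" | s where "s \<in> S" "y \<in> F s" unfolding E_def by blast
      then show "inv t \<otimes> y \<otimes> inv (inv t) \<in> generate G E"
      proof cases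
        case 1
        then show ?thesis using tm(2) tc by (auto intro!: generate.incl simp: E_def)
      next
        case 2
        then have "inv t \<otimes> y \<otimes> t \<in> generate G E"
          using conj_closure_conj_one(2)[OF tc Kc[OF f(1)[OF 2(1)]], of y] Fin[OF 2(1)] FE[OF 2(1)] by blast
        then show ?thesis using tc by simp
      qed
    qed
    then show ?thesis using tc by simp
  qed
  have X: "subgroup (cyc_ext G (generate G E) t) G" by (rule cyc_ext_subgroup[OF L tc tL tL'])
  have "S \<subseteq> cyc_ext G (generate G E) t"
  proof
    fix s assume s: "s \<in> S"
    obtain j :: int where j: "s = f s \<otimes> t [^] j" using f(2)[OF s] by blast
    have "f s \<in> generate G E" using FE[OF s] conj_closure_self[OF tc Kc[OF f(1)[OF s]]] by blast
    then show "s \<in> cyc_ext G (generate G E) t" using j cyc_extI[of "f s" "generate G E" t j] by simp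
  qed
  then have HL: "H \<subseteq> cyc_ext G (generate G E) t" using generate_subgroup_incl[OF _ X] S(3) by blast
  have "K \<subseteq> generate G E"
  proof
    fix k assume k: "k \<in> K"
    then have "k \<in> cyc_ext G (generate G E) t" using HL K(2) by blast
    then obtain l and j :: int where l: "l \<in> generate G E" "k = l \<otimes> t [^] j" by (rule cyc_extE)
    have lc: "l \<in> K" using l LK by blast
    have "t [^] j = inv l \<otimes> k" using l tc Kc[OF lc] by simp
    then have "t [^] j \<in> K" using subgroup.m_closed[OF K(1) subgroup.m_inv_closed[OF K(1) lc] k] by simp
    then obtain i where "j = m * i" using m(2) by blast
    then have "t [^] j = (t [^] m) [^] i" using tc by (simp add: int_pow_pow)
    moreover have "t [^] m \<in> generate G E" by (auto intro: generate.incl simp: E_def)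
    ultimately have "t [^] j \<in> generate G E" using subgroup_int_pow_closed[OF L] by simp
    then show "k \<in> generate G E" using l subgroup.m_closed[OF L] by simp
  qed
  then have "generate G E = K" using LK by blast
  moreover have "finite E" using S(1) F(1) unfolding E_def by simp
  ultimately show ?thesis using Ec unfolding fgs_def by blast
qed

text \<open>Every subgroup between \<open>derived G H\<close> and \<open>H\<close> is normal in
  \<open>H\<close>, so adjoining one further element is an extension by its powers.\<close>

lemma derived_adjoin_step:
  assumes H: "subgroup H G" and S: "S \<subseteq> H" and s: "s \<in> H"
  defines "K \<equiv> generate G (derived G H \<union> S)"
  shows "subgroup K G" "K \<subseteq> generate G (derived G H \<union> insert s S)"
    "\<And>h k. h \<in> H \<Longrightarrow> k \<in> K \<Longrightarrow> h \<otimes> k \<otimes> inv h \<in> K"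
    "generate G (derived G H \<union> insert s S) \<subseteq> cyc_ext G K s"
    "generate G (derived G H \<union> insert s S) \<subseteq> H"
proof -
  note Hc = subgroup.subset[OF H]
  have dH: "derived G H \<subseteq> H" using derived_incl[OF subset_refl H] .
  have sub: "derived G H \<union> S \<subseteq> carrier G" using dH S Hc by blast
  show K: "subgroup K G" unfolding K_def by (rule generate_is_subgroup[OF sub])
  show "K \<subseteq> generate G (derived G H \<union> insert s S)" unfolding K_def by (rule mono_generate) blast
  have KH: "K \<subseteq> H" unfolding K_def by (rule generate_subgroup_incl[OF _ H]) (use dH S in blast)
  show conj: "h \<otimes> k \<otimes> inv h \<in> K" if h: "h \<in> H" and k: "k \<in> K" for h k
  proof -
    have "h \<otimes> k \<otimes> inv h = cmt G h k \<otimes> k" using h k Hc KH by (simp add: cmt_def m_assoc subsetD)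
    moreover have "cmt G h k \<in> K"
      unfolding K_def using cmt_in_derived[OF h, of k] k KH by (intro generate.incl) blast
    ultimately show ?thesis using subgroup.m_closed[OF K] k by simp
  qed
  have sc: "s \<in> carrier G" using s Hc by blast
  have X: "subgroup (cyc_ext G K s) G"
    using conj[OF s] conj[OF subgroup.m_inv_closed[OF H s]] sc by (intro cyc_ext_subgroup[OF K sc]) auto
  have "derived G H \<union> S \<subseteq> K" unfolding K_def by (auto intro: generate.incl)
  then have "derived G H \<union> insert s S \<subseteq> cyc_ext G K s" using cyc_ext_incl[OF K sc] by blast
  then show "generate G (derived G H \<union> insert s S) \<subseteq> cyc_ext G K s"
    by (rule generate_subgroup_incl[OF _ X])
  show "generate G (derived G H \<union> insert s S) \<subseteq> H"
    by (rule generate_subgroup_incl[OF _ H]) (use dH S s in blast)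
qed

text \<open>Induction on the derived length. Finite generation goes down from \<open>H\<close> to
  \<open>derived G H\<close> by removing generators one at a time, and the polycyclic series comes
  back up along the same chain; both implications are therefore proved in one induction over the
  adjoined set.\<close>

lemma restrained_imp_pcs:
  assumes restrained: "\<And>x y. x \<in> carrier G \<Longrightarrow> y \<in> carrier G \<Longrightarrow> fgs G (conj_closure G x y)"
  shows "fgs G H \<Longrightarrow> (derived G ^^ n) H = {\<one>} \<Longrightarrow> pcs G H"
proof (induction n arbitrary: H)
  case 0
  then show ?case using pcs.trivial[of G] by simp
next
  case (Suc n)
  note Hs = fgs_subgroup[OF Suc.prems(1)]
  obtain S where S: "finite S" "S \<subseteq> carrier G" "generate G S = H" using Suc.prems(1) unfolding fgs_def by blast
  have SH: "S \<subseteq> H" using S(3) generate.incl[of _ S G] by blast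
  have dH: "derived G H \<subseteq> H" using derived_incl[OF subset_refl Hs] .
  have dsub: "subgroup (derived G H) G" using derived_is_subgroup[OF subgroup.subset[OF Hs]] .
  have d0: "generate G (derived G H \<union> {}) = derived G H"
  proof
    show "generate G (derived G H \<union> {}) \<subseteq> derived G H" by (rule generate_subgroup_incl[OF _ dsub]) simp
    show "derived G H \<subseteq> generate G (derived G H \<union> {})" by (auto intro: generate.incl)
  qed
  have "(fgs G (generate G (derived G H \<union> R)) \<longrightarrow> fgs G (derived G H)) \<and>
        (pcs G (derived G H) \<longrightarrow> pcs G (generate G (derived G H \<union> R)))" if "R \<subseteq> S" for R
    using finite_subset[OF that S(1)] that
  proof (induction R rule: finite_induct)
    case empty
    then show ?case unfolding d0 by simp
  next
    case (insert s R)
    have RH: "R \<subseteq> H" and sH: "s \<in> H" using insert.prems SH by auto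
    note st = derived_adjoin_step[OF Hs RH sH]
    let ?K = "generate G (derived G H \<union> R)" and ?L = "generate G (derived G H \<union> insert s R)"
    have sL: "s \<in> ?L" by (auto intro: generate.incl)
    have c: "\<And>h k. h \<in> ?L \<Longrightarrow> k \<in> ?K \<Longrightarrow> h \<otimes> k \<otimes> inv h \<in> ?K" using st(3,5) by blast
    have Lc: "derived G H \<union> insert s R \<subseteq> carrier G"
      using dH RH sH subgroup.subset[OF Hs] by blast
    have "fgs G ?L \<Longrightarrow> fgs G ?K" by (rule fgs_descend[OF restrained _ st(1,2) c sL st(4)])
    moreover have "pcs G ?K \<Longrightarrow> pcs G ?L"
      by (rule pcs.step[OF _ generate_is_subgroup[OF Lc] st(2) c sL st(4)])
    ultimately show ?case using insert.IH insert.prems by blast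
  qed
  then have R: "fgs G (generate G (derived G H \<union> S)) \<Longrightarrow> fgs G (derived G H)"
    "pcs G (derived G H) \<Longrightarrow> pcs G (generate G (derived G H \<union> S))" by auto
  have "generate G (derived G H \<union> S) = H"
  proof
    show "generate G (derived G H \<union> S) \<subseteq> H" by (rule generate_subgroup_incl[OF _ Hs]) (use dH SH in blast)
    show "H \<subseteq> generate G (derived G H \<union> S)" using mono_generate[of S "derived G H \<union> S"] S(3) by blast
  qed
  moreover have "(derived G ^^ n) (derived G H) = {\<one>}" using Suc.prems(2) by (simp add: funpow_swap1)
  ultimately show ?case using Suc.IH[of "derived G H"] R Suc.prems(1) by simp
qed

section \<open>Consequences of a polycyclic series\<close>

lemma pcs_imp_polycyclic_seq: "pcs G H \<Longrightarrow> polycyclic_seq G H"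
proof (induction rule: pcs.induct)
  case trivial
  then show ?case by (rule polycyclic_seq.unity)
next
  case (step K H t)
  let ?H = "G\<lparr>carrier := H\<rparr>"
  interpret H: group ?H by (rule subgroup_imp_group[OF step(2)])
  have KH: "subgroup K ?H" by (rule subgroup_incl[OF pcs_subgroup[OF step(1)] step(2,3)])
  have nK: "K \<lhd> ?H"
    by (rule H.normal_invI[OF KH]) (use step(2,4) in \<open>simp add: m_inv_consistent\<close>)
  define Q where "Q = ?H Mod K"
  define f where "f = (\<lambda>a. K #>\<^bsub>?H\<^esub> a)"
  interpret q: group_hom ?H Q f using H.quotient_hom(1)[OF nK] unfolding Q_def f_def .
  have surj: "f ` H = carrier Q" using H.quotient_hom(2)[OF nK] unfolding Q_def f_def by simp
  have ft: "f t \<in> carrier Q" using surj step(5) by blast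
  have gs: "subgroup (generate Q {f t}) Q" by (rule q.H.generate_is_subgroup) (use ft in simp)
  have "carrier Q \<subseteq> generate Q {f t}"
  proof
    fix y assume "y \<in> carrier Q"
    then obtain a where a: "a \<in> H" "y = f a" using surj by blast
    then have "a \<in> cyc_ext G K t" using step(6) by blast
    then obtain k and j :: int where k: "k \<in> K" "a = k \<otimes> t [^] j" by (rule cyc_extE)
    have kH: "k \<in> H" using k(1) step(3) by blast
    have tj: "t [^] j = t [^]\<^bsub>?H\<^esub> j" by (rule int_pow_consistent[OF step(2,5)])
    have tjH: "t [^]\<^bsub>?H\<^esub> j \<in> carrier ?H" using step(5) by (intro H.int_pow_closed) simp
    have "f k = \<one>\<^bsub>Q\<^esub>" using H.quotient_hom(3)[OF nK, of k] k(1) kH unfolding f_def Q_def by simp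
    then have "f a = f (t [^]\<^bsub>?H\<^esub> j)"
      using q.hom_mult[of k "t [^]\<^bsub>?H\<^esub> j"] kH tjH k(2) tj q.hom_closed[OF tjH] by simp
    also have "\<dots> = f t [^]\<^bsub>Q\<^esub> j" using q.hom_int_pow[of t j] step(5) by simp
    finally show "y \<in> generate Q {f t}"
      using a q.H.subgroup_int_pow_closed[OF gs] by (simp add: generate.incl)
  qed
  then have "cyclic_grp Q" using subgroup.subset[OF gs] ft unfolding cyclic_grp_def by blast
  then show ?case using polycyclic_seq.extension[OF step(7) nK step(2)] unfolding Q_def by blast
qed

text \<open>\<open>L\<close> is generated by its intersection with \<open>K\<close> and one element
  \<open>k t ^ m\<close>, where \<open>m\<close> generates the group of exponents that occur in
  elements of \<open>L\<close>.\<close>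

lemma pcs_subgroup_fgs: "pcs G H \<Longrightarrow> subgroup L G \<Longrightarrow> L \<subseteq> H \<Longrightarrow> fgs G L"
proof (induction arbitrary: L rule: pcs.induct)
  case trivial
  then have "L = {\<one>}" using subgroup.one_closed[OF trivial(1)] by blast
  then show ?case unfolding fgs_def using generate_empty by (intro exI[of _ "{}"]) simp
next
  case (step K H t)
  have K: "subgroup K G" by (rule pcs_subgroup[OF step(1)])
  have LK: "subgroup (L \<inter> K) G" by (rule subgroups_Inter_pair[OF step.prems(1) K])
  then have "fgs G (L \<inter> K)" using step(7) by blast
  then obtain S where S: "finite S" "S \<subseteq> carrier G" "generate G S = L \<inter> K" unfolding fgs_def by blast
  have tc: "t \<in> carrier G" using subgroup.mem_carrier[OF step(2,5)] .
  have Kc: "k \<in> carrier G" if "k \<in> K" for k using subgroup.mem_carrier[OF K that] .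
  have tHj: "t [^] j \<in> H" for j :: int using subgroup_int_pow_closed[OF step(2,5)] .
  let ?J = "{j::int. \<exists>k\<in>K. k \<otimes> t [^] j \<in> L}"
  have "\<exists>m\<in>?J. \<forall>j\<in>?J. m dvd j"
  proof (rule int_subgroup_principal)
    show "0 \<in> ?J" using subgroup.one_closed[OF K] subgroup.one_closed[OF step.prems(1)] by force
    fix a b assume "a \<in> ?J" "b \<in> ?J"
    then obtain k l where k: "k \<in> K" "k \<otimes> t [^] a \<in> L" and l: "l \<in> K" "l \<otimes> t [^] b \<in> L" by blast
    have "(k \<otimes> t [^] a) \<otimes> inv (l \<otimes> t [^] b) \<in> L"
      using k l subgroup.m_closed[OF step.prems(1)] subgroup.m_inv_closed[OF step.prems(1)] by blast
    moreover have "(k \<otimes> t [^] a) \<otimes> inv (l \<otimes> t [^] b) = (k \<otimes> (t [^] (a - b) \<otimes> inv l \<otimes> inv (t [^] (a - b)))) \<otimes> t [^] (a - b)"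
      using Kc[OF k(1)] Kc[OF l(1)] tc by (simp add: int_pow_diff inv_mult_group m_assoc)
    moreover have "k \<otimes> (t [^] (a - b) \<otimes> inv l \<otimes> inv (t [^] (a - b))) \<in> K"
      using subgroup.m_closed[OF K k(1) step(4)[OF tHj subgroup.m_inv_closed[OF K l(1)]]] .
    ultimately show "a - b \<in> ?J" by (metis (mono_tags, lifting) mem_Collect_eq)
  qed
  then obtain m k where m: "k \<in> K" "k \<otimes> t [^] m \<in> L" "\<And>j. j \<in> ?J \<Longrightarrow> m dvd j" by blast
  define z where "z = k \<otimes> t [^] m"
  have zc: "z \<in> carrier G" using Kc[OF m(1)] tc by (simp add: z_def)
  have zj: "\<exists>k'\<in>K. z [^] i = k' \<otimes> t [^] (m * i)" for i :: int
  proof -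
    have p: "\<exists>k'\<in>K. z [^] n = k' \<otimes> t [^] (m * int n)" for n :: nat
    proof (induction n)
      case 0
      show ?case using subgroup.one_closed[OF K] by (intro bexI[of _ \<one>]) auto
    next
      case (Suc n)
      then obtain k' where k': "k' \<in> K" "z [^] n = k' \<otimes> t [^] (m * int n)" by blast
      have "z [^] Suc n = (k' \<otimes> (t [^] (m * int n) \<otimes> k \<otimes> inv (t [^] (m * int n)))) \<otimes> (t [^] (m * int n) \<otimes> t [^] m)"
        using k' Kc[OF k'(1)] Kc[OF m(1)] tc by (simp add: z_def m_assoc)
      also have "t [^] (m * int n) \<otimes> t [^] m = t [^] (m * int (Suc n))"
        using tc by (simp add: int_pow_mult[symmetric] algebra_simps)
      finally show ?case
        using subgroup.m_closed[OF K k'(1) step(4)[OF tHj m(1)]] by blast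
    qed
    show ?thesis
    proof (cases i rule: int_cases2)
      case (nonneg n)
      then show ?thesis using p[of n] by (simp add: int_pow_int)
    next
      case (nonpos n)
      obtain k' where k': "k' \<in> K" "z [^] n = k' \<otimes> t [^] (m * int n)" using p by blast
      let ?u = "t [^] (m * i)"
      have u: "?u = inv (t [^] (m * int n))" using tc nonpos by (simp add: int_pow_neg)
      have "z [^] i = inv (k' \<otimes> t [^] (m * int n))" using nonpos zc k'(2) by (simp add: int_pow_neg_int)
      also have "\<dots> = (?u \<otimes> inv k' \<otimes> inv ?u) \<otimes> ?u"
        using Kc[OF k'(1)] tc by (simp add: u inv_mult_group m_assoc)
      finally show ?thesis using step(4)[OF tHj subgroup.m_inv_closed[OF K k'(1)]] by blast
    qed
  qed
  have "generate G (insert z S) = L"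
  proof
    show "generate G (insert z S) \<subseteq> L"
      using S(3) m(2) generate.incl[of _ S G] by (intro generate_subgroup_incl[OF _ step.prems(1)]) (auto simp: z_def)
    show "L \<subseteq> generate G (insert z S)"
    proof
      fix l assume l: "l \<in> L"
      then have "l \<in> cyc_ext G K t" using step(6) step.prems(2) by blast
      then obtain k' and j :: int where k': "k' \<in> K" "l = k' \<otimes> t [^] j" by (rule cyc_extE)
      then have "m dvd j" using m(3) l by blast
      then obtain i where i: "j = m * i" by blast
      obtain k2 where k2: "k2 \<in> K" "z [^] i = k2 \<otimes> t [^] (m * i)" using zj by blast
      have sub: "subgroup (generate G (insert z S)) G" by (rule generate_is_subgroup) (use S(2) zc in simp)
      have zi: "z [^] i \<in> generate G (insert z S)"
        by (rule subgroup_int_pow_closed[OF sub]) (simp add: generate.incl)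
      have zL: "z [^] i \<in> L" using subgroup_int_pow_closed[OF step.prems(1)] m(2) z_def by simp
      have "l \<otimes> inv (z [^] i) = k' \<otimes> inv k2"
        using k' k2 Kc tc i by (simp add: inv_mult_group m_assoc)
      then have "l \<otimes> inv (z [^] i) \<in> K" using k' k2 subgroup.m_closed[OF K] subgroup.m_inv_closed[OF K] by simp
      moreover have "l \<otimes> inv (z [^] i) \<in> L"
        using l zL subgroup.m_closed[OF step.prems(1)] subgroup.m_inv_closed[OF step.prems(1)] by simp
      ultimately have "l \<otimes> inv (z [^] i) \<in> generate G S" using S(3) by blast
      then have "l \<otimes> inv (z [^] i) \<in> generate G (insert z S)" using mono_generate[of S "insert z S"] by blast
      then have "(l \<otimes> inv (z [^] i)) \<otimes> z [^] i \<in> generate G (insert z S)" using zi by (rule generate.eng)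
      then show "l \<in> generate G (insert z S)"
        using subgroup.mem_carrier[OF step.prems(1) l] zc by (simp add: m_assoc)
    qed
  qed
  then show ?case unfolding fgs_def using S(1,2) zc by (intro exI[of _ "insert z S"]) simp
qed

text \<open>The ascending chain condition in the form used for Noetherian induction: the union of a
  chain is a finitely generated subgroup, so some member contains all its generators.\<close>

lemma pcs_maximal_subgroup_in_family:
  assumes pcs: "pcs G (carrier G)" and sub: "\<And>V. V \<in> \<F> \<Longrightarrow> subgroup V G" and ne: "\<F> \<noteq> {}"
  shows "\<exists>M\<in>\<F>. \<forall>V\<in>\<F>. M \<subseteq> V \<longrightarrow> V = M"
proof (rule subset_Zorn_nonempty[OF ne])
  fix \<C> assume C: "\<C> \<noteq> {}" "subset.chain \<F> \<C>"
  have CF: "\<C> \<subseteq> \<F>" using C(2) by (simp add: subset.chain_def)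
  have lin: "V \<subseteq> Y \<or> Y \<subseteq> V" if "V \<in> \<C>" "Y \<in> \<C>" for V Y
    using C(2) that by (auto simp: subset_chain_def)
  have U: "subgroup (\<Union>\<C>) G"
  proof (rule subgroupI)
    show "\<Union>\<C> \<subseteq> carrier G" using CF sub subgroup.subset by blast
    obtain V where "V \<in> \<C>" using C(1) by blast
    then show "\<Union>\<C> \<noteq> {}" using subgroup.one_closed[OF sub] CF by blast
    show "inv a \<in> \<Union>\<C>" if "a \<in> \<Union>\<C>" for a using that subgroup.m_inv_closed[OF sub] CF by blast
    fix a b assume "a \<in> \<Union>\<C>" "b \<in> \<Union>\<C>"
    then obtain V Y where V: "V \<in> \<C>" "a \<in> V" and Y: "Y \<in> \<C>" "b \<in> Y" by blast
    then obtain W where W: "W \<in> \<C>" "a \<in> W" "b \<in> W" using lin[OF V(1) Y(1)] by blast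
    then have "a \<otimes> b \<in> W" using subgroup.m_closed[OF sub, of W] CF by blast
    then show "a \<otimes> b \<in> \<Union>\<C>" using W(1) by blast
  qed
  obtain S where S: "finite S" "S \<subseteq> carrier G" "generate G S = \<Union>\<C>"
    using pcs_subgroup_fgs[OF pcs U subgroup.subset[OF U]] unfolding fgs_def by blast
  have "S \<subseteq> \<Union>\<C>" using S(3) generate.incl[of _ S G] by blast
  then obtain V where V: "V \<in> \<C>" "S \<subseteq> V" using finite_subset_Union_chain[OF S(1) _ C] by blast
  then have "\<Union>\<C> \<subseteq> V" using generate_subgroup_incl[OF V(2) sub] CF S(3) by blast
  then have "\<Union>\<C> = V" using V(1) by blast
  then show "\<Union>\<C> \<in> \<F>" using V(1) CF by blast
qed

theorem fg_solvable_imp_pcs: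
  assumes "meta_nil_hamiltonian G" "solvable G" "finitely_generated G"
  shows "pcs G (carrier G)"
proof -
  obtain n where "(derived G ^^ n) (carrier G) = {\<one>}"
    using assms(2) solvable_iff_trivial_derived_seq by blast
  moreover have "fgs G (carrier G)" using assms(3) unfolding finitely_generated_def fgs_def .
  ultimately show ?thesis using restrained_imp_pcs[OF solvable_fg_conj[OF assms(1,2)]] by blast
qed

end

lemma (in group_hom) pcs_img: "pcs G K \<Longrightarrow> pcs H (h ` K)"
proof (induction rule: pcs.induct)
  case trivial
  then show ?case using pcs.trivial[of H] by simp
next
  case (step K L t)
  have Lc: "l \<in> carrier G" if "l \<in> L" for l using subgroup.mem_carrier[OF step(2) that] .
  show ?case
  proof (rule pcs.step[OF step(7)])
    show "subgroup (h ` L) H" by (rule subgroup_img_is_subgroup[OF step(2)])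
    show "h ` K \<subseteq> h ` L" using step(3) by blast
    show "h t \<in> h ` L" using step(5) by blast
  next
    fix a k assume "a \<in> h ` L" "k \<in> h ` K"
    then obtain a' k' where a: "a' \<in> L" "a = h a'" "k' \<in> K" "k = h k'" by blast
    have "a \<otimes>\<^bsub>H\<^esub> k \<otimes>\<^bsub>H\<^esub> inv\<^bsub>H\<^esub> a = h (a' \<otimes> k' \<otimes> inv a')" using a step(3) Lc by (simp add: subsetD)
    then show "a \<otimes>\<^bsub>H\<^esub> k \<otimes>\<^bsub>H\<^esub> inv\<^bsub>H\<^esub> a \<in> h ` K" using step(4)[OF a(1,3)] by blast
  next
    show "h ` L \<subseteq> cyc_ext H (h ` K) (h t)"
    proof
      fix y assume "y \<in> h ` L"
      then obtain l where l: "l \<in> L" "y = h l" by blast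
      then have "l \<in> cyc_ext G K t" using step(6) by blast
      then obtain k and j :: int where k: "k \<in> K" "l = k \<otimes> t [^] j" by (rule G.cyc_extE)
      have "y = h k \<otimes>\<^bsub>H\<^esub> h t [^]\<^bsub>H\<^esub> j"
        using l k step(3,5) Lc hom_int_pow[of t j] by (simp add: subsetD)
      then show "y \<in> cyc_ext H (h ` K) (h t)" using H.cyc_extI[of "h k" "h ` K" "h t" j] k(1) by blast
    qed
  qed
qed

section \<open>Central elements modulo normal subgroups\<close>

context group
begin

text \<open>Used in a quotient to show that the elements centralizing a normal subgroup
  \<open>K\<close> are stable under commutation with \<open>t\<close>.\<close>

lemma cmt_commute_conj:
  assumes c: "m \<in> carrier G" "k \<in> carrier G" "t \<in> carrier G"
    and 1: "m \<otimes> k = k \<otimes> m" and 2: "m \<otimes> (inv t \<otimes> k \<otimes> t) = (inv t \<otimes> k \<otimes> t) \<otimes> m"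
  shows "cmt G m t \<otimes> k = k \<otimes> cmt G m t"
proof -
  define k' where "k' = inv t \<otimes> k \<otimes> t"
  have k': "k' \<in> carrier G" "k = t \<otimes> k' \<otimes> inv t" using c by (simp_all add: k'_def m_assoc)
  have 3: "inv m \<otimes> k' = k' \<otimes> inv m"
    using 2 c k' unfolding k'_def[symmetric] by (metis inv_closed inv_solve_left inv_solve_right m_assoc m_closed)
  have "cmt G m t \<otimes> k = m \<otimes> t \<otimes> (inv m \<otimes> k') \<otimes> inv t"
    using c k'(1) by (subst k'(2)) (simp add: cmt_def m_assoc)
  also have "\<dots> = m \<otimes> (t \<otimes> k' \<otimes> inv t) \<otimes> t \<otimes> inv m \<otimes> inv t"
    unfolding 3 using c k'(1) by (simp add: m_assoc)
  also have "\<dots> = (m \<otimes> k) \<otimes> t \<otimes> inv m \<otimes> inv t" by (subst k'(2)) simp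
  also have "\<dots> = k \<otimes> cmt G m t" unfolding 1 using c by (simp add: cmt_def m_assoc)
  finally show ?thesis .
qed

lemma centralizer_subgroup:
  assumes "m \<in> carrier G" shows "subgroup {g \<in> carrier G. m \<otimes> g = g \<otimes> m} G"
proof (rule subgroupI)
  show "{g \<in> carrier G. m \<otimes> g = g \<otimes> m} \<noteq> {}" using assms by auto
  fix a assume a: "a \<in> {g \<in> carrier G. m \<otimes> g = g \<otimes> m}"
  then show "inv a \<in> {g \<in> carrier G. m \<otimes> g = g \<otimes> m}"
    using assms by simp (metis inv_closed inv_solve_left inv_solve_right m_assoc m_closed)
  fix b assume b: "b \<in> {g \<in> carrier G. m \<otimes> g = g \<otimes> m}"
  have "m \<otimes> (a \<otimes> b) = a \<otimes> m \<otimes> b" using a b assms by (simp add: m_assoc[symmetric])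
  also have "\<dots> = (a \<otimes> b) \<otimes> m" using a b assms by (simp add: m_assoc)
  finally show "a \<otimes> b \<in> {g \<in> carrier G. m \<otimes> g = g \<otimes> m}" using a b by simp
qed auto

lemma cmt_in_normal_iff_commute:
  assumes "L \<lhd> G" "a \<in> carrier G" "b \<in> carrier G"
  shows "cmt G a b \<in> L \<longleftrightarrow> (L #> a) \<otimes>\<^bsub>G Mod L\<^esub> (L #> b) = (L #> b) \<otimes>\<^bsub>G Mod L\<^esub> (L #> a)"
proof -
  interpret q: group_hom G "G Mod L" "\<lambda>a. L #> a" by (rule quotient_hom(1)[OF assms(1)])
  have "cmt G a b \<in> L \<longleftrightarrow> L #> cmt G a b = \<one>\<^bsub>G Mod L\<^esub>"
    using quotient_hom(3)[OF assms(1) cmt_closed[OF assms(2,3)]] by blast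
  also have "\<dots> \<longleftrightarrow> cmt (G Mod L) (L #> a) (L #> b) = \<one>\<^bsub>G Mod L\<^esub>"
    using q.hom_cmt[OF assms(2,3)] by simp
  also have "\<dots> \<longleftrightarrow> (L #> a) \<otimes>\<^bsub>G Mod L\<^esub> (L #> b) = (L #> b) \<otimes>\<^bsub>G Mod L\<^esub> (L #> a)"
    by (rule q.H.cmt_eq_one_iff[OF q.hom_closed[OF assms(2)] q.hom_closed[OF assms(3)]])
  finally show ?thesis .
qed

lemma centralizer_mod_subgroup:
  assumes L: "L \<lhd> G" and m: "m \<in> carrier G"
  shows "subgroup {g \<in> carrier G. cmt G m g \<in> L} G"
proof -
  define Q where "Q = G Mod L"
  define h where "h = (\<lambda>a. L #> a)"
  interpret q: group_hom G Q h unfolding Q_def h_def by (rule quotient_hom(1)[OF L])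
  have hm: "h m \<in> carrier Q" using m by simp
  have "{g \<in> carrier G. cmt G m g \<in> L} = {g \<in> carrier G. h g \<in> {y \<in> carrier Q. h m \<otimes>\<^bsub>Q\<^esub> y = y \<otimes>\<^bsub>Q\<^esub> h m}}"
    using cmt_in_normal_iff_commute[OF L m] unfolding h_def[symmetric] Q_def[symmetric] by auto
  then show ?thesis using q.vimage_subgroup[OF q.H.centralizer_subgroup[OF hm]] by simp
qed

text \<open>Induction along the series. The elements of \<open>M\<close> centralizing
  \<open>K\<close> modulo \<open>L\<close> are stable under commutation with \<open>t\<close>. By
  the Engel condition their iterated commutators with \<open>t\<close> enter \<open>L\<close>, and
  the last one outside \<open>L\<close> is centralized modulo \<open>L\<close> by \<open>t\<close>
  as well, hence by \<open>H\<close>.\<close>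

lemma exists_central_mod:
  assumes M: "M \<lhd> G" and L: "L \<lhd> G" and ne: "\<exists>m. m \<in> M - L"
    and eng: "\<And>x m. x \<in> carrier G \<Longrightarrow> m \<in> M \<Longrightarrow> \<exists>n. engel G x n m \<in> L"
  shows "pcs G H \<Longrightarrow> \<exists>m\<in>M - L. \<forall>g\<in>H. cmt G m g \<in> L"
proof (induction rule: pcs.induct)
  case trivial
  show ?case using ne subgroup.one_closed[OF normal_sub(1)[OF L]] normal_sub(2)[OF M] by force
next
  case (step K H t)
  then obtain m where m: "m \<in> M - L" "\<And>k. k \<in> K \<Longrightarrow> cmt G m k \<in> L" by blast
  have K: "subgroup K G" by (rule pcs_subgroup[OF step(1)])
  have Kc: "k \<in> carrier G" if "k \<in> K" for k using subgroup.mem_carrier[OF K that] .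
  have tc: "t \<in> carrier G" using subgroup.mem_carrier[OF step(2,5)] .
  have Mc: "m \<in> carrier G" if "m \<in> M" for m using normal_sub(2)[OF M] that by blast
  have tK: "inv t \<otimes> k \<otimes> t \<in> K" if "k \<in> K" for k
    using step(4)[OF subgroup.m_inv_closed[OF step(2,5)] that] tc by simp
  define D where "D = {m \<in> M. \<forall>k\<in>K. cmt G m k \<in> L}"
  define Q where "Q = G Mod L"
  define h where "h = (\<lambda>a. L #> a)"
  interpret q: group_hom G Q h unfolding Q_def h_def by (rule quotient_hom(1)[OF L])
  have com: "cmt G a b \<in> L \<longleftrightarrow> h a \<otimes>\<^bsub>Q\<^esub> h b = h b \<otimes>\<^bsub>Q\<^esub> h a" if "a \<in> carrier G" "b \<in> carrier G" for a b
    using cmt_in_normal_iff_commute[OF L that] unfolding h_def Q_def .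
  have D: "cmt G m t \<in> D" if "m \<in> D" for m
  proof -
    have mM: "m \<in> M" using that by (simp add: D_def)
    have "cmt G (cmt G m t) k \<in> L" if k: "k \<in> K" for k
    proof -
      have "h m \<otimes>\<^bsub>Q\<^esub> h k = h k \<otimes>\<^bsub>Q\<^esub> h m"
        using com[OF Mc[OF mM] Kc[OF k]] \<open>m \<in> D\<close> k unfolding D_def by blast
      moreover have "h m \<otimes>\<^bsub>Q\<^esub> (inv\<^bsub>Q\<^esub> (h t) \<otimes>\<^bsub>Q\<^esub> h k \<otimes>\<^bsub>Q\<^esub> h t) = (inv\<^bsub>Q\<^esub> (h t) \<otimes>\<^bsub>Q\<^esub> h k \<otimes>\<^bsub>Q\<^esub> h t) \<otimes>\<^bsub>Q\<^esub> h m"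
        using com[OF Mc[OF mM] Kc[OF tK[OF k]]] tK[OF k] \<open>m \<in> D\<close> tc Kc[OF k] unfolding D_def by simp
      ultimately have "cmt Q (h m) (h t) \<otimes>\<^bsub>Q\<^esub> h k = h k \<otimes>\<^bsub>Q\<^esub> cmt Q (h m) (h t)"
        using q.H.cmt_commute_conj[of "h m" "h k" "h t"] Mc[OF mM] Kc[OF k] tc by simp
      then show ?thesis using com[OF cmt_closed[OF Mc[OF mM] tc] Kc[OF k]] q.hom_cmt[OF Mc[OF mM] tc] by simp
    qed
    then show ?thesis using cmt_in_normal(1)[OF M mM tc] unfolding D_def by blast
  qed
  have Dn: "engel G t n m \<in> D" for n
    by (induction n) (use m D in \<open>auto simp: D_def engel_Suc\<close>)
  obtain n where "engel G t n m \<in> L" using eng[OF tc, of m] m(1) by blast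
  then have "\<exists>n. engel G t n m \<in> L" by blast
  then obtain n where n: "engel G t n m \<in> L" and lt: "\<And>k. k < n \<Longrightarrow> engel G t k m \<notin> L"
    using exists_least_iff[of "\<lambda>n. engel G t n m \<in> L"] by blast
  have "n \<noteq> 0" using n m(1) by (metis DiffD2 engel_0)
  then obtain k where k: "n = Suc k" using not0_implies_Suc by blast
  let ?m = "engel G t k m"
  have mD: "?m \<in> D" by (rule Dn)
  then have mc: "?m \<in> carrier G" using Mc unfolding D_def by blast
  have mL: "?m \<notin> L" using lt k by simp
  have mt: "cmt G ?m t \<in> L" using n k by (simp add: engel_Suc)
  note C = centralizer_mod_subgroup[OF L mc]
  have "cmt G ?m g \<in> L" if g: "g \<in> H" for g
  proof -
    have "g \<in> cyc_ext G K t" using step(6) g by blast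
    then obtain k' and j :: int where k': "k' \<in> K" "g = k' \<otimes> t [^] j" by (rule cyc_extE)
    have "k' \<in> {g \<in> carrier G. cmt G ?m g \<in> L}" using k' mD Kc unfolding D_def by blast
    moreover have "t [^] j \<in> {g \<in> carrier G. cmt G ?m g \<in> L}"
      by (rule subgroup_int_pow_closed[OF C]) (use tc mt in simp)
    ultimately show ?thesis using subgroup.m_closed[OF C] k'(2) by blast
  qed
  then show ?case using mD mL unfolding D_def by blast
qed

lemma cmt_swap_in: "subgroup L G \<Longrightarrow> a \<in> carrier G \<Longrightarrow> b \<in> carrier G \<Longrightarrow> cmt G a b \<in> L \<longleftrightarrow> cmt G b a \<in> L"
  using cmt_inv subgroup.m_inv_closed by metis

text \<open>Climbs an upper central series of \<open>F\<close> relative to \<open>U\<close> by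
  maximality instead of by counting: if a maximal \<open>L\<close> with trivial
  \<open>[L, U, ..., U]\<close> were proper, the elements of \<open>F\<close> centralized by
  \<open>U\<close> modulo \<open>L\<close> would form a larger one. In this form it serves both for
  terms of the lower central series and for Fitting's theorem.\<close>

lemma upper_central_reaches:
  assumes pcs: "pcs G (carrier G)" and F: "F \<lhd> G" and U: "U \<lhd> G"
    and step: "\<And>L. L \<lhd> G \<Longrightarrow> L \<subseteq> F \<Longrightarrow> L \<noteq> F \<Longrightarrow> \<exists>m\<in>F - L. \<forall>g\<in>U. cmt G m g \<in> L"
  shows "\<exists>j. icomm G F U j = {\<one>}"
proof -
  define \<F> where "\<F> = {L. L \<lhd> G \<and> L \<subseteq> F \<and> (\<exists>j. icomm G L U j = {\<one>})}"
  have "icomm G {\<one>} U 0 = {\<one>}" by simp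
  then have "{\<one>} \<in> \<F>"
    unfolding \<F>_def using one_is_normal subgroup.one_closed[OF normal_sub(1)[OF F]] by blast
  then have ne: "\<F> \<noteq> {}" by blast
  have sub: "subgroup V G" if "V \<in> \<F>" for V using that normal_sub(1)[of V] by (simp add: \<F>_def)
  obtain L where L: "L \<in> \<F>" and max: "\<And>V. V \<in> \<F> \<Longrightarrow> L \<subseteq> V \<Longrightarrow> V = L"
    using pcs_maximal_subgroup_in_family[OF pcs sub ne] by blast
  then obtain j where Ln: "L \<lhd> G" "L \<subseteq> F" and j: "icomm G L U j = {\<one>}" unfolding \<F>_def by blast
  note Ls = normal_sub(1)[OF Ln(1)]
  have Fc: "m \<in> carrier G" if "m \<in> F" for m using normal_sub(2)[OF F] that by blast
  have Uc: "g \<in> carrier G" if "g \<in> U" for g using normal_sub(2)[OF U] that by blast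
  have "L = F"
  proof (rule ccontr)
    assume "L \<noteq> F"
    then obtain m where m: "m \<in> F - L" "\<And>g. g \<in> U \<Longrightarrow> cmt G m g \<in> L" using step[OF Ln] by blast
    \<comment> \<open>With \<open>g\<close> as first argument the condition is a centralizer modulo
      \<open>L\<close> for each fixed \<open>g\<close>, hence defines a subgroup.\<close>
    define L' where "L' = {m \<in> F. \<forall>g\<in>U. cmt G g m \<in> L}"
    have "subgroup L' G"
    proof (rule subgroupI)
      show "L' \<subseteq> carrier G" using Fc unfolding L'_def by blast
      have "\<one> \<in> L'" using subgroup.one_closed[OF normal_sub(1)[OF F]] subgroup.one_closed[OF Ls]
        using Uc unfolding L'_def by simp
      then show "L' \<noteq> {}" by blast
      fix a assume a: "a \<in> L'"
      show "inv a \<in> L'"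
        using a subgroup.m_inv_closed[OF normal_sub(1)[OF F]] Fc subgroup.m_inv_closed[OF centralizer_mod_subgroup[OF Ln(1)]]
        using Uc unfolding L'_def by simp
      fix b assume b: "b \<in> L'"
      show "a \<otimes> b \<in> L'"
        using a b subgroup.m_closed[OF normal_sub(1)[OF F]] Fc subgroup.m_closed[OF centralizer_mod_subgroup[OF Ln(1)]]
        using Uc unfolding L'_def by simp
    qed
    then have L'n: "L' \<lhd> G"
    proof (rule normal_invI)
      fix y a assume y: "y \<in> carrier G" and a: "a \<in> L'"
      have aF: "a \<in> F" using a by (simp add: L'_def)
      have "cmt G g (y \<otimes> a \<otimes> inv y) \<in> L" if gU: "g \<in> U" for g
      proof -
        have g: "g \<in> carrier G" using Uc gU .
        have "cmt G g (y \<otimes> a \<otimes> inv y) = y \<otimes> cmt G (inv y \<otimes> g \<otimes> y) a \<otimes> inv y"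
          using g y Fc[OF aF] by (simp add: cmt_def inv_mult_group m_assoc)
        moreover have "cmt G (inv y \<otimes> g \<otimes> y) a \<in> L" using a normal_conj'[OF U y gU] unfolding L'_def by simp
        ultimately show ?thesis using normal_conj[OF Ln(1) y] by simp
      qed
      then show "y \<otimes> a \<otimes> inv y \<in> L'" using normal_conj[OF F y aF] unfolding L'_def by blast
    qed
    have LL': "L \<subseteq> L'" using Ln(2) cmt_in_normal(2)[OF Ln(1)] Uc unfolding L'_def by blast
    have "m \<in> L'" using m cmt_swap_in[OF Ls Fc[of m]] Uc unfolding L'_def by blast
    have L'F: "L' \<subseteq> F" unfolding L'_def by blast
    have "icomm G L' U (Suc 0) \<subseteq> L"
    proof (rule icomm_Suc_subsetI[OF Ls])
      fix a b assume "a \<in> icomm G L' U 0" "b \<in> U"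
      then show "cmt G a b \<in> L" using cmt_swap_in[OF Ls Fc[of a] Uc[of b]] unfolding L'_def by simp
    qed
    then have "icomm G L' U (Suc 0 + j) \<subseteq> {\<one>}"
      unfolding icomm_add using icomm_mono[of _ L U U j] j by blast
    then have "icomm G L' U (Suc 0 + j) = {\<one>}"
      using one_in_icomm[OF normal_sub(1)[OF L'n] normal_sub(2)[OF U], of "Suc 0 + j"] by blast
    then have "L' \<in> \<F>" unfolding \<F>_def using L'n L'F by blast
    then have "L' = L" using max LL' by blast
    then show False using \<open>m \<in> L'\<close> m(1) by blast
  qed
  then show ?thesis using j by blast
qed

text \<open>The transfer into a central subgroup of index \<open>n\<close> is a homomorphism to an abelian group and
  restricts to \<open>z \<mapsto> z ^ n\<close>.\<close>
lemma central_transfer: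
  assumes Z: "subgroup Z G" and cen: "\<And>z g. z \<in> Z \<Longrightarrow> g \<in> carrier G \<Longrightarrow> z \<otimes> g = g \<otimes> z"
    and fin: "finite (rcosets Z)" and z: "z \<in> Z" "z \<in> derived G (carrier G)"
  shows "z [^] card (rcosets Z) = \<one>"
proof -
  have Zc: "z \<in> carrier G" if "z \<in> Z" for z using subgroup.mem_carrier[OF Z that] .
  have Zn: "Z \<lhd> G"
  proof (rule normal_invI[OF Z])
    fix y a assume y: "y \<in> carrier G" and a: "a \<in> Z"
    have "y \<otimes> a \<otimes> inv y = a" using cen[OF a y] y Zc[OF a] by (metis inv_solve_right m_closed)
    then show "y \<otimes> a \<otimes> inv y \<in> Z" using a by simp
  qed
  define Q where "Q = G Mod Z"
  define h where "h = (\<lambda>a. Z #> a)"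
  interpret q: group_hom G Q h unfolding Q_def h_def by (rule quotient_hom(1)[OF Zn])
  have surj: "h ` carrier G = carrier Q" unfolding Q_def h_def by (rule quotient_hom(2)[OF Zn])
  have ker: "h g = \<one>\<^bsub>Q\<^esub> \<longleftrightarrow> g \<in> Z" if "g \<in> carrier G" for g
    using quotient_hom(3)[OF Zn that] unfolding h_def Q_def .
  have QR: "carrier Q = rcosets Z" unfolding Q_def by (simp add: FactGroup_def)
  let ?Z = "G\<lparr>carrier := Z\<rparr>"
  interpret zg: group ?Z by (rule subgroup_imp_group[OF Z])
  interpret cz: comm_group ?Z
  proof (rule zg.group_comm_groupI)
    fix a b assume "a \<in> carrier ?Z" "b \<in> carrier ?Z"
    then show "a \<otimes>\<^bsub>?Z\<^esub> b = b \<otimes>\<^bsub>?Z\<^esub> a" using cen[of a b] Zc[of b] by simp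
  qed
  define s where "s = (\<lambda>c. SOME a. a \<in> carrier G \<and> h a = c)"
  have s: "s c \<in> carrier G" "h (s c) = c" if "c \<in> carrier Q" for c
  proof -
    have "c \<in> h ` carrier G" using surj that by simp
    then have "\<exists>a. a \<in> carrier G \<and> h a = c" by blast
    from someI_ex[OF this] show "s c \<in> carrier G" "h (s c) = c" unfolding s_def by auto
  qed
  \<comment> \<open>The contribution of the coset \<open>c\<close> to the transfer: it compares
    \<open>g\<close> times the representative of \<open>c\<close> with the representative of the
    product coset.\<close>
  define d where "d = (\<lambda>g c. inv (s (h g \<otimes>\<^bsub>Q\<^esub> c)) \<otimes> g \<otimes> s c)"
  have dZ: "d g c \<in> Z" if "g \<in> carrier G" "c \<in> carrier Q" for g c
  proof -
    have gc: "h g \<otimes>\<^bsub>Q\<^esub> c \<in> carrier Q" using that by simp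
    have dc: "d g c \<in> carrier G" unfolding d_def using s(1)[OF gc] s(1)[OF that(2)] that by simp
    have "h (d g c) = inv\<^bsub>Q\<^esub> (h g \<otimes>\<^bsub>Q\<^esub> c) \<otimes>\<^bsub>Q\<^esub> h g \<otimes>\<^bsub>Q\<^esub> c"
      unfolding d_def using s[OF gc] s[OF that(2)] that by simp
    also have "\<dots> = \<one>\<^bsub>Q\<^esub>" using that by (simp add: q.H.inv_mult_group q.H.m_assoc)
    finally show ?thesis using ker[OF dc] by simp
  qed
  have coc: "d (g \<otimes> g') c = d g (h g' \<otimes>\<^bsub>Q\<^esub> c) \<otimes> d g' c"
    if "g \<in> carrier G" "g' \<in> carrier G" "c \<in> carrier Q" for g g' c
  proof -
    have c1: "h g' \<otimes>\<^bsub>Q\<^esub> c \<in> carrier Q" and c2: "h g \<otimes>\<^bsub>Q\<^esub> (h g' \<otimes>\<^bsub>Q\<^esub> c) \<in> carrier Q" using that by simp_all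
    have e: "h (g \<otimes> g') \<otimes>\<^bsub>Q\<^esub> c = h g \<otimes>\<^bsub>Q\<^esub> (h g' \<otimes>\<^bsub>Q\<^esub> c)" using that by (simp add: q.H.m_assoc)
    show ?thesis unfolding d_def e using that s(1)[OF c1] s(1)[OF c2] s(1)[OF that(3)] by (simp add: m_assoc)
  qed
  define \<phi> where "\<phi> = (\<lambda>g. finprod ?Z (d g) (carrier Q))"
  have hom: "\<phi> \<in> hom G ?Z"
  proof (rule homI)
    fix g assume "g \<in> carrier G"
    then show "\<phi> g \<in> carrier ?Z" unfolding \<phi>_def using dZ by (intro cz.finprod_closed) auto
  next
    fix g g' assume g: "g \<in> carrier G" "g' \<in> carrier G"
    \<comment> \<open>Multiplication by \<open>h g'\<close> permutes the cosets; reindexing by it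
      turns the cocycle identity \<open>coc\<close> into multiplicativity of the transfer.\<close>
    let ?f = "\<lambda>c. h g' \<otimes>\<^bsub>Q\<^esub> c"
    have inj: "inj_on ?f (carrier Q)" using g by (intro inj_onI) simp
    have im: "?f ` carrier Q = carrier Q"
    proof
      show "?f ` carrier Q \<subseteq> carrier Q" using g by auto
      show "carrier Q \<subseteq> ?f ` carrier Q"
      proof
        fix c assume "c \<in> carrier Q"
        then have "c = ?f (inv\<^bsub>Q\<^esub> h g' \<otimes>\<^bsub>Q\<^esub> c)" "inv\<^bsub>Q\<^esub> h g' \<otimes>\<^bsub>Q\<^esub> c \<in> carrier Q" using g by simp_all
        then show "c \<in> ?f ` carrier Q" by blast
      qed
    qed
    have "\<phi> (g \<otimes> g') = finprod ?Z (\<lambda>c. d g (?f c) \<otimes>\<^bsub>?Z\<^esub> d g' c) (carrier Q)"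
      unfolding \<phi>_def using g coc dZ by (intro cz.finprod_cong') (auto intro!: subgroup.m_closed[OF Z])
    also have "\<dots> = finprod ?Z (\<lambda>c. d g (?f c)) (carrier Q) \<otimes>\<^bsub>?Z\<^esub> \<phi> g'"
      unfolding \<phi>_def using g dZ by (intro cz.finprod_multf) auto
    also have "finprod ?Z (\<lambda>c. d g (?f c)) (carrier Q) = \<phi> g"
      unfolding \<phi>_def using cz.finprod_reindex[of "d g" ?f "carrier Q"] inj im dZ[OF g(1)] by auto
    finally show "\<phi> (g \<otimes> g') = \<phi> g \<otimes>\<^bsub>?Z\<^esub> \<phi> g'" .
  qed
  interpret p: group_hom G ?Z \<phi> by (simp add: group_hom_def group_hom_axioms_def hom zg.is_group is_group)
  have "derived G (carrier G) \<subseteq> kernel G ?Z \<phi>"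
  proof (rule derived_subsetI[OF p.subgroup_kernel])
    fix a b assume ab: "a \<in> carrier G" "b \<in> carrier G"
    have "\<phi> (cmt G a b) = cmt ?Z (\<phi> a) (\<phi> b)" by (rule p.hom_cmt[OF ab])
    also have "\<dots> = \<one>\<^bsub>?Z\<^esub>"
      using zg.cmt_eq_one_iff[OF p.hom_closed[OF ab(1)] p.hom_closed[OF ab(2)]]
        cz.m_comm[OF p.hom_closed[OF ab(1)] p.hom_closed[OF ab(2)]] by blast
    finally show "cmt G a b \<in> kernel G ?Z \<phi>" using ab by (simp add: kernel_def)
  qed
  then have "\<phi> z = \<one>" using z(2) by (auto simp: kernel_def)
  moreover have "\<phi> z = z [^] card (rcosets Z)"
  proof -
    have "d z c = z" if c: "c \<in> carrier Q" for c
    proof -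
      have "h z = \<one>\<^bsub>Q\<^esub>" using ker[OF Zc[OF z(1)]] z(1) by simp
      then have "d z c = inv (s c) \<otimes> (z \<otimes> s c)" using c s(1)[OF c] Zc[OF z(1)] by (simp add: d_def m_assoc)
      then show ?thesis using cen[OF z(1) s(1)[OF c]] s(1)[OF c] Zc[OF z(1)] by simp
    qed
    then have "\<phi> z = finprod ?Z (\<lambda>c. z) (carrier Q)"
      unfolding \<phi>_def using z(1) by (intro cz.finprod_cong') auto
    also have "\<dots> = z [^]\<^bsub>?Z\<^esub> card (carrier Q)" using z(1) by (intro cz.finprod_const) simp
    also have "\<dots> = z [^] card (rcosets Z)" unfolding QR nat_pow_def by simp
    finally show ?thesis .
  qed
  ultimately show ?thesis by simp
qed

end

section \<open>Finite lower central terms\<close>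

context group
begin

lemma cyc_ext_finite:
  assumes "finite B" "s \<in> carrier G" "n > 0" "s [^] (n::nat) = \<one>"
  shows "finite (cyc_ext G B s)"
proof -
  have "cyc_ext G B s \<subseteq> (\<lambda>(a, j). a \<otimes> s [^] j) ` (B \<times> {0..<int n})"
  proof
    fix y assume "y \<in> cyc_ext G B s"
    then obtain a and j :: int where a: "a \<in> B" "y = a \<otimes> s [^] j" by (rule cyc_extE)
    have sn: "s [^] int n = \<one>" using assms(4) by (simp add: int_pow_int)
    have "s [^] j = s [^] (int n * (j div int n) + j mod int n)" by simp
    also have "\<dots> = (s [^] int n) [^] (j div int n) \<otimes> s [^] (j mod int n)"
      using int_pow_mult[OF assms(2)] int_pow_pow[OF assms(2)] by metis
    also have "\<dots> = s [^] (j mod int n)" unfolding sn using assms(2) by simp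
    finally have "y = (\<lambda>(a, j). a \<otimes> s [^] j) (a, j mod int n)" using a(2) by simp
    moreover have "(a, j mod int n) \<in> B \<times> {0..<int n}" using a(1) assms(3) by simp
    ultimately show "y \<in> (\<lambda>(a, j). a \<otimes> s [^] j) ` (B \<times> {0..<int n})" by (rule image_eqI)
  qed
  then show ?thesis using assms(1) by (meson finite_SigmaI finite_atLeastLessThan_int finite_imageI finite_subset)
qed

lemma finite_if_trivial_meet:
  assumes N: "N \<lhd> G" and D: "subgroup D G" "D \<inter> N \<subseteq> {\<one>}" and fin: "finite {N #> k | k. k \<in> K}" "D \<subseteq> K"
  shows "finite D"
proof -
  have "inj_on (\<lambda>k. N #> k) D"
  proof (rule inj_onI)
    fix a b assume ab: "a \<in> D" "b \<in> D" "N #> a = N #> b"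
    have c: "a \<in> carrier G" "b \<in> carrier G" using ab subgroup.subset[OF D(1)] by blast+
    have "a \<otimes> inv b \<in> N" using quotient_eq_iff[OF N c] ab(3) by blast
    moreover have "a \<otimes> inv b \<in> D"
      using ab subgroup.m_closed[OF D(1)] subgroup.m_inv_closed[OF D(1)] by blast
    ultimately have "a \<otimes> inv b = \<one>" using D(2) by blast
    then show "a = b" using c by (metis inv_equality inv_inv inv_closed)
  qed
  moreover have "(\<lambda>k. N #> k) ` D \<subseteq> {N #> k | k. k \<in> K}" using fin(2) by blast
  ultimately show ?thesis using fin(1) by (meson finite_imageD finite_subset)
qed

lemma fgs_abelian_torsion_finite:
  assumes "finite S" "S \<subseteq> carrier G" "\<And>a b. a \<in> S \<Longrightarrow> b \<in> S \<Longrightarrow> a \<otimes> b = b \<otimes> a"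
    "n > 0" "\<And>a. a \<in> S \<Longrightarrow> a [^] (n::nat) = \<one>"
  shows "finite (generate G S)"
  using assms(1,2,3,5)
proof (induction S rule: finite_induct)
  case empty
  then show ?case by (simp add: generate_empty)
next
  case (insert s S)
  have sc: "s \<in> carrier G" and Sc: "S \<subseteq> carrier G" using insert.prems by auto
  have fin: "finite (generate G S)" using insert.IH insert.prems by auto
  note sub = generate_is_subgroup[OF Sc]
  have com: "a \<otimes> s = s \<otimes> a" if "a \<in> generate G S" for a
  proof -
    have "generate G S \<subseteq> {g \<in> carrier G. s \<otimes> g = g \<otimes> s}"
      by (rule generate_subgroup_incl[OF _ centralizer_subgroup[OF sc]]) (use insert.prems(2) Sc in auto)
    then show ?thesis using that by auto
  qed
  have c: "a \<in> carrier G" if "a \<in> generate G S" for a using subgroup.mem_carrier[OF sub that] .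
  have "s \<otimes> a \<otimes> inv s \<in> generate G S" "inv s \<otimes> a \<otimes> s \<in> generate G S" if a: "a \<in> generate G S" for a
  proof -
    have "s \<otimes> a \<otimes> inv s = a" unfolding com[OF a, symmetric] using c[OF a] sc by (simp add: m_assoc)
    then show "s \<otimes> a \<otimes> inv s \<in> generate G S" using a by simp
    have "inv s \<otimes> (a \<otimes> s) = a" unfolding com[OF a] using c[OF a] sc by simp
    then show "inv s \<otimes> a \<otimes> s \<in> generate G S" using a c[OF a] sc by (simp add: m_assoc)
  qed
  then have X: "subgroup (cyc_ext G (generate G S) s) G" by (intro cyc_ext_subgroup[OF sub sc])
  have "insert s S \<subseteq> cyc_ext G (generate G S) s"
    using cyc_ext_incl[OF sub sc] generate.incl[of _ S G] by blast
  then have le: "generate G (insert s S) \<subseteq> cyc_ext G (generate G S) s" by (rule generate_subgroup_incl[OF _ X])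
  have "s [^] n = \<one>" using insert.prems(3) by simp
  then have "finite (cyc_ext G (generate G S) s)" by (rule cyc_ext_finite[OF fin sc assms(4)])
  then show ?case using le finite_subset by blast
qed

text \<open>The elements of \<open>M\<close> killed by \<open>n\<close> form a normal subgroup of
  \<open>G\<close>. It is finitely generated because of the polycyclic series, so as an abelian
  group of finite exponent it is finite.\<close>

lemma normal_abelian_torsion_free:
  assumes pcs: "pcs G (carrier G)" and nofin: "\<And>R. R \<lhd> G \<Longrightarrow> finite R \<Longrightarrow> R = {\<one>}"
    and M: "M \<lhd> G" and com: "\<And>a b. a \<in> M \<Longrightarrow> b \<in> M \<Longrightarrow> a \<otimes> b = b \<otimes> a"
    and a: "a \<in> M" "n > 0" "a [^] (n::nat) = \<one>"
  shows "a = \<one>"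
proof -
  define R where "R = {a \<in> M. a [^] n = \<one>}"
  note Ms = normal_sub(1)[OF M]
  have Mc: "a \<in> carrier G" if "a \<in> M" for a using normal_sub(2)[OF M] that by blast
  have Rs: "subgroup R G"
  proof (rule subgroupI)
    show "R \<subseteq> carrier G" using Mc unfolding R_def by blast
    have "\<one> \<in> R" unfolding R_def using subgroup.one_closed[OF Ms] by simp
    then show "R \<noteq> {}" by blast
    fix a assume a: "a \<in> R"
    then show "inv a \<in> R" unfolding R_def using subgroup.m_inv_closed[OF Ms] Mc nat_pow_inv[of a n] by simp
    fix b assume b: "b \<in> R"
    have "(a \<otimes> b) [^] n = a [^] n \<otimes> b [^] n"
      using a b com[of a b] Mc unfolding R_def by (intro pow_mult_distrib) auto
    then show "a \<otimes> b \<in> R" using a b subgroup.m_closed[OF Ms] unfolding R_def by simp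
  qed
  have Rn: "R \<lhd> G"
  proof (rule normal_invI[OF Rs])
    fix y a assume y: "y \<in> carrier G" and a: "a \<in> R"
    have ac: "a \<in> carrier G" using a Mc unfolding R_def by blast
    have "(y \<otimes> a \<otimes> inv y) [^] n = y \<otimes> a [^] n \<otimes> inv y"
      using int_pow_conj[OF ac y, of "int n"] by (simp add: int_pow_int)
    then show "y \<otimes> a \<otimes> inv y \<in> R" using a y normal_conj[OF M y, of a] unfolding R_def by simp
  qed
  obtain S where S: "finite S" "S \<subseteq> carrier G" "generate G S = R"
    using pcs_subgroup_fgs[OF pcs Rs subgroup.subset[OF Rs]] unfolding fgs_def by blast
  have SR: "S \<subseteq> R" using S(3) generate.incl[of _ S G] by blast
  have "finite (generate G S)"
  proof (rule fgs_abelian_torsion_finite[OF S(1,2) _ a(2)])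
    fix u v assume "u \<in> S" "v \<in> S"
    then show "u \<otimes> v = v \<otimes> u" using SR com[of u v] unfolding R_def by blast
  next
    fix u assume "u \<in> S"
    then show "u [^] n = \<one>" using SR unfolding R_def by blast
  qed
  then have "R = {\<one>}" using nofin[OF Rn] S(3) by simp
  moreover have "a \<in> R" using a unfolding R_def by simp
  ultimately show ?thesis by blast
qed

lemma conj_module_normal:
  assumes "A \<lhd> G" "\<And>a b. a \<in> A \<Longrightarrow> b \<in> A \<Longrightarrow> a \<otimes> b = b \<otimes> a" "x \<in> carrier G"
  shows "conj_module G A x"
  by (rule conj_module.intro[OF is_group conj_module_axioms.intro])
    (use assms normal_sub(1)[OF assms(1)] normal_conj[OF assms(1,3)] normal_conj'[OF assms(1,3)] in blast)+

lemma center_subgroup: "subgroup (center G) G"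
proof (rule subgroupI)
  show "center G \<noteq> {}" unfolding center_def by auto
  fix a assume a: "a \<in> center G"
  show "inv a \<in> center G"
  proof -
    have "inv a \<otimes> g = g \<otimes> inv a" if g: "g \<in> carrier G" for g
    proof -
      have ac: "a \<in> carrier G" and e: "inv g \<otimes> a = a \<otimes> inv g" using a g unfolding center_def by auto
      have "inv a \<otimes> g = inv (inv g \<otimes> a)" using ac g by (simp add: inv_mult_group)
      also have "\<dots> = g \<otimes> inv a" unfolding e using ac g by (simp add: inv_mult_group)
      finally show ?thesis .
    qed
    moreover have "inv a \<in> carrier G" using a unfolding center_def by blast
    ultimately show ?thesis unfolding center_def by blast
  qed
  fix b assume b: "b \<in> center G"
  have "a \<otimes> b \<otimes> g = g \<otimes> (a \<otimes> b)" if g: "g \<in> carrier G" for g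
  proof -
    have c: "a \<in> carrier G" "b \<in> carrier G" and ag: "a \<otimes> g = g \<otimes> a" and bg: "b \<otimes> g = g \<otimes> b"
      using a b g unfolding center_def by auto
    have "a \<otimes> b \<otimes> g = a \<otimes> (g \<otimes> b)" unfolding bg[symmetric] using c g by (simp add: m_assoc)
    also have "\<dots> = (a \<otimes> g) \<otimes> b" using c g by (simp add: m_assoc)
    also have "\<dots> = g \<otimes> (a \<otimes> b)" unfolding ag using c g by (simp add: m_assoc)
    finally show ?thesis .
  qed
  moreover have "a \<otimes> b \<in> carrier G" using a b unfolding center_def by blast
  ultimately show "a \<otimes> b \<in> center G" unfolding center_def by blast
qed (auto simp: center_def)

lemma centerD: "z \<in> center G \<Longrightarrow> g \<in> carrier G \<Longrightarrow> z \<otimes> g = g \<otimes> z"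
  and center_carrier: "z \<in> center G \<Longrightarrow> z \<in> carrier G"
  by (auto simp: center_def)

lemma central_subgroup_normal:
  assumes "subgroup Z G" "Z \<subseteq> center G" shows "Z \<lhd> G"
proof (rule normal_invI[OF assms(1)])
  fix y a assume y: "y \<in> carrier G" and a: "a \<in> Z"
  have "y \<otimes> a \<otimes> inv y = a \<otimes> y \<otimes> inv y" using centerD[of a y] a y assms(2) by auto
  then show "y \<otimes> a \<otimes> inv y \<in> Z"
    using a y subgroup.mem_carrier[OF assms(1) a] by (simp add: m_assoc)
qed

lemma derived_trivial_imp_commute:
  assumes "derived G H = {\<one>}" "H \<subseteq> carrier G" "a \<in> H" "b \<in> H" shows "a \<otimes> b = b \<otimes> a"
proof -
  have "cmt G a b = \<one>" using cmt_in_derived[OF assms(3,4)] assms(1) by simp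
  then show ?thesis using cmt_eq_one_iff[of a b] assms by blast
qed

lemma normal_pow_index:
  assumes "N \<lhd> G" "finite (rcosets N)" "g \<in> carrier G" shows "g [^] card (rcosets N) \<in> N"
proof -
  define Q where "Q = G Mod N"
  define h where "h = (\<lambda>a. N #> a)"
  interpret q: group_hom G Q h unfolding Q_def h_def by (rule quotient_hom(1)[OF assms(1)])
  have QR: "carrier Q = rcosets N" unfolding Q_def by (simp add: FactGroup_def)
  have "h g [^]\<^bsub>Q\<^esub> Coset.order Q = \<one>\<^bsub>Q\<^esub>" using q.H.pow_order_eq_1 assms(3) by simp
  then have "h (g [^] card (rcosets N)) = \<one>\<^bsub>Q\<^esub>"
    using q.hom_nat_pow[OF assms(3)] QR by (simp add: Coset.order_def)
  then show ?thesis using quotient_hom(3)[OF assms(1), of "g [^] card (rcosets N)"] assms(3) unfolding h_def Q_def by simp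
qed

lemma finite_of_finite_cosets:
  assumes R: "subgroup R G" "finite R" and K: "K \<subseteq> carrier G" and f: "finite {R #> k | k. k \<in> K}"
  shows "finite K"
proof -
  have "K \<subseteq> \<Union>{R #> k | k. k \<in> K}" using rcos_self[OF _ R(1)] K by blast
  moreover have "finite (R #> k)" for k using R(2) unfolding r_coset_def by simp
  then have "finite (\<Union>{R #> k | k. k \<in> K})" using f by (intro finite_Union) auto
  ultimately show ?thesis using finite_subset by blast
qed

text \<open>The last nontrivial term of the derived series.\<close>

lemma nontrivial_abelian_normal:
  assumes "solvable G" "carrier G \<noteq> {\<one>}"
  shows "\<exists>A. A \<lhd> G \<and> A \<noteq> {\<one>} \<and> (\<forall>a\<in>A. \<forall>b\<in>A. a \<otimes> b = b \<otimes> a)"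
proof -
  obtain n where "(derived G ^^ n) (carrier G) = {\<one>}" using assms(1) solvable_iff_trivial_derived_seq by blast
  then obtain n where n: "(derived G ^^ n) (carrier G) = {\<one>}"
    and lt: "\<And>k. k < n \<Longrightarrow> (derived G ^^ k) (carrier G) \<noteq> {\<one>}"
    using exists_least_iff[of "\<lambda>n. (derived G ^^ n) (carrier G) = {\<one>}"] by blast
  have "n \<noteq> 0" using n assms(2) by (intro notI) simp
  then obtain k where k: "n = Suc k" using not0_implies_Suc by blast
  let ?A = "(derived G ^^ k) (carrier G)"
  have "derived G ?A = {\<one>}" using n k by simp
  then have "\<forall>a\<in>?A. \<forall>b\<in>?A. a \<otimes> b = b \<otimes> a"
    using derived_trivial_imp_commute normal_sub(2)[OF derived_funpow_normal] by blast
  then show ?thesis using derived_funpow_normal[of k] lt[of k] k by blast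
qed

text \<open>Without finite normal subgroups, abelian normal subgroups are torsion-free, every element acts
  unipotently on them, and so the centre is nontrivial. If \<open>K\<close> is finite over the centre, then \<open>K'\<close>
  is finite by transfer, hence trivial, and uniqueness of roots in \<open>K\<close> makes \<open>K\<close> central.\<close>
lemma finite_by_nilpotent_step:
  assumes pcs: "pcs G (carrier G)" and meta: "meta_nil_hamiltonian G" and sol: "solvable G"
    and IH: "\<And>Z. Z \<lhd> G \<Longrightarrow> Z \<noteq> {\<one>} \<Longrightarrow> \<exists>K i. K \<lhd> G \<and> Z \<subseteq> K \<and> finite {Z #> k | k. k \<in> K}
        \<and> icomm G (carrier G) (carrier G) i \<subseteq> K"
  shows "\<exists>K i. K \<lhd> G \<and> finite K \<and> icomm G (carrier G) (carrier G) i \<subseteq> K"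
proof (cases "carrier G = {\<one>}")
  case True
  then have "icomm G (carrier G) (carrier G) 0 \<subseteq> {\<one>}" by simp
  then show ?thesis using one_is_normal by blast
next
  case nontriv: False
  show ?thesis
  proof (cases "\<exists>R. R \<lhd> G \<and> finite R \<and> R \<noteq> {\<one>}")
    case True
    then obtain R where R: "R \<lhd> G" "finite R" "R \<noteq> {\<one>}" by blast
    obtain K i where K: "K \<lhd> G" "finite {R #> k | k. k \<in> K}" "icomm G (carrier G) (carrier G) i \<subseteq> K"
      using IH[OF R(1,3)] by blast
    have "finite K" by (rule finite_of_finite_cosets[OF normal_sub(1)[OF R(1)] R(2) normal_sub(2)[OF K(1)] K(2)])
    then show ?thesis using K by blast
  next
    case False
    then have nofin: "\<And>R. R \<lhd> G \<Longrightarrow> finite R \<Longrightarrow> R = {\<one>}" by blast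
    obtain A where A: "A \<lhd> G" "A \<noteq> {\<one>}" and Acom: "\<And>a b. a \<in> A \<Longrightarrow> b \<in> A \<Longrightarrow> a \<otimes> b = b \<otimes> a"
      using nontrivial_abelian_normal[OF sol nontriv] by blast
    have Ac: "a \<in> carrier G" if "a \<in> A" for a using normal_sub(2)[OF A(1)] that by blast
    have eng: "\<exists>n. engel G x n m \<in> {\<one>}" if x: "x \<in> carrier G" and m: "m \<in> A" for x m
    proof -
      interpret c: conj_module G A x by (rule conj_module_normal[OF A(1) Acom x])
      consider n where "engel G x n m = \<one>" | k :: int where "k > 0" "engel G x 2 m [^] k = \<one>"
        using c.engel_eventually_trivial_or_torsion[OF meta m] by blast
      then show ?thesis
      proof cases
        case 2
        have "engel G x 2 m [^] nat k = \<one>" using 2 by (metis int_pow_int nat_0_le order_less_imp_le)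
        moreover have "engel G x 2 m \<in> A" using m by (simp only: c.engel_eq_pact c.pact_in)
        ultimately have "engel G x 2 m = \<one>"
          using normal_abelian_torsion_free[OF pcs nofin A(1) Acom, of "engel G x 2 m" "nat k"] 2 by simp
        then show ?thesis by blast
      qed blast
    qed
    have "\<exists>m. m \<in> A - {\<one>}" using A(2) subgroup.one_closed[OF normal_sub(1)[OF A(1)]] by blast
    then obtain m where m: "m \<in> A - {\<one>}" "\<And>g. g \<in> carrier G \<Longrightarrow> cmt G m g \<in> {\<one>}"
      using exists_central_mod[OF A(1) one_is_normal _ eng pcs] by blast
    have "m \<in> center G"
      unfolding center_def using m Ac cmt_eq_one_iff by blast
    then have Zne: "center G \<noteq> {\<one>}" using m(1) by blast
    have Zn: "center G \<lhd> G" by (rule central_subgroup_normal[OF center_subgroup subset_refl])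
    have Ztf: "z = \<one>" if "z \<in> center G" "n > 0" "z [^] (n::nat) = \<one>" for z n
      using normal_abelian_torsion_free[OF pcs nofin Zn _ that] centerD center_carrier by blast
    obtain K i where K: "K \<lhd> G" "center G \<subseteq> K" "finite {center G #> k | k. k \<in> K}"
      "icomm G (carrier G) (carrier G) i \<subseteq> K" using IH[OF Zn Zne] by blast
    note Ks = normal_sub(1)[OF K(1)]
    have Kc: "k \<in> carrier G" if "k \<in> K" for k using normal_sub(2)[OF K(1)] that by blast
    let ?K = "G\<lparr>carrier := K\<rparr>"
    interpret k: group ?K by (rule subgroup_imp_group[OF Ks])
    have ZK: "subgroup (center G) ?K" by (rule subgroup_incl[OF center_subgroup Ks K(2)])
    have cos: "rcosets\<^bsub>?K\<^esub> (center G) = {center G #> k | k. k \<in> K}"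
      unfolding RCOSETS_def r_coset_def by auto
    have fin: "finite (rcosets\<^bsub>?K\<^esub> (center G))" using K(3) cos by simp
    define n where "n = card (rcosets\<^bsub>?K\<^esub> (center G))"
    have "rcosets\<^bsub>?K\<^esub> (center G) \<noteq> {}" unfolding cos using subgroup.one_closed[OF Ks] by blast
    then have npos: "n > 0" unfolding n_def using fin by (simp add: card_gt_0_iff)
    have dK: "derived ?K K = derived G K" by (rule derived_consistent[OF subset_refl Ks])
    have DZ: "derived G K \<inter> center G \<subseteq> {\<one>}"
    proof
      fix z assume z: "z \<in> derived G K \<inter> center G"
      have "z [^]\<^bsub>?K\<^esub> n = \<one>\<^bsub>?K\<^esub>"
        unfolding n_def
        by (rule k.central_transfer[OF ZK _ fin]) (use z dK centerD Kc in auto)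
      then have "z [^] n = \<one>" by (simp add: nat_pow_def)
      then show "z \<in> {\<one>}" using Ztf[OF _ npos, of z] z by blast
    qed
    have Dn: "derived G K \<lhd> G" by (rule derived_is_normal[OF K(1)])
    have DK: "derived G K \<subseteq> K" by (rule derived_incl[OF subset_refl Ks])
    have "finite (derived G K)" by (rule finite_if_trivial_meet[OF Zn normal_sub(1)[OF Dn] DZ K(3) DK])
    then have "derived G K = {\<one>}" using nofin[OF Dn] by blast
    then have Kcom: "\<And>a b. a \<in> K \<Longrightarrow> b \<in> K \<Longrightarrow> a \<otimes> b = b \<otimes> a"
      using derived_trivial_imp_commute[OF _ normal_sub(2)[OF K(1)]] by blast
    have Zk: "center G \<lhd> ?K"
      by (rule k.normal_invI[OF ZK]) (use normal_conj[OF Zn] Kc m_inv_consistent[OF Ks] in simp)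
    have cent: "cmt G y g = \<one>" if y: "y \<in> K" and g: "g \<in> carrier G" for y g
    proof -
      have "y [^]\<^bsub>?K\<^esub> n \<in> center G" unfolding n_def by (rule k.normal_pow_index[OF Zk fin]) (use y in simp)
      then have yn: "y [^] n \<in> center G" by (simp add: nat_pow_def)
      define w where "w = g \<otimes> y \<otimes> inv g"
      have wK: "w \<in> K" unfolding w_def by (rule normal_conj[OF K(1) g y])
      have "w [^] n = g \<otimes> y [^] n \<otimes> inv g"
        unfolding w_def using int_pow_conj[OF Kc[OF y] g, of "int n"] by (simp add: int_pow_int)
      also have "\<dots> = y [^] n" using centerD[OF yn g, symmetric] g Kc[OF y] by (simp add: m_assoc)
      finally have wn: "w [^] n = y [^] n" .
      have "(w \<otimes> inv y) [^] n = w [^] n \<otimes> inv y [^] n"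
        using Kcom[OF wK subgroup.m_inv_closed[OF Ks y]] Kc[OF wK] Kc[OF y] by (intro pow_mult_distrib) auto
      also have "\<dots> = \<one>" using wn Kc[OF y] by (simp add: nat_pow_inv)
      finally have "w \<otimes> inv y = \<one>"
        using normal_abelian_torsion_free[OF pcs nofin K(1) Kcom, of "w \<otimes> inv y" n] npos
          subgroup.m_closed[OF Ks wK subgroup.m_inv_closed[OF Ks y]] by simp
      then have "cmt G g y = \<one>" unfolding w_def cmt_def .
      then show ?thesis using cmt_eq_one_iff[OF g Kc[OF y]] cmt_eq_one_iff[OF Kc[OF y] g] by simp
    qed
    \<comment> \<open>\<open>K\<close> is now central, so the lower central series ends one step
      after entering it, and the trivial subgroup can serve as the finite one.\<close>
    have "icomm G (carrier G) (carrier G) (Suc i) \<subseteq> {\<one>}"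
      by (rule icomm_Suc_subsetI[OF triv_subgroup]) (use K(4) cent in blast)
    then show ?thesis using one_is_normal by blast
  qed
qed

text \<open>The predicate \<open>P R\<close> says that \<open>G\<close> modulo \<open>R\<close> is
  finite-by-nilpotent. It is stated through a subgroup of \<open>G\<close> containing
  \<open>R\<close>, because factor groups have elements of another type and the induction has to run
  inside one group. For a maximal \<open>R\<close> violating it, the preimages of the nontrivial
  normal subgroups of \<open>G Mod R\<close> satisfy it, which is the premise of
  \<open>finite_by_nilpotent_step\<close>.\<close>

theorem lower_central_finite:
  assumes pcs: "pcs G (carrier G)" and meta: "meta_nil_hamiltonian G" and sol: "solvable G"
  shows "\<exists>i. finite (icomm G (carrier G) (carrier G) i)"
proof -
  define P where "P = (\<lambda>R. \<exists>K i. K \<lhd> G \<and> R \<subseteq> K \<and> finite {R #> k | k. k \<in> K} \<and> icomm G (carrier G) (carrier G) i \<subseteq> K)"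
  define \<F> where "\<F> = {R. R \<lhd> G \<and> \<not> P R}"
  have sub: "subgroup V G" if "V \<in> \<F>" for V using that normal_sub(1)[of V] by (simp add: \<F>_def)
  have "\<F> = {}"
  proof (rule ccontr)
    assume ne: "\<F> \<noteq> {}"
    obtain R where R: "R \<in> \<F>" and max: "\<And>V. V \<in> \<F> \<Longrightarrow> R \<subseteq> V \<Longrightarrow> V = R"
      using pcs_maximal_subgroup_in_family[OF pcs sub ne] by blast
    then have Rn: "R \<lhd> G" and nP: "\<not> P R" unfolding \<F>_def by auto
    define Q where "Q = G Mod R"
    define h where "h = (\<lambda>a. R #> a)"
    interpret q: group_hom G Q h unfolding Q_def h_def by (rule quotient_hom(1)[OF Rn])
    have surj: "h ` carrier G = carrier Q" unfolding Q_def h_def by (rule quotient_hom(2)[OF Rn])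
    have ker: "h g = \<one>\<^bsub>Q\<^esub> \<longleftrightarrow> g \<in> R" if "g \<in> carrier G" for g
      using quotient_hom(3)[OF Rn that] unfolding h_def Q_def .
    have Rc: "g \<in> carrier G" if "g \<in> R" for g using normal_sub(2)[OF Rn] that by blast
    have ic: "icomm Q (carrier Q) (carrier Q) i = h ` icomm G (carrier G) (carrier G) i" for i
      using q.icomm_img[OF subset_refl subset_refl, of i] surj by simp
    have "\<exists>K i. K \<lhd> Q \<and> finite K \<and> icomm Q (carrier Q) (carrier Q) i \<subseteq> K"
    proof (rule q.H.finite_by_nilpotent_step)
      show "pcs Q (carrier Q)" using q.pcs_img[OF pcs] surj by simp
      show "meta_nil_hamiltonian Q" by (rule q.meta_nil_hamiltonian_img[OF surj meta])
      show "solvable Q" by (rule q.surj_hom_imp_solvable[OF surj sol])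
      fix Z assume Z: "Z \<lhd> Q" "Z \<noteq> {\<one>\<^bsub>Q\<^esub>}"
      note Zs = q.H.normal_sub(1)[OF Z(1)]
      define V where "V = {g \<in> carrier G. h g \<in> Z}"
      have V: "V \<lhd> G" unfolding V_def by (rule q.vimage_normal[OF Z(1)])
      have hV: "h ` V = Z"
      proof
        show "h ` V \<subseteq> Z" unfolding V_def by blast
        have "Z \<subseteq> h ` carrier G" using surj q.H.normal_sub(2)[OF Z(1)] by simp
        then show "Z \<subseteq> h ` V" unfolding V_def by blast
      qed
      have RV: "R \<subseteq> V"
      proof
        fix r assume r: "r \<in> R"
        then show "r \<in> V" using ker[OF Rc[OF r]] Rc[OF r] subgroup.one_closed[OF Zs] unfolding V_def by simp
      qed
      have "V \<noteq> R"
      proof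
        assume "V = R"
        then have "Z \<subseteq> {\<one>\<^bsub>Q\<^esub>}" using hV ker Rc by blast
        then show False using Z(2) subgroup.one_closed[OF Zs] by blast
      qed
      then have "P V" using max[OF _ RV] V unfolding \<F>_def by blast
      then obtain K i where K: "K \<lhd> G" "V \<subseteq> K" "finite {V #> k | k. k \<in> K}" "icomm G (carrier G) (carrier G) i \<subseteq> K"
        unfolding P_def by blast
      have co: "Z #>\<^bsub>Q\<^esub> h k = h ` (V #> k)" if k: "k \<in> K" for k
      proof -
        have kc: "k \<in> carrier G" using normal_sub(2)[OF K(1)] k by blast
        have hm: "h (v \<otimes> k) = h v \<otimes>\<^bsub>Q\<^esub> h k" if "v \<in> V" for v
          using kc normal_sub(2)[OF V] that by (intro q.hom_mult) auto
        have "h ` (V #> k) = (\<lambda>v. h (v \<otimes> k)) ` V" unfolding r_coset_def by blast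
        also have "\<dots> = (\<lambda>v. h v \<otimes>\<^bsub>Q\<^esub> h k) ` V" using hm by (intro image_cong) auto
        also have "\<dots> = (\<lambda>y. y \<otimes>\<^bsub>Q\<^esub> h k) ` Z" unfolding hV[symmetric] by (simp add: image_image)
        also have "\<dots> = Z #>\<^bsub>Q\<^esub> h k" unfolding r_coset_def by blast
        finally show ?thesis by (rule sym)
      qed
      have f: "finite {Z #>\<^bsub>Q\<^esub> y | y. y \<in> h ` K}"
      proof -
        have "{Z #>\<^bsub>Q\<^esub> y | y. y \<in> h ` K} = (\<lambda>k. Z #>\<^bsub>Q\<^esub> h k) ` K" by blast
        also have "\<dots> = (\<lambda>k. h ` (V #> k)) ` K" using co by (intro image_cong) auto
        also have "\<dots> = (\<lambda>C. h ` C) ` (\<lambda>k. V #> k) ` K" by (simp only: image_image)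
        finally show ?thesis using K(3) by (simp add: setcompr_eq_image)
      qed
      have "icomm Q (carrier Q) (carrier Q) i \<subseteq> h ` K" unfolding ic using K(4) by blast
      moreover have "Z \<subseteq> h ` K" using hV K(2) by blast
      ultimately show "\<exists>K i. K \<lhd> Q \<and> Z \<subseteq> K \<and> finite {Z #>\<^bsub>Q\<^esub> k | k. k \<in> K} \<and> icomm Q (carrier Q) (carrier Q) i \<subseteq> K"
        using q.normal_img[OF surj K(1)] f by blast
    qed
    then obtain K i where K: "K \<lhd> Q" "finite K" "icomm Q (carrier Q) (carrier Q) i \<subseteq> K" by blast
    define W where "W = {g \<in> carrier G. h g \<in> K}"
    have W: "W \<lhd> G" unfolding W_def by (rule q.vimage_normal[OF K(1)])
    have RW: "R \<subseteq> W"
    proof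
      fix r assume r: "r \<in> R"
      then show "r \<in> W" using ker[OF Rc[OF r]] Rc[OF r] subgroup.one_closed[OF q.H.normal_sub(1)[OF K(1)]] unfolding W_def by simp
    qed
    have "{R #> k | k. k \<in> W} \<subseteq> K" unfolding W_def h_def by blast
    then have "finite {R #> k | k. k \<in> W}" using K(2) finite_subset by blast
    moreover have "icomm G (carrier G) (carrier G) i \<subseteq> W"
      using K(3) icomm_incl[OF subset_refl subset_refl, of i] unfolding ic W_def by blast
    ultimately have "P R" unfolding P_def using W RW by blast
    then show False using nP by blast
  qed
  then have "P {\<one>}" using one_is_normal unfolding \<F>_def by blast
  then obtain K i where K: "K \<lhd> G" "finite {{\<one>} #> k | k. k \<in> K}" "icomm G (carrier G) (carrier G) i \<subseteq> K"
    unfolding P_def by blast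
  have "finite K" by (rule finite_of_finite_cosets[OF triv_subgroup _ normal_sub(2)[OF K(1)] K(2)]) simp
  then show ?thesis using K(3) finite_subset by blast
qed

end

section \<open>Torsion-free normal subgroups of finite index\<close>

context group
begin

lemma finite_subgroup_pow_card:
  assumes "subgroup R G" "finite R" "a \<in> R" shows "a [^] card R = \<one>"
proof -
  interpret r: group "G\<lparr>carrier := R\<rparr>" by (rule subgroup_imp_group[OF assms(1)])
  have "a [^]\<^bsub>G\<lparr>carrier := R\<rparr>\<^esub> card R = \<one>\<^bsub>G\<lparr>carrier := R\<rparr>\<^esub>"
    using r.pow_order_eq_1[of a] assms(3) by (simp add: Coset.order_def)
  then show ?thesis by (simp add: nat_pow_def)
qed

lemma finite_subgroup_meets_torsion_free:
  assumes "subgroup R G" "finite R" "\<And>a n. a \<in> N \<Longrightarrow> n > 0 \<Longrightarrow> a [^] (n::nat) = \<one> \<Longrightarrow> a = \<one>"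
  shows "R \<inter> N \<subseteq> {\<one>}"
proof
  fix a assume a: "a \<in> R \<inter> N"
  have "card R > 0" using assms(2) a by (auto simp: card_gt_0_iff)
  then show "a \<in> {\<one>}" using assms(3)[of a "card R"] finite_subgroup_pow_card[OF assms(1,2)] a by blast
qed

text \<open>Otherwise \<open>G\<close> acts on this term by Engel elements, so
  \<open>exists_central_mod\<close> and \<open>upper_central_reaches\<close> drive the lower central
  series from there to the identity.\<close>

lemma exists_non_engel:
  assumes pcs: "pcs G (carrier G)" and nil: "\<not> nilpotent_grp G"
  shows "\<exists>x\<in>carrier G. \<exists>f\<in>icomm G (carrier G) (carrier G) i. \<forall>n. engel G x n f \<noteq> \<one>"
proof (rule ccontr)
  define F where "F = icomm G (carrier G) (carrier G) i"
  assume "\<not> ?thesis"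
  then have neg: "\<not> (\<exists>x\<in>carrier G. \<exists>f\<in>F. \<forall>n. engel G x n f \<noteq> \<one>)" unfolding F_def .
  have F: "F \<lhd> G" unfolding F_def by (rule icomm_normal[OF normal_self normal_self])
  have "\<exists>j. icomm G F (carrier G) j = {\<one>}"
  proof (rule upper_central_reaches[OF pcs F normal_self])
    fix L assume L: "L \<lhd> G" "L \<subseteq> F" "L \<noteq> F"
    have one: "\<one> \<in> L" by (rule subgroup.one_closed[OF normal_sub(1)[OF L(1)]])
    show "\<exists>m\<in>F - L. \<forall>g\<in>carrier G. cmt G m g \<in> L"
    proof (rule exists_central_mod[OF F L(1) _ _ pcs])
      show "\<exists>m. m \<in> F - L" using L(2,3) by blast
      fix x m assume "x \<in> carrier G" "m \<in> F"
      then obtain n where "engel G x n m = \<one>" using neg by blast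
      then have "engel G x n m \<in> L" using one by simp
      then show "\<exists>n. engel G x n m \<in> L" by blast
    qed
  qed
  then obtain j where "icomm G F (carrier G) j = {\<one>}" by blast
  then have "icomm G (carrier G) (carrier G) (i + j) = {\<one>}" unfolding icomm_add F_def .
  then show False using nil nilpotent_iff by blast
qed

text \<open>Let \<open>F\<close> be the finite term of the lower central series and \<open>x\<close> act on \<open>F\<close> non-nilpotently. So does
  \<open>y = x c\<close> for \<open>c \<in> N\<close>, hence \<open>F\<langle>y\<rangle>\<close> is normal; as \<open>G / F\<close> is nilpotent, \<open>y\<close> is central modulo
  \<open>F\<close> whenever it has infinite order. Among \<open>x c ^ k\<close>, \<open>k \<le> 3\<close>, two consecutive ones have infinite
  order, and their quotient is \<open>c\<close>.\<close>
lemma torsion_free_normal_central: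
  assumes pcs: "pcs G (carrier G)" and meta: "meta_nil_hamiltonian G" and nil: "\<not> nilpotent_grp G"
    and fin: "finite (icomm G (carrier G) (carrier G) i)"
    and N: "N \<lhd> G" "finite (rcosets N)"
    and tf: "\<And>a n. a \<in> N \<Longrightarrow> n > 0 \<Longrightarrow> a [^] (n::nat) = \<one> \<Longrightarrow> a = \<one>"
  shows "N \<subseteq> center G"
proof -
  define F where "F = icomm G (carrier G) (carrier G) i"
  have F: "F \<lhd> G" unfolding F_def by (rule icomm_normal[OF normal_self normal_self])
  note Fs = normal_sub(1)[OF F] and Ns = normal_sub(1)[OF N(1)]
  have Fc: "a \<in> carrier G" if "a \<in> F" for a using normal_sub(2)[OF F] that by blast
  have Nc: "a \<in> carrier G" if "a \<in> N" for a using normal_sub(2)[OF N(1)] that by blast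
  have Ffin: "finite F" using fin unfolding F_def .
  have FN: "F \<inter> N \<subseteq> {\<one>}" by (rule finite_subgroup_meets_torsion_free[OF Fs Ffin tf])
  define r where "r = card (rcosets N)"
  have "rcosets N \<noteq> {}" unfolding RCOSETS_def by auto
  then have r: "r > 0" unfolding r_def using N(2) by (simp add: card_gt_0_iff)
  have powN: "g [^] r \<in> N" if "g \<in> carrier G" for g
    unfolding r_def by (rule normal_pow_index[OF N that])
  obtain x f where x: "x \<in> carrier G" and f: "f \<in> F" and ne: "\<And>n. engel G x n f \<noteq> \<one>"
    using exists_non_engel[OF pcs nil, of i] unfolding F_def by blast
  have comFN: "c \<otimes> m = m \<otimes> c" if c: "c \<in> N" and m: "m \<in> F" for c m
  proof -
    have "cmt G c m \<in> F \<inter> N" using cmt_in_normal(2)[OF F m Nc[OF c]] cmt_in_normal(1)[OF N(1) c Fc[OF m]] by blast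
    then have "cmt G c m = \<one>" using FN by blast
    then show ?thesis using cmt_eq_one_iff[OF Nc[OF c] Fc[OF m]] by blast
  qed
  \<comment> \<open>As \<open>c\<close> centralizes \<open>F\<close>, the commutators with
    \<open>x\<close> and with \<open>x c\<close> coincide on \<open>F\<close>.\<close>
  have ne': "engel G (x \<otimes> c) n f \<noteq> \<one>" if c: "c \<in> N" for c n
  proof -
    have "engel G (x \<otimes> c) n f = engel G x n f \<and> engel G x n f \<in> F"
    proof (induction n)
      case (Suc n)
      define m where "m = engel G x n f"
      have m: "m \<in> F" using Suc m_def by simp
      have e: "c \<otimes> inv m = inv m \<otimes> c" by (rule comFN[OF c subgroup.m_inv_closed[OF Fs m]])
      have "cmt G m (x \<otimes> c) = m \<otimes> x \<otimes> (c \<otimes> inv m) \<otimes> inv c \<otimes> inv x"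
        using x Nc[OF c] Fc[OF m] by (simp add: cmt_def inv_mult_group m_assoc)
      also have "\<dots> = cmt G m x"
        unfolding e using x Nc[OF c] Fc[OF m] by (simp add: cmt_def m_assoc)
      finally show ?case using Suc cmt_in_normal(1)[OF F m x] unfolding m_def engel_Suc by simp
    qed (use f in simp)
    then show ?thesis using ne by simp
  qed
  have ext_normal: "cyc_ext G F y \<lhd> G" if y: "y \<in> carrier G" and e: "\<And>n. engel G y n f \<noteq> \<one>" for y
  proof -
    have s: "subgroup (cyc_ext G F y) G"
      by (rule cyc_ext_subgroup[OF Fs y normal_conj[OF F y] normal_conj'[OF F y]])
    have "f \<in> cyc_ext G F y" "y \<in> cyc_ext G F y" using cyc_ext_incl[OF Fs y] f by auto
    then have "\<not> nilpotent_grp (G\<lparr>carrier := cyc_ext G F y\<rparr>)"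
      using not_nilpotent_if_engel[OF s _ _ e] by blast
    then show ?thesis using meta s unfolding meta_nil_hamiltonian_def by blast
  qed
  \<comment> \<open>Modulo \<open>F\<close>, conjugation by \<open>g\<close> maps \<open>y\<close>
    to some \<open>y ^ j\<close>, so commuting \<open>i\<close> times with \<open>g\<close> sends
    \<open>y\<close> to its power with exponent \<open>(1 - j) ^ i\<close>. The result lies in the
    lower central term \<open>F\<close>, and infinite order modulo \<open>F\<close> forces
    \<open>j = 1\<close>.\<close>
  have central_mod: "cmt G y g \<in> F"
    if y: "y \<in> carrier G" and e: "\<And>n. engel G y n f \<noteq> \<one>" and yr: "y [^] r \<noteq> \<one>" and g: "g \<in> carrier G" for y g
  proof -
    define Q where "Q = G Mod F"
    define h where "h = (\<lambda>a. F #> a)"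
    interpret q: group_hom G Q h unfolding Q_def h_def by (rule quotient_hom(1)[OF F])
    have ker: "h g = \<one>\<^bsub>Q\<^esub> \<longleftrightarrow> g \<in> F" if "g \<in> carrier G" for g
      using quotient_hom(3)[OF F that] unfolding h_def Q_def .
    \<comment> \<open>\<open>y [^] r\<close> is a nontrivial element of the torsion-free
      \<open>N\<close>, so it has infinite order, and no nontrivial power of it lies in
      \<open>F\<close>.\<close>
    have inf: "j = 0" if yj: "y [^] j \<in> F" for j :: int
    proof (rule ccontr)
      assume j: "j \<noteq> 0"
      have "(y [^] j) [^] int r = (y [^] int r) [^] j" using y by (simp only: int_pow_pow mult.commute)
      moreover have "(y [^] j) [^] int r \<in> F" by (rule subgroup_int_pow_closed[OF Fs yj])
      moreover have "(y [^] int r) [^] j \<in> N" using subgroup_int_pow_closed[OF Ns powN[OF y]] by (simp add: int_pow_int)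
      ultimately have "(y [^] int r) [^] j = \<one>" using FN by auto
      then have z: "(y [^] r) [^] j = \<one>" by (simp add: int_pow_int)
      have "(y [^] r) [^] nat \<bar>j\<bar> = \<one>"
      proof (cases "j \<ge> 0")
        case True
        then show ?thesis using z by (metis abs_of_nonneg int_pow_int nat_0_le)
      next
        case False
        then have "(y [^] r) [^] (- j) = \<one>" using z y by (simp add: int_pow_neg)
        then show ?thesis using False by (metis abs_of_neg int_pow_int linorder_not_le nat_0_le neg_0_le_iff_le order_less_imp_le)
      qed
      then have "y [^] r = \<one>" using tf[OF powN[OF y], of "nat \<bar>j\<bar>"] j by simp
      then show False using yr by simp
    qed
    have "g \<otimes> y \<otimes> inv g \<in> cyc_ext G F y"
      by (rule normal_conj[OF ext_normal[OF y e] g cyc_ext_incl(2)[OF Fs y]])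
    then obtain u and j :: int where u: "u \<in> F" "g \<otimes> y \<otimes> inv g = u \<otimes> y [^] j" by (rule cyc_extE)
    have hj: "h g \<otimes>\<^bsub>Q\<^esub> h y \<otimes>\<^bsub>Q\<^esub> inv\<^bsub>Q\<^esub> h g = h y [^]\<^bsub>Q\<^esub> j"
    proof -
      have "h g \<otimes>\<^bsub>Q\<^esub> h y \<otimes>\<^bsub>Q\<^esub> inv\<^bsub>Q\<^esub> h g = h (g \<otimes> y \<otimes> inv g)" using g y by simp
      also have "\<dots> = h u \<otimes>\<^bsub>Q\<^esub> h y [^]\<^bsub>Q\<^esub> j" using u y Fc[OF u(1)] q.hom_int_pow[OF y] by simp
      also have "h u = \<one>\<^bsub>Q\<^esub>" using ker[OF Fc[OF u(1)]] u(1) by simp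
      finally show ?thesis using y by simp
    qed
    have cm: "cmt Q (h y [^]\<^bsub>Q\<^esub> k) (h g) = h y [^]\<^bsub>Q\<^esub> (k * (1 - j))" for k :: int
    proof -
      have hy: "h y \<in> carrier Q" and hg: "h g \<in> carrier Q" using y g by simp_all
      have "h g \<otimes>\<^bsub>Q\<^esub> h y [^]\<^bsub>Q\<^esub> (- k) \<otimes>\<^bsub>Q\<^esub> inv\<^bsub>Q\<^esub> h g = (h y [^]\<^bsub>Q\<^esub> j) [^]\<^bsub>Q\<^esub> (- k)"
        using q.H.int_pow_conj[OF hy hg, of "- k"] hj by simp
      also have "\<dots> = h y [^]\<^bsub>Q\<^esub> (- (k * j))" using q.H.int_pow_pow[OF hy] by (simp add: mult.commute)
      finally have c: "h g \<otimes>\<^bsub>Q\<^esub> h y [^]\<^bsub>Q\<^esub> (- k) \<otimes>\<^bsub>Q\<^esub> inv\<^bsub>Q\<^esub> h g = h y [^]\<^bsub>Q\<^esub> (- (k * j))" .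
      have "cmt Q (h y [^]\<^bsub>Q\<^esub> k) (h g) = h y [^]\<^bsub>Q\<^esub> k \<otimes>\<^bsub>Q\<^esub> (h g \<otimes>\<^bsub>Q\<^esub> h y [^]\<^bsub>Q\<^esub> (- k) \<otimes>\<^bsub>Q\<^esub> inv\<^bsub>Q\<^esub> h g)"
        using hy hg by (simp add: cmt_def q.H.m_assoc q.H.int_pow_neg)
      also have "\<dots> = h y [^]\<^bsub>Q\<^esub> (k + - (k * j))" unfolding c by (rule q.H.int_pow_mult[OF hy, symmetric])
      finally show ?thesis by (simp add: algebra_simps)
    qed
    have "engel Q (h g) n (h y) = h y [^]\<^bsub>Q\<^esub> ((1 - j) ^ n)" for n
    proof (induction n)
      case (Suc n)
      then show ?case using cm[of "(1 - j) ^ n"] by (simp add: engel_Suc mult.commute)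
    qed (use y in simp)
    then have "h (engel G g i y) = h (y [^] ((1 - j) ^ i))"
      using q.hom_engel[OF g y] q.hom_int_pow[OF y] by simp
    moreover have "engel G g i y \<in> F" unfolding F_def by (rule engel_in_icomm[OF y g])
    ultimately have "h (y [^] ((1 - j) ^ i)) = \<one>\<^bsub>Q\<^esub>" using ker[OF engel_closed[OF g y, of i]] by metis
    then have "y [^] ((1 - j) ^ i) \<in> F" using ker[OF int_pow_closed[OF y]] by blast
    then have "(1 - j) ^ i = 0" by (rule inf)
    then have "j = 1" by simp
    have "h (cmt G y g) = cmt Q (h y [^]\<^bsub>Q\<^esub> (1::int)) (h g)" using q.hom_cmt[OF y g] y by simp
    also have "\<dots> = \<one>\<^bsub>Q\<^esub>" unfolding cm \<open>j = 1\<close> by simp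
    finally show ?thesis using ker[OF cmt_closed[OF y g]] by blast
  qed
  \<comment> \<open>Allows \<open>(x c ^ k) ^ r\<close> to be expanded. If \<open>x\<close> has
    finite order, its extension of \<open>F\<close> is a finite normal subgroup and meets
    \<open>N\<close> trivially; otherwise \<open>central_mod\<close> applies to
    \<open>x\<close>.\<close>
  have xN: "x \<otimes> c = c \<otimes> x" if c: "c \<in> N" for c
  proof -
    have cN: "cmt G x c \<in> N" by (rule cmt_in_normal(2)[OF N(1) c x])
    have "cmt G x c = \<one>"
    proof (cases "x [^] r = \<one>")
      case True
      have En: "cyc_ext G F x \<lhd> G" by (rule ext_normal[OF x ne])
      have "finite (cyc_ext G F x)" by (rule cyc_ext_finite[OF Ffin x r True])
      then have "cyc_ext G F x \<inter> N \<subseteq> {\<one>}" by (rule finite_subgroup_meets_torsion_free[OF normal_sub(1)[OF En] _ tf])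
      moreover have "cmt G x c \<in> cyc_ext G F x"
        by (rule cmt_in_normal(1)[OF En cyc_ext_incl(2)[OF Fs x] Nc[OF c]])
      ultimately show ?thesis using cN by blast
    next
      case False
      then show ?thesis using central_mod[OF x ne False Nc[OF c]] cN FN by blast
    qed
    then show ?thesis using cmt_eq_one_iff[OF x Nc[OF c]] by blast
  qed
  show ?thesis
  proof
    fix c assume c: "c \<in> N"
    have cc: "c \<in> carrier G" using Nc[OF c] .
    have ckN: "c [^] (k::nat) \<in> N" for k
      using subgroup_int_pow_closed[OF Ns c, of "int k"] by (simp add: int_pow_int)
    show "c \<in> center G"
    proof (cases "c = \<one>")
      case True
      then show ?thesis using subgroup.one_closed[OF center_subgroup] by simp
    next
      case False
      have pw: "(x \<otimes> c [^] k) [^] r = x [^] r \<otimes> c [^] (k * r)" for k :: nat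
        using pow_mult_distrib[OF xN[OF ckN[of k]] x, of r] cc by (simp add: nat_pow_pow)
      \<comment> \<open>Since \<open>c\<close> has infinite order, at most one
        \<open>x c ^ k\<close> has finite order. If that \<open>k\<close> is 0 or 1, then 2 and 3
        are good exponents; otherwise 0 and 1 are.\<close>
      have bad: "k = l" if k: "(x \<otimes> c [^] k) [^] r = \<one>" and l: "(x \<otimes> c [^] l) [^] r = \<one>" and kl: "k \<le> l" for k l :: nat
      proof (rule ccontr)
        assume "k \<noteq> l"
        have "x [^] r \<otimes> c [^] (k * r) = x [^] r \<otimes> c [^] (l * r)" using k l pw by simp
        then have e: "c [^] (k * r) = c [^] (l * r)" using x cc by simp
        have "l * r = k * r + (l - k) * r" using kl by (simp add: algebra_simps)
        then have "c [^] (l * r) = c [^] (k * r) \<otimes> c [^] ((l - k) * r)" using cc by (simp add: nat_pow_mult)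
        then have "c [^] (k * r) \<otimes> c [^] ((l - k) * r) = c [^] (k * r) \<otimes> \<one>" using e cc by simp
        then have "c [^] ((l - k) * r) = \<one>" using l_cancel cc nat_pow_closed one_closed by blast
        then have "c = \<one>" using tf[OF c, of "(l - k) * r"] r \<open>k \<noteq> l\<close> kl by simp
        then show False using False by simp
      qed
      have "\<exists>k. (x \<otimes> c [^] k) [^] r \<noteq> \<one> \<and> (x \<otimes> c [^] Suc k) [^] r \<noteq> \<one>"
      proof (cases "(x \<otimes> c [^] (0::nat)) [^] r \<noteq> \<one> \<and> (x \<otimes> c [^] Suc 0) [^] r \<noteq> \<one>")
        case False
        then obtain l :: nat where "l \<le> 1" "(x \<otimes> c [^] l) [^] r = \<one>" by fastforce
        then have "(x \<otimes> c [^] (2::nat)) [^] r \<noteq> \<one>" "(x \<otimes> c [^] Suc 2) [^] r \<noteq> \<one>"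
          using bad[of l 2] bad[of l "Suc 2"] by linarith+
        then show ?thesis by blast
      qed blast
      then obtain k where k: "(x \<otimes> c [^] k) [^] r \<noteq> \<one>" "(x \<otimes> c [^] Suc k) [^] r \<noteq> \<one>" by blast
      define u v where "u = x \<otimes> c [^] k" and "v = x \<otimes> c [^] Suc k"
      have uv: "u \<in> carrier G" "v \<in> carrier G" unfolding u_def v_def using x cc by simp_all
      have cuv: "c = inv u \<otimes> v" unfolding u_def v_def using x cc by (simp add: inv_mult_group m_assoc)
      have "c \<otimes> g = g \<otimes> c" if g: "g \<in> carrier G" for g
      proof -
        have "cmt G u g \<in> F" unfolding u_def
          by (rule central_mod[OF _ ne'[OF ckN] k(1) g]) (use x cc in simp)
        moreover have "cmt G v g \<in> F" unfolding v_def
          by (rule central_mod[OF _ ne'[OF ckN] k(2) g]) (use x cc in simp)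
        ultimately have "u \<in> {y \<in> carrier G. cmt G g y \<in> F}" "v \<in> {y \<in> carrier G. cmt G g y \<in> F}"
          using cmt_swap_in[OF Fs uv(1) g] cmt_swap_in[OF Fs uv(2) g] uv by blast+
        then have "c \<in> {y \<in> carrier G. cmt G g y \<in> F}"
          unfolding cuv using subgroup.m_closed[OF centralizer_mod_subgroup[OF F g]]
            subgroup.m_inv_closed[OF centralizer_mod_subgroup[OF F g]] by blast
        then have "cmt G g c = \<one>" using FN cmt_in_normal(2)[OF N(1) c g] by blast
        then show ?thesis using cmt_eq_one_iff[OF g cc] by simp
      qed
      then show ?thesis using cc unfolding center_def by simp
    qed
  qed
qed

section \<open>Subgroups of finite index\<close>

lemma finite_index_mono:
  assumes "subgroup N G" "subgroup K G" "N \<subseteq> K" "finite (rcosets N)" shows "finite (rcosets K)"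
proof -
  have "K #> a = K <#> (N #> a)" if a: "a \<in> carrier G" for a
  proof
    show "K #> a \<subseteq> K <#> (N #> a)"
    proof
      fix y assume "y \<in> K #> a"
      then obtain k where "k \<in> K" "y = k \<otimes> a" unfolding r_coset_def by blast
      moreover have "a \<in> N #> a" by (rule rcos_self[OF a assms(1)])
      ultimately show "y \<in> K <#> (N #> a)" unfolding set_mult_def by blast
    qed
    show "K <#> (N #> a) \<subseteq> K #> a"
    proof
      fix y assume "y \<in> K <#> (N #> a)"
      then obtain k n where k: "k \<in> K" "n \<in> N" "y = k \<otimes> (n \<otimes> a)" unfolding set_mult_def r_coset_def by blast
      have "y = (k \<otimes> n) \<otimes> a"
        using k a subgroup.mem_carrier[OF assms(1)] subgroup.mem_carrier[OF assms(2)] by (simp add: m_assoc)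
      moreover have "k \<otimes> n \<in> K" using k assms(3) subgroup.m_closed[OF assms(2)] by blast
      ultimately show "y \<in> K #> a" unfolding r_coset_def by blast
    qed
  qed
  then have "rcosets K \<subseteq> (\<lambda>C. K <#> C) ` (rcosets N)" unfolding RCOSETS_def by blast
  then show ?thesis using assms(4) finite_surj by blast
qed

text \<open>The core is the kernel of right multiplication on the cosets of \<open>H\<close>. Its
  index is finite because the permutation induced by an element determines the coset of that
  element.\<close>

lemma normal_core_finite_index:
  assumes H: "subgroup H G" and fin: "finite (rcosets H)"
  shows "\<exists>N. N \<lhd> G \<and> N \<subseteq> H \<and> finite (rcosets N)"
proof -
  let ?R = "rcosets H"
  define N where "N = {g \<in> carrier G. \<forall>C\<in>?R. C #> g = C}"
  have RC: "C \<subseteq> carrier G" if "C \<in> ?R" for C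
    using rcosets_part_G[OF H] that by blast
  have act: "C #> g \<in> ?R" if C: "C \<in> ?R" and g: "g \<in> carrier G" for C g
  proof -
    obtain a where a: "a \<in> carrier G" "C = H #> a" using C unfolding RCOSETS_def by blast
    then have "C #> g = H #> (a \<otimes> g)" using coset_mult_assoc[OF subgroup.subset[OF H]] g by simp
    then show ?thesis using rcosetsI[OF subgroup.subset[OF H]] a g by simp
  qed
  have Ns: "subgroup N G"
  proof (rule subgroupI)
    show "N \<subseteq> carrier G" unfolding N_def by blast
    have "\<one> \<in> N" unfolding N_def using RC by simp
    then show "N \<noteq> {}" by blast
    fix a assume a: "a \<in> N"
    have "C #> inv a = C" if C: "C \<in> ?R" for C
    proof -
      have "(C #> a) #> inv a = C" using coset_mult_assoc[OF RC[OF C], of a "inv a"] a RC[OF C] unfolding N_def by simp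
      then show ?thesis using a C unfolding N_def by simp
    qed
    then show "inv a \<in> N" using a unfolding N_def by simp
    fix b assume b: "b \<in> N"
    have "C #> (a \<otimes> b) = C" if C: "C \<in> ?R" for C
      using coset_mult_assoc[OF RC[OF C], of a b] a b C unfolding N_def by simp
    then show "a \<otimes> b \<in> N" using a b unfolding N_def by simp
  qed
  have Nn: "N \<lhd> G"
  proof (rule normal_invI[OF Ns])
    fix y a assume y: "y \<in> carrier G" and a: "a \<in> N"
    have ac: "a \<in> carrier G" using a unfolding N_def by blast
    have "C #> (y \<otimes> a \<otimes> inv y) = C" if C: "C \<in> ?R" for C
    proof -
      have "C #> (y \<otimes> a \<otimes> inv y) = ((C #> y) #> a) #> inv y"
        using y ac RC[OF C] RC[OF act[OF C y]] by (simp add: coset_mult_assoc m_assoc)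
      also have "(C #> y) #> a = C #> y" using a act[OF C y] unfolding N_def by blast
      also have "(C #> y) #> inv y = C" using y RC[OF C] by (simp add: coset_mult_assoc)
      finally show ?thesis .
    qed
    then show "y \<otimes> a \<otimes> inv y \<in> N" using y ac unfolding N_def by simp
  qed
  have "N \<subseteq> H"
  proof
    fix g assume g: "g \<in> N"
    have "H \<in> ?R" using rcosetsI[OF subgroup.subset[OF H] one_closed] subgroup.subset[OF H] by simp
    then have "H #> g = H" using g unfolding N_def by blast
    then show "g \<in> H" using coset_join1[OF _ _ H] g unfolding N_def by blast
  qed
  moreover have "finite (rcosets N)"
  proof -
    define p where "p = (\<lambda>g. \<lambda>C\<in>?R. C #> g)"
    have "p ` carrier G \<subseteq> ?R \<rightarrow>\<^sub>E ?R" unfolding p_def using act by auto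
    then have fp: "finite (p ` carrier G)" using fin finite_PiE[of ?R "\<lambda>_. ?R"] finite_subset by blast
    have eq: "N #> a = N #> b" if a: "a \<in> carrier G" and b: "b \<in> carrier G" and pab: "p a = p b" for a b
    proof -
      have "C #> (a \<otimes> inv b) = C" if C: "C \<in> ?R" for C
      proof -
        have "C #> a = C #> b" using fun_cong[OF pab, of C] C unfolding p_def by simp
        then have "(C #> a) #> inv b = C" using b RC[OF C] by (simp add: coset_mult_assoc)
        then show ?thesis using a b RC[OF C] by (simp add: coset_mult_assoc)
      qed
      then have "a \<otimes> inv b \<in> N" using a b unfolding N_def by simp
      then show ?thesis using quotient_eq_iff[OF Nn a b] by blast
    qed
    have "rcosets N \<subseteq> (\<lambda>q. N #> (SOME g. g \<in> carrier G \<and> p g = q)) ` (p ` carrier G)"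
    proof
      fix C assume "C \<in> rcosets N"
      then obtain a where a: "a \<in> carrier G" "C = N #> a" unfolding RCOSETS_def by blast
      define b where "b = (SOME g. g \<in> carrier G \<and> p g = p a)"
      have "b \<in> carrier G \<and> p b = p a" unfolding b_def by (rule someI[of _ a]) (use a in simp)
      then have "C = N #> b" using eq[of a b] a by simp
      then show "C \<in> (\<lambda>q. N #> (SOME g. g \<in> carrier G \<and> p g = q)) ` (p ` carrier G)"
        unfolding b_def using a(1) by blast
    qed
    then show ?thesis using fp finite_surj by blast
  qed
  ultimately show ?thesis using Nn by blast
qed

end

section \<open>Fitting subgroup and maximal subgroups\<close>

text \<open>The normalizer; both directions of conjugation are demanded because \<open>D\<close> may
  be infinite.\<close>

definition nrm :: "('a, 'b) monoid_scheme \<Rightarrow> 'a set \<Rightarrow> 'a set" where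
  "nrm G D = {g \<in> carrier G. \<forall>d\<in>D. g \<otimes>\<^bsub>G\<^esub> d \<otimes>\<^bsub>G\<^esub> inv\<^bsub>G\<^esub> g \<in> D \<and> inv\<^bsub>G\<^esub> g \<otimes>\<^bsub>G\<^esub> d \<otimes>\<^bsub>G\<^esub> g \<in> D}"

context group
begin

lemma nrm_subgroup:
  assumes "D \<subseteq> carrier G" shows "subgroup (nrm G D) G"
proof (rule subgroupI)
  show "nrm G D \<subseteq> carrier G" unfolding nrm_def by blast
  have "\<one> \<in> nrm G D" unfolding nrm_def using assms by (auto simp: subsetD)
  then show "nrm G D \<noteq> {}" by blast
  fix a assume a: "a \<in> nrm G D"
  then show "inv a \<in> nrm G D" unfolding nrm_def by simp
  fix b assume b: "b \<in> nrm G D"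
  have ab: "a \<in> carrier G" "b \<in> carrier G" using a b unfolding nrm_def by auto
  have "(a \<otimes> b) \<otimes> d \<otimes> inv (a \<otimes> b) \<in> D \<and> inv (a \<otimes> b) \<otimes> d \<otimes> (a \<otimes> b) \<in> D" if d: "d \<in> D" for d
  proof -
    have dc: "d \<in> carrier G" using assms d by blast
    have "(a \<otimes> b) \<otimes> d \<otimes> inv (a \<otimes> b) = a \<otimes> (b \<otimes> d \<otimes> inv b) \<otimes> inv a"
      "inv (a \<otimes> b) \<otimes> d \<otimes> (a \<otimes> b) = inv b \<otimes> (inv a \<otimes> d \<otimes> a) \<otimes> b"
      using ab dc by (simp_all add: inv_mult_group m_assoc)
    moreover have "a \<otimes> (b \<otimes> d \<otimes> inv b) \<otimes> inv a \<in> D" "inv b \<otimes> (inv a \<otimes> d \<otimes> a) \<otimes> b \<in> D"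
      using a b d unfolding nrm_def by blast+
    ultimately show ?thesis by simp
  qed
  then show "a \<otimes> b \<in> nrm G D" using ab unfolding nrm_def by blast
qed

lemma nrm_incl: "subgroup D G \<Longrightarrow> D \<subseteq> nrm G D"
  unfolding nrm_def by (auto intro!: subgroup.m_closed subgroup.m_inv_closed subgroup.mem_carrier)

lemma nrm_carrier_imp_normal:
  assumes "subgroup D G" "carrier G \<subseteq> nrm G D" shows "D \<lhd> G"
proof (rule normal_invI[OF assms(1)])
  fix y d assume "y \<in> carrier G" "d \<in> D"
  then show "y \<otimes> d \<otimes> inv y \<in> D" using assms(2) unfolding nrm_def by blast
qed

lemma generate_Un_is_normal:
  assumes "A \<lhd> G" "B \<lhd> G" shows "generate G (A \<union> B) \<lhd> G"
  using normal_sub(2)[OF assms(1)] normal_sub(2)[OF assms(2)] normal_conj[OF assms(1)] normal_conj[OF assms(2)]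
  by (intro normal_generateI) blast+

lemma icomm_self_subset: "subgroup A G \<Longrightarrow> icomm G A A n \<subseteq> A"
  using icomm_antimono[OF _ subgroup.subset subgroup_cmt, of A A 0 n] by auto

lemma last_icomm_not_in:
  assumes "icomm G L K n \<subseteq> V" "\<not> L \<subseteq> V"
  shows "\<exists>t. \<not> icomm G L K t \<subseteq> V \<and> icomm G L K (Suc t) \<subseteq> V"
proof -
  have "\<exists>n. icomm G L K n \<subseteq> V" using assms(1) by blast
  then obtain n where n: "icomm G L K n \<subseteq> V" and lt: "\<And>k. k < n \<Longrightarrow> \<not> icomm G L K k \<subseteq> V"
    using exists_least_iff[of "\<lambda>n. icomm G L K n \<subseteq> V"] by blast
  have "n \<noteq> 0" using n assms(2) by (intro notI) simp
  then obtain t where "n = Suc t" using not0_implies_Suc by blast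
  then show ?thesis using n lt[of t] by blast
qed

text \<open>Fitting's theorem. For \<open>L\<close> properly inside the join, an element outside
  \<open>L\<close> is sought that both \<open>A\<close> and \<open>B\<close> centralize modulo
  \<open>L\<close>. If \<open>A\<close> is not inside \<open>L\<close>, start from the last lower
  central term \<open>W\<close> of \<open>A\<close> outside \<open>L\<close> and commute it with
  \<open>B\<close> as long as the result stays outside \<open>L\<close>. This stops because
  \<open>[W, B]\<close> lies in the nilpotent \<open>B\<close>, and it never leaves the normal
  subgroup \<open>W\<close>, so \<open>A\<close> still centralizes the result modulo
  \<open>L\<close>. If \<open>A\<close> is inside \<open>L\<close>, the last lower central term of
  \<open>B\<close> outside \<open>L\<close> works.\<close>

theorem fitting_join_nilpotent:
  assumes pcs: "pcs G (carrier G)" and A: "A \<lhd> G" "nilpotent_grp (G\<lparr>carrier := A\<rparr>)"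
    and B: "B \<lhd> G" "nilpotent_grp (G\<lparr>carrier := B\<rparr>)"
  shows "nilpotent_grp (G\<lparr>carrier := generate G (A \<union> B)\<rparr>)"
proof -
  define J where "J = generate G (A \<union> B)"
  have J: "J \<lhd> G" unfolding J_def by (rule generate_Un_is_normal[OF A(1) B(1)])
  have AJ: "A \<subseteq> J" "B \<subseteq> J" unfolding J_def by (auto intro: generate.incl)
  note As = normal_sub(1)[OF A(1)] and Bs = normal_sub(1)[OF B(1)]
  obtain a where a: "icomm G A A a = {\<one>}" using A(2) nilpotent_subgroup_iff[OF As] by blast
  obtain b where b: "icomm G B B b = {\<one>}" using B(2) nilpotent_subgroup_iff[OF Bs] by blast
  have "\<exists>j. icomm G J J j = {\<one>}"
  proof (rule upper_central_reaches[OF pcs J J])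
    fix L assume L: "L \<lhd> G" "L \<subseteq> J" "L \<noteq> J"
    note Ls = normal_sub(1)[OF L(1)]
    have one: "{\<one>} \<subseteq> L" using subgroup.one_closed[OF Ls] by blast
    have fin: "\<exists>m\<in>J - L. \<forall>g\<in>J. cmt G m g \<in> L"
      if m: "m \<in> J" "m \<notin> L" "\<And>g. g \<in> A \<Longrightarrow> cmt G m g \<in> L" "\<And>g. g \<in> B \<Longrightarrow> cmt G m g \<in> L" for m
    proof -
      have mc: "m \<in> carrier G" using m(1) normal_sub(2)[OF J] by blast
      have "A \<union> B \<subseteq> {g \<in> carrier G. cmt G m g \<in> L}"
        using m(3,4) normal_sub(2)[OF A(1)] normal_sub(2)[OF B(1)] by blast
      then have "J \<subseteq> {g \<in> carrier G. cmt G m g \<in> L}"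
        unfolding J_def by (rule generate_subgroup_incl[OF _ centralizer_mod_subgroup[OF L(1) mc]])
      then show ?thesis using m(1,2) by blast
    qed
    show "\<exists>m\<in>J - L. \<forall>g\<in>J. cmt G m g \<in> L"
    proof (cases "A \<subseteq> L")
      case True
      have "\<not> B \<subseteq> L"
      proof
        assume "B \<subseteq> L"
        then have "J \<subseteq> L" unfolding J_def using True by (intro generate_subgroup_incl[OF _ Ls]) blast
        then show False using L(2,3) by blast
      qed
      then obtain t where t: "\<not> icomm G B B t \<subseteq> L" "icomm G B B (Suc t) \<subseteq> L"
        using last_icomm_not_in[of B B b L] b one by auto
      then obtain m where m: "m \<in> icomm G B B t" "m \<notin> L" by blast
      have mB: "m \<in> B" using m(1) icomm_self_subset[OF Bs] by blast
      then have mc: "m \<in> carrier G" using normal_sub(2)[OF B(1)] by blast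
      show ?thesis
      proof (rule fin[OF _ m(2)])
        show "m \<in> J" using mB AJ by blast
        show "cmt G m g \<in> L" if "g \<in> A" for g using cmt_in_normal(2)[OF A(1) that mc] True by blast
        show "cmt G m g \<in> L" if "g \<in> B" for g using cmt_in_icomm[OF m(1) that] t(2) by blast
      qed
    next
      case False
      then obtain t where t: "\<not> icomm G A A t \<subseteq> L" "icomm G A A (Suc t) \<subseteq> L"
        using last_icomm_not_in[of A A a L] a one by auto
      define W where "W = icomm G A A t"
      have W: "W \<lhd> G" unfolding W_def by (rule icomm_normal[OF A(1) A(1)])
      have Bc: "B \<subseteq> carrier G" by (rule normal_sub(2)[OF B(1)])
      have "icomm G W B (Suc 0) \<subseteq> B"
      proof (rule icomm_Suc_subsetI[OF Bs])
        fix u v assume "u \<in> icomm G W B 0" "v \<in> B"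
        then show "cmt G u v \<in> B" using cmt_in_normal(2)[OF B(1)] normal_sub(2)[OF W] by auto
      qed
      then have "icomm G W B (Suc 0 + b) \<subseteq> L"
        unfolding icomm_add using icomm_mono[of _ B B B b] b one by blast
      then obtain s where s: "\<not> icomm G W B s \<subseteq> L" "icomm G W B (Suc s) \<subseteq> L"
        using last_icomm_not_in[of W B "Suc 0 + b" L] t(1) unfolding W_def by blast
      then obtain m where m: "m \<in> icomm G W B s" "m \<notin> L" by blast
      have "icomm G W B s \<subseteq> icomm G W B 0"
      proof (rule icomm_antimono[OF normal_sub(1)[OF W] Bc])
        show "cmt G u v \<in> W" if "u \<in> W" "v \<in> B" for u v using cmt_in_normal(1)[OF W that(1)] that(2) Bc by blast
      qed simp
      then have mW: "m \<in> W" using m(1) by auto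
      then have mA: "m \<in> A" unfolding W_def using icomm_self_subset[OF As] by blast
      show ?thesis
      proof (rule fin[OF _ m(2)])
        show "m \<in> J" using mA AJ by blast
        show "cmt G m g \<in> L" if "g \<in> A" for g using cmt_in_icomm[of m A A t g] mW that t(2) unfolding W_def by blast
        show "cmt G m g \<in> L" if "g \<in> B" for g using cmt_in_icomm[OF m(1) that] s(2) by blast
      qed
    qed
  qed
  then show ?thesis using nilpotent_subgroup_iff[OF normal_sub(1)[OF J]] unfolding J_def by blast
qed

text \<open>A maximal nilpotent normal subgroup exists by the chain condition and, by Fitting's
  theorem, absorbs all others.\<close>

lemma fitting_nilpotent:
  assumes pcs: "pcs G (carrier G)"
  shows "nilpotent_grp (G\<lparr>carrier := fitting G\<rparr>)" "fitting G \<lhd> G"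
proof -
  define \<F> where "\<F> = {N. N \<lhd> G \<and> nilpotent_grp (G\<lparr>carrier := N\<rparr>)}"
  have sub: "subgroup V G" if "V \<in> \<F>" for V using that normal_sub(1)[of V] by (simp add: \<F>_def)
  have "icomm G {\<one>} {\<one>} 0 = {\<one>}" by simp
  then have "nilpotent_grp (G\<lparr>carrier := {\<one>}\<rparr>)" using nilpotent_subgroup_iff[OF triv_subgroup] by blast
  then have ne: "\<F> \<noteq> {}" unfolding \<F>_def using one_is_normal by blast
  obtain M where M: "M \<in> \<F>" and max: "\<And>V. V \<in> \<F> \<Longrightarrow> M \<subseteq> V \<Longrightarrow> V = M"
    using pcs_maximal_subgroup_in_family[OF pcs sub ne] by blast
  have "V \<subseteq> M" if V: "V \<in> \<F>" for V
  proof -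
    have "generate G (M \<union> V) \<in> \<F>"
      using M V fitting_join_nilpotent[OF pcs, of M V] generate_Un_is_normal[of M V] unfolding \<F>_def by simp
    moreover have le: "M \<union> V \<subseteq> generate G (M \<union> V)" by (auto intro: generate.incl)
    ultimately show ?thesis using max by blast
  qed
  then have "\<Union>\<F> \<subseteq> M" by blast
  then have "generate G (\<Union>\<F>) \<subseteq> M" by (rule generate_subgroup_incl[OF _ sub[OF M]])
  moreover have "M \<subseteq> generate G (\<Union>\<F>)" using M generate.incl[of _ "\<Union>\<F>" G] by blast
  ultimately have "fitting G = M" unfolding fitting_def \<F>_def by blast
  then show "nilpotent_grp (G\<lparr>carrier := fitting G\<rparr>)" "fitting G \<lhd> G" using M unfolding \<F>_def by auto
qed

lemma central_subgroup_nilpotent: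
  assumes "subgroup N G" "N \<subseteq> center G" shows "nilpotent_grp (G\<lparr>carrier := N\<rparr>)"
proof -
  have "icomm G N N (Suc 0) \<subseteq> {\<one>}"
  proof (rule icomm_Suc_subsetI[OF triv_subgroup])
    fix a b assume "a \<in> icomm G N N 0" "b \<in> N"
    then show "cmt G a b \<in> {\<one>}"
      using cmt_eq_one_iff[of a b] centerD[of a b] subgroup.mem_carrier[OF assms(1)] assms(2) by auto
  qed
  then have "icomm G N N (Suc 0) = {\<one>}"
    using one_in_icomm[OF assms(1) subgroup.subset[OF assms(1)], of "Suc 0"] by blast
  then show ?thesis using nilpotent_subgroup_iff[OF assms(1)] by blast
qed

lemma normal_subset_fitting: "N \<lhd> G \<Longrightarrow> nilpotent_grp (G\<lparr>carrier := N\<rparr>) \<Longrightarrow> N \<subseteq> fitting G"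
  unfolding fitting_def by (auto intro: generate.incl)

section \<open>Maximal supplements of the derived subgroup\<close>

lemma maximal_normal_derived:
  assumes M: "maximal_subgroup M G" "M \<lhd> G" shows "derived G (carrier G) \<subseteq> M"
proof -
  have Ms: "subgroup M G" and ne: "M \<noteq> carrier G"
    and max: "\<And>H. subgroup H G \<Longrightarrow> M \<subseteq> H \<Longrightarrow> H = M \<or> H = carrier G"
    using M(1) unfolding maximal_subgroup_def by auto
  obtain g where g: "g \<in> carrier G" "g \<notin> M" using ne subgroup.subset[OF Ms] by blast
  have "subgroup (cyc_ext G M g) G"
    by (rule cyc_ext_subgroup[OF Ms g(1) normal_conj[OF M(2) g(1)] normal_conj'[OF M(2) g(1)]])
  \<comment> \<open>Maximality makes the quotient by \<open>M\<close> cyclic, generated by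
    \<open>g\<close>, and therefore abelian.\<close>
  then have all: "cyc_ext G M g = carrier G" using max cyc_ext_incl[OF Ms g(1)] g(2) by blast
  define Q where "Q = G Mod M"
  define h where "h = (\<lambda>a. M #> a)"
  interpret q: group_hom G Q h unfolding Q_def h_def by (rule quotient_hom(1)[OF M(2)])
  have pw: "\<exists>j::int. h a = h g [^]\<^bsub>Q\<^esub> j" if "a \<in> carrier G" for a
  proof -
    have "a \<in> cyc_ext G M g" using all that by blast
    then obtain m and j :: int where m: "m \<in> M" "a = m \<otimes> g [^] j" by (rule cyc_extE)
    have mc: "m \<in> carrier G" using subgroup.mem_carrier[OF Ms m(1)] .
    have "h m = \<one>\<^bsub>Q\<^esub>" using quotient_hom(3)[OF M(2) mc] m(1) unfolding h_def Q_def by blast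
    then have "h a = h g [^]\<^bsub>Q\<^esub> j" using m mc g(1) q.hom_int_pow[OF g(1)] by simp
    then show ?thesis by blast
  qed
  show ?thesis
  proof (rule derived_subsetI[OF Ms])
    fix a b assume ab: "a \<in> carrier G" "b \<in> carrier G"
    obtain i j :: int where ij: "h a = h g [^]\<^bsub>Q\<^esub> i" "h b = h g [^]\<^bsub>Q\<^esub> j" using pw[OF ab(1)] pw[OF ab(2)] by blast
    have hg: "h g \<in> carrier Q" using g by simp
    have "h a \<otimes>\<^bsub>Q\<^esub> h b = h b \<otimes>\<^bsub>Q\<^esub> h a"
      unfolding ij q.H.int_pow_mult[OF hg, symmetric] by (simp add: add.commute)
    then show "cmt G a b \<in> M" using cmt_in_normal_iff_commute[OF M(2) ab] unfolding h_def Q_def by blast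
  qed
qed

lemma maximal_supplement_not_normal:
  assumes M: "maximal_subgroup M G" "M <#> derived G (carrier G) = carrier G" shows "\<not> M \<lhd> G"
proof
  assume "M \<lhd> G"
  then have d: "derived G (carrier G) \<subseteq> M" by (rule maximal_normal_derived[OF M(1)])
  have Ms: "subgroup M G" using M(1) unfolding maximal_subgroup_def by blast
  have "M <#> derived G (carrier G) \<subseteq> M" unfolding set_mult_def using d subgroup.m_closed[OF Ms] by blast
  then show False using M subgroup.subset[OF Ms] unfolding maximal_subgroup_def by blast
qed

lemma maximal_supplement_nilpotent:
  assumes "meta_nil_hamiltonian G" "maximal_subgroup M G" "M <#> derived G (carrier G) = carrier G"
  shows "nilpotent_grp (G\<lparr>carrier := M\<rparr>)"
  using maximal_supplement_not_normal[OF assms(2,3)] assms(1,2)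
  unfolding meta_nil_hamiltonian_def maximal_subgroup_def by blast

text \<open>A maximal subgroup that is not normal is its own normalizer, and the center normalizes
  every subgroup.\<close>

lemma maximal_supplement_contains_center:
  assumes M: "maximal_subgroup M G" "M <#> derived G (carrier G) = carrier G"
  shows "center G \<subseteq> M"
proof (rule ccontr)
  assume nz: "\<not> center G \<subseteq> M"
  have Ms: "subgroup M G" and max: "\<And>H. subgroup H G \<Longrightarrow> M \<subseteq> H \<Longrightarrow> H = M \<or> H = carrier G"
    using M(1) unfolding maximal_subgroup_def by auto
  have "center G \<subseteq> nrm G M"
  proof
    fix z assume z: "z \<in> center G"
    have zc: "z \<in> carrier G" by (rule center_carrier[OF z])
    have "z \<otimes> m \<otimes> inv z = m" "inv z \<otimes> m \<otimes> z = m" if m: "m \<in> M" for m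
    proof -
      have mc: "m \<in> carrier G" using subgroup.mem_carrier[OF Ms m] .
      have e: "z \<otimes> m = m \<otimes> z" by (rule centerD[OF z mc])
      show "z \<otimes> m \<otimes> inv z = m" unfolding e using zc mc by (simp add: m_assoc)
      have "inv z \<otimes> m \<otimes> z = inv z \<otimes> (z \<otimes> m)" unfolding e using zc mc by (simp add: m_assoc)
      then show "inv z \<otimes> m \<otimes> z = m" using zc mc by simp
    qed
    then show "z \<in> nrm G M" unfolding nrm_def using zc by simp
  qed
  then have "nrm G M = carrier G"
    using max[OF nrm_subgroup[OF subgroup.subset[OF Ms]] nrm_incl[OF Ms]] nz by blast
  then have "M \<lhd> G" using nrm_carrier_imp_normal[OF Ms] by blast
  then show False using maximal_supplement_not_normal[OF M] by blast
qed

text \<open>Each such subgroup is a union of cosets of the center, so it is determined by a subset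
  of a finite set.\<close>

lemma finite_maximal_supplements:
  assumes "finite (rcosets (center G))"
  shows "finite {M. maximal_subgroup M G \<and> M <#> derived G (carrier G) = carrier G}" (is "finite ?S")
proof -
  define p where "p = (\<lambda>M. {C \<in> rcosets (center G). C \<subseteq> M})"
  have un: "\<Union>(p M) = M" if M: "M \<in> ?S" for M
  proof
    show "\<Union>(p M) \<subseteq> M" unfolding p_def by blast
    have Ms: "subgroup M G" using M unfolding maximal_subgroup_def by blast
    have Z: "center G \<subseteq> M" using maximal_supplement_contains_center M by blast
    show "M \<subseteq> \<Union>(p M)"
    proof
      fix m assume m: "m \<in> M"
      have mc: "m \<in> carrier G" using subgroup.mem_carrier[OF Ms m] .
      have "center G #> m \<subseteq> M" unfolding r_coset_def using Z m subgroup.m_closed[OF Ms] by blast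
      moreover have "center G #> m \<in> rcosets (center G)" by (rule rcosetsI[OF subgroup.subset[OF center_subgroup] mc])
      moreover have "m \<in> center G #> m" by (rule rcos_self[OF mc center_subgroup])
      ultimately show "m \<in> \<Union>(p M)" unfolding p_def by blast
    qed
  qed
  have "inj_on p ?S" by (rule inj_onI) (metis un)
  moreover have "p ` ?S \<subseteq> Pow (rcosets (center G))" unfolding p_def by blast
  ultimately show ?thesis using assms by (meson finite_Pow_iff finite_imageD finite_subset)
qed

text \<open>A case of Schur's theorem: by the transfer, \<open>derived G (carrier G)\<close> meets
  \<open>N\<close> in elements of finite order, hence trivially, and so embeds into the set of
  cosets of \<open>N\<close>.\<close>

lemma derived_finite_if_torsion_free_central:
  assumes N: "subgroup N G" "N \<subseteq> center G" "finite (rcosets N)"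
    and tf: "\<And>a n. a \<in> N \<Longrightarrow> n > 0 \<Longrightarrow> a [^] (n::nat) = \<one> \<Longrightarrow> a = \<one>"
  shows "finite (derived G (carrier G))"
proof (rule finite_if_trivial_meet)
  show "N \<lhd> G" by (rule central_subgroup_normal[OF N(1,2)])
  show "subgroup (derived G (carrier G)) G" by (rule derived_is_subgroup[OF subset_refl])
  show "derived G (carrier G) \<subseteq> carrier G" by (rule derived_in_carrier[OF subset_refl])
  have "{N #> k | k. k \<in> carrier G} = rcosets N" unfolding RCOSETS_def by blast
  then show "finite {N #> k | k. k \<in> carrier G}" using N(3) by simp
  have "rcosets N \<noteq> {}" unfolding RCOSETS_def by auto
  then have pos: "card (rcosets N) > 0" using N(3) by (simp add: card_gt_0_iff)
  show "derived G (carrier G) \<inter> N \<subseteq> {\<one>}"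
  proof
    fix z assume z: "z \<in> derived G (carrier G) \<inter> N"
    have "z [^] card (rcosets N) = \<one>"
      by (rule central_transfer[OF N(1) _ N(3)]) (use z N(2) centerD in blast)+
    then show "z \<in> {\<one>}" using tf[OF _ pos, of z] z by blast
  qed
qed

end

section \<open>Solvability of finite groups\<close>

lemma ex_maximal_subset:
  assumes "finite S" "P (H :: 'a set)" "\<And>H. P H \<Longrightarrow> H \<subseteq> S"
  shows "\<exists>M. P M \<and> (\<forall>K. P K \<longrightarrow> M \<subseteq> K \<longrightarrow> K = M)"
proof -
  have "{H. P H} \<subseteq> Pow S" using assms(3) by blast
  then have fin: "finite {H. P H}" using assms(1) finite_subset by blast
  have "{H. P H} \<noteq> {}" using assms(2) by blast
  from finite_has_maximal[OF fin this] show ?thesis by auto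
qed

context group
begin

lemma nilpotent_imp_solvable:
  assumes "nilpotent_grp G" shows "solvable G"
proof -
  have "(derived G ^^ n) (carrier G) \<subseteq> icomm G (carrier G) (carrier G) n" for n
  proof (induction n)
    case (Suc n)
    have "cmt G a b \<in> icomm G (carrier G) (carrier G) (Suc n)"
      if "a \<in> (derived G ^^ n) (carrier G)" "b \<in> (derived G ^^ n) (carrier G)" for a b
      using cmt_in_icomm[of a "carrier G" "carrier G" n b] Suc that normal_sub(2)[OF derived_funpow_normal[of n]] by blast
    then show ?case
      using derived_subsetI[OF icomm_subgroup[OF subgroup_self subset_refl, of "Suc n"]] by simp
  qed simp
  moreover obtain n where "icomm G (carrier G) (carrier G) n = {\<one>}" using assms nilpotent_iff by blast
  ultimately have "(derived G ^^ n) (carrier G) \<subseteq> {\<one>}" by metis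
  then have "(derived G ^^ n) (carrier G) = {\<one>}"
    using subgroup.one_closed[OF normal_sub(1)[OF derived_funpow_normal[of n]]] by blast
  then show ?thesis using solvable_iff_trivial_derived_seq by blast
qed

lemma solvable_subgroup_mono:
  assumes "subgroup N G" "subgroup H G" "N \<subseteq> H" "solvable (G\<lparr>carrier := H\<rparr>)"
  shows "solvable (G\<lparr>carrier := N\<rparr>)"
proof -
  interpret h: group_hom "G\<lparr>carrier := N\<rparr>" "G\<lparr>carrier := H\<rparr>" "\<lambda>x. x"
    using subgroup_imp_group[OF assms(1)] subgroup_imp_group[OF assms(2)] assms(3)
    by (auto simp: group_hom_def group_hom_axioms_def hom_def)
  show ?thesis by (rule h.inj_hom_imp_solvable[OF _ assms(4)]) (simp add: inj_on_def)
qed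

lemma solvable_extension:
  assumes "N \<lhd> G" "solvable (G\<lparr>carrier := N\<rparr>)" "solvable (G Mod N)" shows "solvable G"
proof (rule solvable_condition[OF _ quotient_hom(1)[OF assms(1)] quotient_hom(2)[OF assms(1)] _ assms(2,3)])
  show "group_hom (G\<lparr>carrier := N\<rparr>) G (\<lambda>x. x)"
    using subgroup_imp_group[OF normal_sub(1)[OF assms(1)]] normal_sub(2)[OF assms(1)] is_group
    by (auto simp: group_hom_def group_hom_axioms_def hom_def)
  show "kernel G (G Mod N) (\<lambda>a. N #> a) \<subseteq> (\<lambda>x. x) ` carrier (G\<lparr>carrier := N\<rparr>)"
    using quotient_hom(3)[OF assms(1)] unfolding kernel_def by auto
qed

text \<open>Automorphisms of cyclic groups commute, so commutators centralize every element.\<close>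
lemma dedekind_imp_solvable:
  assumes ded: "\<And>H. subgroup H G \<Longrightarrow> H \<lhd> G" shows "solvable G"
proof -
  have pw: "\<exists>k::int. g \<otimes> a \<otimes> inv g = a [^] k" if a: "a \<in> carrier G" and g: "g \<in> carrier G" for a g
  proof -
    have "subgroup (cyc_ext G {\<one>} a) G" by (rule cyc_ext_subgroup[OF triv_subgroup a]) (use a in auto)
    then have n: "cyc_ext G {\<one>} a \<lhd> G" by (rule ded)
    have "g \<otimes> a \<otimes> inv g \<in> cyc_ext G {\<one>} a" by (rule normal_conj[OF n g cyc_ext_incl(2)[OF triv_subgroup a]])
    then obtain e and k :: int where "e \<in> {\<one>}" "g \<otimes> a \<otimes> inv g = e \<otimes> a [^] k" by (rule cyc_extE)
    then show ?thesis using a by auto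
  qed
  have cen: "cmt G g h \<in> center G" if g: "g \<in> carrier G" and h: "h \<in> carrier G" for g h
  proof -
    have "a \<otimes> cmt G g h = cmt G g h \<otimes> a" if a: "a \<in> carrier G" for a
    proof -
      define u v where "u = h \<otimes> g" and "v = g \<otimes> h"
      have uv: "u \<in> carrier G" "v \<in> carrier G" using g h by (simp_all add: u_def v_def)
      obtain i :: int where i: "g \<otimes> a \<otimes> inv g = a [^] i" using pw[OF a g] by blast
      obtain j :: int where j: "h \<otimes> a \<otimes> inv h = a [^] j" using pw[OF a h] by blast
      \<comment> \<open>The commutator of \<open>g\<close> and \<open>h\<close> is \<open>v\<close>
        times the inverse of \<open>u\<close>. Conjugation by the inverse of \<open>u\<close> takes
        \<open>a\<close> to \<open>a [^] k\<close>, on which \<open>u\<close> and \<open>v\<close>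
        act alike.\<close>
      obtain k :: int where k: "inv u \<otimes> a \<otimes> inv (inv u) = a [^] k" using pw[OF a inv_closed[OF uv(1)]] by blast
      have "u \<otimes> a \<otimes> inv u = h \<otimes> (g \<otimes> a \<otimes> inv g) \<otimes> inv h" using g h a by (simp add: u_def inv_mult_group m_assoc)
      also have "\<dots> = (h \<otimes> a \<otimes> inv h) [^] i" unfolding i by (rule int_pow_conj[OF a h])
      also have "\<dots> = a [^] (i * j)" unfolding j using a by (simp add: int_pow_pow mult.commute)
      finally have ua: "u \<otimes> a \<otimes> inv u = a [^] (i * j)" .
      have "v \<otimes> a \<otimes> inv v = g \<otimes> (h \<otimes> a \<otimes> inv h) \<otimes> inv g" using g h a by (simp add: v_def inv_mult_group m_assoc)
      also have "\<dots> = (g \<otimes> a \<otimes> inv g) [^] j" unfolding j by (rule int_pow_conj[OF a g])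
      also have "\<dots> = a [^] (i * j)" unfolding i using a by (simp add: int_pow_pow)
      finally have va: "v \<otimes> a \<otimes> inv v = a [^] (i * j)" .
      have "v \<otimes> a [^] k \<otimes> inv v = u \<otimes> a [^] k \<otimes> inv u"
        unfolding int_pow_conj[OF a uv(1)] int_pow_conj[OF a uv(2)] ua va ..
      also have "\<dots> = a" unfolding k[symmetric] using a uv by (simp add: m_assoc)
      finally have "v \<otimes> (inv u \<otimes> a \<otimes> u) \<otimes> inv v = a" unfolding k[symmetric] using uv by simp
      moreover have "cmt G g h = v \<otimes> inv u" using g h by (simp add: u_def v_def cmt_def inv_mult_group m_assoc)
      ultimately have "cmt G g h \<otimes> a \<otimes> inv (cmt G g h) = a" using a uv by (simp add: inv_mult_group m_assoc)
      then have "cmt G g h \<otimes> a \<otimes> inv (cmt G g h) \<otimes> cmt G g h = a \<otimes> cmt G g h" by simp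
      then show ?thesis using a g h by (simp add: m_assoc)
    qed
    then show ?thesis unfolding center_def using g h by simp
  qed
  have d: "derived G (carrier G) \<subseteq> center G" by (rule derived_subsetI[OF center_subgroup cen])
  have "derived G (derived G (carrier G)) \<subseteq> {\<one>}"
  proof (rule derived_subsetI[OF triv_subgroup])
    fix a b assume "a \<in> derived G (carrier G)" "b \<in> derived G (carrier G)"
    then have "a \<in> center G" "b \<in> carrier G" using d center_carrier by blast+
    then show "cmt G a b \<in> {\<one>}" using cmt_eq_one_iff[OF center_carrier, of a b] centerD by blast
  qed
  then have "(derived G ^^ 2) (carrier G) \<subseteq> {\<one>}" by (simp add: numeral_2_eq_2)
  then have "(derived G ^^ 2) (carrier G) = {\<one>}"
    using subgroup.one_closed[OF normal_sub(1)[OF derived_funpow_normal[of 2]]] by blast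
  then show ?thesis using solvable_iff_trivial_derived_seq by blast
qed

text \<open>The normalizer condition: the last lower central term of \<open>M\<close> outside
  \<open>D\<close> normalizes \<open>D\<close>, because its commutators with \<open>M\<close> fall
  into \<open>D\<close>.\<close>

lemma nilpotent_normalizer_grows:
  assumes M: "subgroup M G" "nilpotent_grp (G\<lparr>carrier := M\<rparr>)" and D: "subgroup D G" "D \<subseteq> M" "D \<noteq> M"
  shows "\<exists>g\<in>M - D. g \<in> nrm G D"
proof -
  obtain n where "icomm G M M n = {\<one>}" using M nilpotent_subgroup_iff by blast
  then have "icomm G M M n \<subseteq> D" using subgroup.one_closed[OF D(1)] by simp
  then obtain t where t: "\<not> icomm G M M t \<subseteq> D" "icomm G M M (Suc t) \<subseteq> D"
    using last_icomm_not_in[of M M n D] D(2,3) by blast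
  then obtain g where g: "g \<in> icomm G M M t" "g \<notin> D" by blast
  have gM: "g \<in> M" using g(1) icomm_self_subset[OF M(1)] by blast
  have gc: "g \<in> carrier G" using subgroup.mem_carrier[OF M(1) gM] .
  have ig: "inv g \<in> icomm G M M t"
    using subgroup.m_inv_closed[OF icomm_subgroup[OF M(1) subgroup.subset[OF M(1)]] g(1)] .
  have cj: "u \<otimes> d \<otimes> inv u \<in> D" if u: "u \<in> icomm G M M t" and d: "d \<in> D" for u d
  proof -
    have uc: "u \<in> carrier G" using u icomm_self_subset[OF M(1)] subgroup.subset[OF M(1)] by blast
    have dc: "d \<in> carrier G" using subgroup.mem_carrier[OF D(1) d] .
    have "cmt G u d \<in> D" using cmt_in_icomm[OF u, of d] d D(2) t(2) by blast
    moreover have "u \<otimes> d \<otimes> inv u = cmt G u d \<otimes> d" using uc dc by (simp add: cmt_def m_assoc)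
    ultimately show ?thesis using subgroup.m_closed[OF D(1) _ d] by simp
  qed
  have "g \<in> nrm G D" unfolding nrm_def using cj[OF g(1)] cj[OF ig] gc by simp
  then show ?thesis using gM g(2) by blast
qed

lemma conj_image_subgroup:
  assumes "subgroup M G" "k \<in> carrier G" shows "subgroup ((\<lambda>m. k \<otimes> m \<otimes> inv k) ` M) G"
proof (rule subgroupI)
  have c: "m \<in> carrier G" if "m \<in> M" for m using subgroup.mem_carrier[OF assms(1) that] .
  show "(\<lambda>m. k \<otimes> m \<otimes> inv k) ` M \<subseteq> carrier G" using c assms(2) by auto
  show "(\<lambda>m. k \<otimes> m \<otimes> inv k) ` M \<noteq> {}" using subgroup.one_closed[OF assms(1)] by blast
  fix a assume "a \<in> (\<lambda>m. k \<otimes> m \<otimes> inv k) ` M"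
  then obtain m where m: "m \<in> M" "a = k \<otimes> m \<otimes> inv k" by blast
  have "inv a = k \<otimes> inv m \<otimes> inv k" using m c assms(2) by (simp add: inv_mult_group m_assoc)
  then show "inv a \<in> (\<lambda>m. k \<otimes> m \<otimes> inv k) ` M" using subgroup.m_inv_closed[OF assms(1) m(1)] by blast
  fix b assume "b \<in> (\<lambda>m. k \<otimes> m \<otimes> inv k) ` M"
  then obtain m' where m': "m' \<in> M" "b = k \<otimes> m' \<otimes> inv k" by blast
  have "a \<otimes> b = k \<otimes> (m \<otimes> m') \<otimes> inv k" using m m' c assms(2) by (simp add: m_assoc)
  then show "a \<otimes> b \<in> (\<lambda>m. k \<otimes> m \<otimes> inv k) ` M" using subgroup.m_closed[OF assms(1) m(1) m'(1)] by blast
qed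

lemma conj_image_inv:
  assumes "M \<subseteq> carrier G" "k \<in> carrier G"
  shows "(\<lambda>m. inv k \<otimes> m \<otimes> inv (inv k)) ` (\<lambda>m. k \<otimes> m \<otimes> inv k) ` M = M"
proof -
  have "inv k \<otimes> (k \<otimes> m \<otimes> inv k) \<otimes> inv (inv k) = m" if "m \<in> M" for m
    using that assms by (simp add: m_assoc subsetD)
  then show ?thesis unfolding image_image by simp
qed

lemma conj_image_maximal:
  assumes M: "maximal_subgroup M G" and k: "k \<in> carrier G"
  shows "maximal_subgroup ((\<lambda>m. k \<otimes> m \<otimes> inv k) ` M) G"
proof -
  let ?c = "\<lambda>k M. (\<lambda>m. k \<otimes> m \<otimes> inv k) ` M"
  have Ms: "subgroup M G" and ne: "M \<noteq> carrier G"
    and max: "\<And>H. subgroup H G \<Longrightarrow> M \<subseteq> H \<Longrightarrow> H = M \<or> H = carrier G"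
    using M unfolding maximal_subgroup_def by auto
  note ki = inv_closed[OF k]
  have bk: "?c (inv k) (?c k V) = V" if "V \<subseteq> carrier G" for V by (rule conj_image_inv[OF that k])
  have bkk: "?c k (?c (inv k) V) = V" if "V \<subseteq> carrier G" for V
    using conj_image_inv[OF that ki] k by simp
  have fullc: "?c u (carrier G) \<subseteq> carrier G" if "u \<in> carrier G" for u using that by auto
  have fullk: "?c k (carrier G) = carrier G"
    using fullc[OF k] bkk[OF subset_refl] image_mono[OF fullc[OF ki], of "\<lambda>m. k \<otimes> m \<otimes> inv k"] by blast
  show ?thesis unfolding maximal_subgroup_def
  proof (intro conjI allI impI)
    show "subgroup (?c k M) G" by (rule conj_image_subgroup[OF Ms k])
    show "?c k M \<noteq> carrier G"
    proof
      assume "?c k M = carrier G"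
      then have "M = ?c (inv k) (carrier G)" using bk[OF subgroup.subset[OF Ms]] by simp
      moreover have "?c (inv k) (carrier G) = carrier G" using bk[OF subset_refl] fullk by simp
      ultimately show False using ne by simp
    qed
    fix H assume H: "subgroup H G" "?c k M \<subseteq> H"
    have "M \<subseteq> ?c (inv k) H" using image_mono[OF H(2), of "\<lambda>m. inv k \<otimes> m \<otimes> inv (inv k)"] bk[OF subgroup.subset[OF Ms]] by simp
    then have "?c (inv k) H = M \<or> ?c (inv k) H = carrier G" by (rule max[OF conj_image_subgroup[OF H(1) ki]])
    then show "H = ?c k M \<or> H = carrier G" using bkk[OF subgroup.subset[OF H(1)]] fullk by auto
  qed
qed

lemma exists_maximal_subgroup:
  assumes "finite (carrier G)" "subgroup H G" "H \<noteq> carrier G"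
  shows "\<exists>M. maximal_subgroup M G \<and> H \<subseteq> M"
proof -
  obtain M where M: "subgroup M G \<and> M \<noteq> carrier G \<and> H \<subseteq> M"
    and max: "\<And>K. subgroup K G \<and> K \<noteq> carrier G \<and> H \<subseteq> K \<Longrightarrow> M \<subseteq> K \<Longrightarrow> K = M"
    using ex_maximal_subset[of "carrier G" "\<lambda>M. subgroup M G \<and> M \<noteq> carrier G \<and> H \<subseteq> M" H]
      assms subgroup.subset by (metis (no_types, lifting) subset_refl)
  then show ?thesis unfolding maximal_subgroup_def by blast
qed

text \<open>Schmidt's argument: by the normalizer condition distinct maximal subgroups meet trivially, so the
  conjugates of one of them cover at least half of the group but miss a nontrivial element, which
  lies in a maximal subgroup whose conjugates cover another half.\<close>
theorem simple_minimal_nonnilpotent_solvable: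
  assumes fin: "finite (carrier G)"
    and simple: "\<And>N. N \<lhd> G \<Longrightarrow> N = {\<one>} \<or> N = carrier G"
    and nil: "\<And>H. subgroup H G \<Longrightarrow> H \<noteq> carrier G \<Longrightarrow> nilpotent_grp (G\<lparr>carrier := H\<rparr>)"
  shows "solvable G"
proof (rule ccontr)
  assume ns: "\<not> solvable G"
  let ?c = "\<lambda>k M. (\<lambda>m. k \<otimes> m \<otimes> inv k) ` M"
  have cyc_sub: "subgroup (cyc_ext G {\<one>} g) G" if "g \<in> carrier G" for g
    by (rule cyc_ext_subgroup[OF triv_subgroup that]) (use that in auto)
  \<comment> \<open>A cyclic group is abelian, so all its subgroups are normal and
    \<open>dedekind_imp_solvable\<close> applies.\<close>
  have cyc: "cyc_ext G {\<one>} g \<noteq> carrier G" if g: "g \<in> carrier G" for g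
  proof
    assume all: "cyc_ext G {\<one>} g = carrier G"
    have "solvable G"
    proof (rule dedekind_imp_solvable)
      fix H assume H: "subgroup H G"
      show "H \<lhd> G"
      proof (rule normal_invI[OF H])
        fix y a assume y: "y \<in> carrier G" and a: "a \<in> H"
        have ac: "a \<in> carrier G" using subgroup.mem_carrier[OF H a] .
        obtain i j :: int where ij: "y = g [^] i" "a = g [^] j"
        proof -
          have "y \<in> cyc_ext G {\<one>} g" "a \<in> cyc_ext G {\<one>} g" using all y ac by auto
          then show ?thesis using that g by (auto elim!: cyc_extE)
        qed
        have "y \<otimes> a = a \<otimes> y" unfolding ij int_pow_mult[OF g, symmetric] by (simp add: add.commute)
        then have "y \<otimes> a \<otimes> inv y = a" using y ac by (simp add: m_assoc)
        then show "y \<otimes> a \<otimes> inv y \<in> H" using a by simp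
      qed
    qed
    then show False using ns by blast
  qed
  have inmax: "\<exists>M. maximal_subgroup M G \<and> g \<in> M" if g: "g \<in> carrier G" for g
    using exists_maximal_subgroup[OF fin cyc_sub[OF g] cyc[OF g]] cyc_ext_incl(2)[OF triv_subgroup g] by blast
  have nontriv: "carrier G \<noteq> {\<one>}"
  proof
    assume "carrier G = {\<one>}"
    moreover have "\<one> \<in> cyc_ext G {\<one>} \<one>" by (rule cyc_ext_incl(2)[OF triv_subgroup one_closed])
    ultimately have "cyc_ext G {\<one>} \<one> = carrier G" using subgroup.subset[OF cyc_sub[OF one_closed]] by auto
    then show False using cyc[OF one_closed] by simp
  qed
  then obtain g0 where g0: "g0 \<in> carrier G" "g0 \<noteq> \<one>" using one_closed by blast
  have mxs: "subgroup M G" "M \<noteq> carrier G" "\<And>H. subgroup H G \<Longrightarrow> M \<subseteq> H \<Longrightarrow> H \<noteq> carrier G \<Longrightarrow> H = M"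
    if "maximal_subgroup M G" for M using that unfolding maximal_subgroup_def by auto
  have mx1: "M \<noteq> {\<one>}" if M: "maximal_subgroup M G" for M
  proof
    assume "M = {\<one>}"
    then have "cyc_ext G {\<one>} g0 = M"
      using mxs(3)[OF M cyc_sub[OF g0(1)] _ cyc[OF g0(1)]] cyc_ext_incl(1)[OF triv_subgroup g0(1)] by blast
    then show False using cyc_ext_incl(2)[OF triv_subgroup g0(1)] g0(2) \<open>M = {\<one>}\<close> by blast
  qed
  have nrm_proper: "nrm G D \<noteq> carrier G" if D: "subgroup D G" "D \<noteq> {\<one>}" "D \<noteq> carrier G" for D
    using nrm_carrier_imp_normal[OF D(1)] simple[of D] D(2,3) by blast
  have selfn: "nrm G M = M" if M: "maximal_subgroup M G" for M
    using mxs(3)[OF M nrm_subgroup[OF subgroup.subset[OF mxs(1)[OF M]]] nrm_incl[OF mxs(1)[OF M]]]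
      nrm_proper[OF mxs(1)[OF M] mx1[OF M] mxs(2)[OF M]] by blast
  have triv_meet: "M \<inter> L \<subseteq> {\<one>}" if M: "maximal_subgroup M G" and L: "maximal_subgroup L G" and neq: "M \<noteq> L" for M L
  proof (rule ccontr)
    assume nt: "\<not> M \<inter> L \<subseteq> {\<one>}"
    \<comment> \<open>Let \<open>D\<close> be a largest nontrivial intersection of distinct maximal
      subgroups. By simplicity its normalizer lies in some maximal \<open>C\<close>. Each maximal
      subgroup properly containing \<open>D\<close> meets \<open>C\<close> in more than
      \<open>D\<close>, by the normalizer condition, hence equals \<open>C\<close>.\<close>
    define P where "P = (\<lambda>D. D \<noteq> {\<one>} \<and> (\<exists>M L. maximal_subgroup M G \<and> maximal_subgroup L G \<and> M \<noteq> L \<and> D = M \<inter> L))"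
    have "M \<inter> L \<noteq> {\<one>}" using nt by blast
    then have "P (M \<inter> L)" unfolding P_def using M L neq by blast
    moreover have Pc: "D \<subseteq> carrier G" if "P D" for D
      using that subgroup.subset[OF mxs(1)] unfolding P_def by blast
    ultimately obtain D where D: "P D" and maxD: "\<And>K. P K \<Longrightarrow> D \<subseteq> K \<Longrightarrow> K = D"
      using ex_maximal_subset[of "carrier G" P "M \<inter> L", OF fin] by blast
    then obtain A B where AB: "maximal_subgroup A G" "maximal_subgroup B G" "A \<noteq> B" "D = A \<inter> B" and D1: "D \<noteq> {\<one>}"
      unfolding P_def by blast
    have Ds: "subgroup D G" unfolding AB(4) by (rule subgroups_Inter_pair[OF mxs(1)[OF AB(1)] mxs(1)[OF AB(2)]])
    have DA: "D \<noteq> A"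
    proof
      assume "D = A"
      then have "A \<subseteq> B" using AB(4) by blast
      then show False using mxs(3)[OF AB(1) mxs(1)[OF AB(2)] _ mxs(2)[OF AB(2)]] AB(3) by blast
    qed
    have DB: "D \<noteq> B"
    proof
      assume "D = B"
      then have "B \<subseteq> A" using AB(4) by blast
      then show False using mxs(3)[OF AB(2) mxs(1)[OF AB(1)] _ mxs(2)[OF AB(1)]] AB(3) by blast
    qed
    have Dc: "D \<noteq> carrier G" using AB(4) mxs(1,2)[OF AB(1)] subgroup.subset by blast
    obtain C where C: "maximal_subgroup C G" "nrm G D \<subseteq> C"
      using exists_maximal_subgroup[OF fin nrm_subgroup[OF subgroup.subset[OF Ds]] nrm_proper[OF Ds D1 Dc]] by blast
    have eqC: "V = C" if V: "maximal_subgroup V G" "D \<subseteq> V" "D \<noteq> V" for V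
    proof (rule ccontr)
      assume "V \<noteq> C"
      obtain g where g: "g \<in> V - D" "g \<in> nrm G D"
        using nilpotent_normalizer_grows[OF mxs(1)[OF V(1)] nil[OF mxs(1,2)[OF V(1)]] Ds V(2,3)] by blast
      have "D \<subseteq> V \<inter> C" using V(2) nrm_incl[OF Ds] C(2) by blast
      moreover have "g \<in> V \<inter> C" using g C(2) by blast
      moreover have "V \<inter> C \<noteq> {\<one>}" using calculation(2) g(1) subgroup.one_closed[OF Ds] by (metis DiffD2 singletonD)
      then have "P (V \<inter> C)" unfolding P_def using V(1) C(1) \<open>V \<noteq> C\<close> by blast
      ultimately show False using maxD[of "V \<inter> C"] g by blast
    qed
    have "A = C" "B = C" using eqC[OF AB(1) _ DA] eqC[OF AB(2) _ DB] AB(4) by blast+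
    then show False using AB(3) by simp
  qed
  define n where "n = card (carrier G)"
  \<comment> \<open>The union of the conjugates of \<open>M\<close>, without the identity.\<close>
  define U where "U = (\<lambda>M. (\<lambda>(g, m). g \<otimes> m \<otimes> inv g) ` (carrier G \<times> (M - {\<one>})))"
  have Uc: "U M \<subseteq> carrier G - {\<one>}" if M: "subgroup M G" for M
  proof
    fix y assume "y \<in> U M"
    then obtain g m where g: "g \<in> carrier G" "m \<in> M" "m \<noteq> \<one>" "y = g \<otimes> m \<otimes> inv g" unfolding U_def by auto
    have mc: "m \<in> carrier G" using subgroup.mem_carrier[OF M g(2)] .
    have "m = inv g \<otimes> y \<otimes> g" using g mc by (simp add: m_assoc)
    then have "y \<noteq> \<one>" using g by auto
    then show "y \<in> carrier G - {\<one>}" using g mc by simp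
  qed
  \<comment> \<open>The count of index times \<open>card M - 1\<close> elements, cleared of the
    denominator. Since \<open>M\<close> is self-normalizing and distinct conjugates meet trivially,
    each fibre of \<open>(g, m) \<mapsto> g m g^-1\<close> is parametrized by
    \<open>M\<close>.\<close>
  have cardU: "card (U M) * card M = n * (card M - 1)" if M: "maximal_subgroup M G" for M
  proof -
    note Ms = mxs(1)[OF M]
    have Mc: "m \<in> carrier G" if "m \<in> M" for m using subgroup.mem_carrier[OF Ms that] .
    have finM: "finite M" using fin subgroup.subset[OF Ms] finite_subset by blast
    let ?A = "carrier G \<times> (M - {\<one>})"
    let ?f = "\<lambda>(g, m). g \<otimes> m \<otimes> inv g"
    have finA: "finite ?A" using fin finM by simp
    have fib: "card {a \<in> ?A. ?f a = y} = card M" if y: "y \<in> ?f ` ?A" for y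
    proof -
      obtain g m where g: "g \<in> carrier G" and m: "m \<in> M" "m \<noteq> \<one>" and yg: "y = g \<otimes> m \<otimes> inv g" using y by auto
      have mc: "m \<in> carrier G" using Mc[OF m(1)] .
      let ?b = "\<lambda>k. (g \<otimes> k, inv k \<otimes> m \<otimes> k)"
      have "bij_betw ?b M {a \<in> ?A. ?f a = y}"
      proof (rule bij_betw_imageI)
        show "inj_on ?b M" using g Mc by (auto intro!: inj_onI)
        show "?b ` M = {a \<in> ?A. ?f a = y}"
        proof (intro subset_antisym subsetI)
          fix a assume "a \<in> ?b ` M"
          then obtain k where k: "k \<in> M" "a = ?b k" by blast
          have kc: "k \<in> carrier G" using Mc[OF k(1)] .
          have "inv k \<otimes> m \<otimes> k \<in> M" using subgroup.m_closed[OF Ms subgroup.m_closed[OF Ms subgroup.m_inv_closed[OF Ms k(1)] m(1)] k(1)] .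
          moreover have "inv k \<otimes> m \<otimes> k \<noteq> \<one>"
          proof
            assume e: "inv k \<otimes> m \<otimes> k = \<one>"
            have "m = k \<otimes> (inv k \<otimes> m \<otimes> k) \<otimes> inv k" using kc mc by (simp add: m_assoc)
            then show False using m(2) kc unfolding e by simp
          qed
          moreover have "(g \<otimes> k) \<otimes> (inv k \<otimes> m \<otimes> k) \<otimes> inv (g \<otimes> k) = y"
            unfolding yg using g kc mc by (simp add: inv_mult_group m_assoc)
          ultimately show "a \<in> {a \<in> ?A. ?f a = y}" using k g kc by simp
        next
          fix a assume "a \<in> {a \<in> ?A. ?f a = y}"
          then obtain g' m' where a: "a = (g', m')" "g' \<in> carrier G" "m' \<in> M" "m' \<noteq> \<one>" "g' \<otimes> m' \<otimes> inv g' = y" by auto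
          have mc': "m' \<in> carrier G" using Mc[OF a(3)] .
          define k where "k = inv g \<otimes> g'"
          have kc: "k \<in> carrier G" using g a(2) by (simp add: k_def)
          have "k \<otimes> m' \<otimes> inv k = inv g \<otimes> (g' \<otimes> m' \<otimes> inv g') \<otimes> g"
            using g a(2) mc' by (simp add: k_def inv_mult_group m_assoc)
          also have "\<dots> = m" unfolding a(5) yg using g mc by (simp add: m_assoc)
          finally have km: "k \<otimes> m' \<otimes> inv k = m" .
          have "m \<in> ?c k M" using km a(3) by blast
          then have eq: "?c k M = M" using triv_meet[OF conj_image_maximal[OF M kc] M] m by blast
          have "k \<in> nrm G M"
          proof -
            have "k \<otimes> d \<otimes> inv k \<in> M" if "d \<in> M" for d using eq that by blast
            moreover have "inv k \<otimes> d \<otimes> k \<in> M" if "d \<in> M" for d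
            proof -
              have "d \<in> ?c k M" using eq that by simp
              then obtain d' where "d' \<in> M" "d = k \<otimes> d' \<otimes> inv k" by blast
              then show ?thesis using kc Mc by (simp add: m_assoc)
            qed
            ultimately show ?thesis using kc unfolding nrm_def by blast
          qed
          then have kM: "k \<in> M" using selfn[OF M] by simp
          have "g' = g \<otimes> k" using g a(2) by (simp add: k_def)
          moreover have "m' = inv k \<otimes> m \<otimes> k" unfolding km[symmetric] using kc mc' by (simp add: m_assoc)
          ultimately have "a = ?b k" using a(1) by simp
          then show "a \<in> ?b ` M" using kM by blast
        qed
      qed
      then show ?thesis by (simp add: bij_betw_same_card)
    qed
    have "card ?A = (\<Sum>a\<in>?A. 1)" by simp
    also have "\<dots> = (\<Sum>y\<in>?f ` ?A. \<Sum>a\<in>{a \<in> ?A. ?f a = y}. 1)" by (rule sum.image_gen[OF finA])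
    also have "\<dots> = (\<Sum>y\<in>?f ` ?A. card M)" by (rule sum.cong) (use fib in auto)
    also have "\<dots> = card (U M) * card M" unfolding U_def by simp
    finally have "card (U M) * card M = card ?A" by simp
    moreover have "card (M - {\<one>}) = card M - 1" using subgroup.one_closed[OF Ms] by simp
    ultimately show ?thesis unfolding n_def by (simp add: card_cartesian_product)
  qed
  have cardM: "2 \<le> card M" "card M < n" if M: "maximal_subgroup M G" for M
  proof -
    note Ms = mxs(1)[OF M]
    show "card M < n" unfolding n_def
      using psubset_card_mono[OF fin] subgroup.subset[OF Ms] mxs(2)[OF M] by blast
    have finM: "finite M" using fin subgroup.subset[OF Ms] finite_subset by blast
    obtain m where m: "m \<in> M" "m \<noteq> \<one>" using mx1[OF M] subgroup.one_closed[OF Ms] by blast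
    have "card {\<one>, m} \<le> card M" by (rule card_mono[OF finM]) (use m subgroup.one_closed[OF Ms] in simp)
    then show "2 \<le> card M" using \<open>m \<noteq> \<one>\<close> by simp
  qed
  have half: "n \<le> 2 * card (U M)" if M: "maximal_subgroup M G" for M
  proof -
    have "n * card M \<le> n * (2 * (card M - 1))" using cardM(1)[OF M] by (intro mult_left_mono) auto
    also have "\<dots> = 2 * card (U M) * card M" using cardU[OF M] by simp
    finally show ?thesis using cardM(1)[OF M] by simp
  qed
  obtain M where M: "maximal_subgroup M G" using inmax[OF g0(1)] by blast
  have finU: "finite (U V)" if "maximal_subgroup V G" for V
    using Uc[OF mxs(1)[OF that]] fin finite_subset by blast
  \<comment> \<open>Equality would give \<open>(n - 1) * card M = n * (card M - 1)\<close>, that is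
    \<open>card M = n\<close>.\<close>
  have "U M \<noteq> carrier G - {\<one>}"
  proof
    assume e: "U M = carrier G - {\<one>}"
    have c: "card (U M) = n - 1" unfolding e n_def using one_closed by simp
    have n1: "1 \<le> n" "1 \<le> card M" using cardM[OF M] by auto
    have "int ((n - 1) * card M) = int (n * (card M - 1))" using cardU[OF M] c by simp
    then have "(int n - 1) * int (card M) = int n * (int (card M) - 1)" using n1 by (simp add: of_nat_diff)
    then have "int (card M) = int n" by (simp add: algebra_simps)
    then show False using cardM(2)[OF M] by simp
  qed
  then obtain y where y: "y \<in> carrier G" "y \<noteq> \<one>" "y \<notin> U M" using Uc[OF mxs(1)[OF M]] by blast
  obtain L where L: "maximal_subgroup L G" "y \<in> L" using inmax[OF y(1)] by blast
  \<comment> \<open>A common element would make a conjugate of \<open>M\<close> equal to a conjugate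
    of \<open>L\<close>, and then \<open>y\<close> in \<open>L\<close> would be conjugate into
    \<open>M\<close>.\<close>
  have disj: "U M \<inter> U L = {}"
  proof (rule ccontr)
    assume "U M \<inter> U L \<noteq> {}"
    then obtain w where w: "w \<in> U M" "w \<in> U L" by blast
    obtain g m where g: "g \<in> carrier G" "m \<in> M" "w = g \<otimes> m \<otimes> inv g" using w(1) unfolding U_def by auto
    obtain g' l where g': "g' \<in> carrier G" "l \<in> L" "w = g' \<otimes> l \<otimes> inv g'" using w(2) unfolding U_def by auto
    have w1: "w \<noteq> \<one>" using w(1) Uc[OF mxs(1)[OF M]] by blast
    have "w \<in> ?c g M \<inter> ?c g' L" using g g' by blast
    then have eq: "?c g M = ?c g' L"
      using triv_meet[OF conj_image_maximal[OF M g(1)] conj_image_maximal[OF L(1) g'(1)]] w1 by blast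
    have "g' \<otimes> y \<otimes> inv g' \<in> ?c g M" unfolding eq using L(2) by blast
    then obtain m' where m': "m' \<in> M" "g' \<otimes> y \<otimes> inv g' = g \<otimes> m' \<otimes> inv g" by blast
    have mc': "m' \<in> carrier G" using subgroup.mem_carrier[OF mxs(1)[OF M] m'(1)] .
    have "y = inv g' \<otimes> (g' \<otimes> y \<otimes> inv g') \<otimes> g'" using y(1) g'(1) by (simp add: m_assoc)
    also have "\<dots> = (inv g' \<otimes> g) \<otimes> m' \<otimes> inv (inv g' \<otimes> g)"
      unfolding m'(2) using g(1) g'(1) mc' by (simp add: inv_mult_group m_assoc)
    finally have ye: "y = (inv g' \<otimes> g) \<otimes> m' \<otimes> inv (inv g' \<otimes> g)" .
    have "m' \<noteq> \<one>"
    proof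
      assume "m' = \<one>"
      then have "y = \<one>" using ye g(1) g'(1) by simp
      then show False using y(2) by simp
    qed
    then have "(inv g' \<otimes> g, m') \<in> carrier G \<times> (M - {\<one>})" using g(1) g'(1) m'(1) by simp
    then have "y \<in> U M" unfolding U_def using ye by (intro image_eqI[of _ _ "(inv g' \<otimes> g, m')"]) auto
    then show False using y(3) by simp
  qed
  have "card (U M) + card (U L) = card (U M \<union> U L)" using card_Un_disjoint[OF finU[OF M] finU[OF L(1)] disj] by simp
  also have "\<dots> \<le> card (carrier G - {\<one>})"
    using Uc[OF mxs(1)[OF M]] Uc[OF mxs(1)[OF L(1)]] fin by (intro card_mono) auto
  also have "\<dots> < n" unfolding n_def by (rule card_Diff1_less[OF fin one_closed])
  finally show False using half[OF M] half[OF L(1)] by linarith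
qed

text \<open>A maximal proper normal subgroup \<open>N\<close> is nilpotent, hence soluble, and its
  quotient is simple with proper subgroups that are images of proper, hence nilpotent,
  subgroups.\<close>

theorem minimal_nonnilpotent_solvable:
  assumes fin: "finite (carrier G)"
    and nil: "\<And>H. subgroup H G \<Longrightarrow> H \<noteq> carrier G \<Longrightarrow> nilpotent_grp (G\<lparr>carrier := H\<rparr>)"
  shows "solvable G"
proof (cases "carrier G = {\<one>}")
  case True
  then have "(derived G ^^ 0) (carrier G) = {\<one>}" by simp
  then show ?thesis using solvable_iff_trivial_derived_seq by blast
next
  case False
  obtain N where N: "N \<lhd> G \<and> N \<noteq> carrier G"
    and max: "\<And>K. K \<lhd> G \<and> K \<noteq> carrier G \<Longrightarrow> N \<subseteq> K \<Longrightarrow> K = N"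
    using ex_maximal_subset[of "carrier G" "\<lambda>N. N \<lhd> G \<and> N \<noteq> carrier G" "{\<one>}", OF fin]
      one_is_normal normal_sub(2) False by (metis (no_types, lifting))
  have Nn: "N \<lhd> G" using N by blast
  note Ns = normal_sub(1)[OF Nn]
  interpret n: group "G\<lparr>carrier := N\<rparr>" by (rule subgroup_imp_group[OF Ns])
  have "solvable (G\<lparr>carrier := N\<rparr>)" by (rule n.nilpotent_imp_solvable) (use nil[OF Ns] N in simp)
  moreover have "solvable (G Mod N)"
  proof -
    define Q where "Q = G Mod N"
    define h where "h = (\<lambda>a. N #> a)"
    interpret q: group_hom G Q h unfolding Q_def h_def by (rule quotient_hom(1)[OF Nn])
    have surj: "h ` carrier G = carrier Q" unfolding Q_def h_def by (rule quotient_hom(2)[OF Nn])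
    have ker: "h g = \<one>\<^bsub>Q\<^esub> \<longleftrightarrow> g \<in> N" if "g \<in> carrier G" for g
      using quotient_hom(3)[OF Nn that] unfolding h_def Q_def .
    have img: "h ` {g \<in> carrier G. h g \<in> K} = K" if K: "subgroup K Q" for K
    proof
      have "K \<subseteq> h ` carrier G" using surj subgroup.subset[OF K] by simp
      then show "K \<subseteq> h ` {g \<in> carrier G. h g \<in> K}" by blast
    qed blast
    have "solvable Q"
    proof (rule q.H.simple_minimal_nonnilpotent_solvable)
      show "finite (carrier Q)" unfolding surj[symmetric] using fin by simp
    next
      fix V assume V: "V \<lhd> Q"
      note Vs = q.H.normal_sub(1)[OF V]
      let ?W = "{g \<in> carrier G. h g \<in> V}"
      have W: "?W \<lhd> G" by (rule q.vimage_normal[OF V])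
      have NW: "N \<subseteq> ?W"
      proof
        fix a assume a: "a \<in> N"
        then have ac: "a \<in> carrier G" using normal_sub(2)[OF Nn] by blast
        then show "a \<in> ?W" using ker[OF ac] a subgroup.one_closed[OF Vs] by simp
      qed
      show "V = {\<one>\<^bsub>Q\<^esub>} \<or> V = carrier Q"
      proof (cases "?W = carrier G")
        case True
        then show ?thesis using img[OF Vs] surj by simp
      next
        case False
        then have "?W = N" using max W NW by blast
        then have "V = h ` N" using img[OF Vs] by simp
        also have "\<dots> \<subseteq> {\<one>\<^bsub>Q\<^esub>}" using ker normal_sub(2)[OF Nn] by blast
        finally show ?thesis using subgroup.one_closed[OF Vs] by blast
      qed
    next
      fix K assume K: "subgroup K Q" "K \<noteq> carrier Q"
      let ?P = "{g \<in> carrier G. h g \<in> K}"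
      have P: "subgroup ?P G" by (rule q.vimage_subgroup[OF K(1)])
      have "?P \<noteq> carrier G" using img[OF K(1)] K(2) surj by auto
      then show "nilpotent_grp (Q\<lparr>carrier := K\<rparr>)" using q.nilpotent_img[OF P nil[OF P]] img[OF K(1)] by simp
    qed
    then show ?thesis unfolding Q_def .
  qed
  ultimately show ?thesis by (rule solvable_extension[OF Nn])
qed

lemma meta_nil_hamiltonian_subgroup:
  assumes "meta_nil_hamiltonian G" "subgroup H G" shows "meta_nil_hamiltonian (G\<lparr>carrier := H\<rparr>)"
  unfolding meta_nil_hamiltonian_def
proof (intro allI impI)
  fix K assume K: "subgroup K (G\<lparr>carrier := H\<rparr>)" "\<not> nilpotent_grp (G\<lparr>carrier := H, carrier := K\<rparr>)"
  have KG: "subgroup K G" by (rule incl_subgroup[OF assms(2) K(1)])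
  then have "K \<lhd> G" using assms(1) K(2) unfolding meta_nil_hamiltonian_def by simp
  then show "K \<lhd> (G\<lparr>carrier := H\<rparr>)"
    using normal_restrict_supergroup[OF assms(2)] subgroup.subset[OF K(1)] by simp
qed

end

text \<open>The induction on the order is applied only to a subgroup \<open>K\<close>, which keeps
  the element type. The quotient by a non-nilpotent \<open>K\<close> is treated directly: all
  subgroups above \<open>K\<close> are non-nilpotent, hence normal.\<close>

theorem finite_meta_nil_hamiltonian_solvable:
  fixes G :: "('a, 'b) monoid_scheme"
  assumes "group G" "finite (carrier G)" "meta_nil_hamiltonian G"
  shows "solvable G"
  using assms
proof (induction "card (carrier G)" arbitrary: G rule: less_induct)
  case (less G)
  interpret group G by (rule less.prems(1))
  show ?case
  proof (cases "\<forall>H. subgroup H G \<longrightarrow> H \<noteq> carrier G \<longrightarrow> nilpotent_grp (G\<lparr>carrier := H\<rparr>)")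
    case True
    then show ?thesis using minimal_nonnilpotent_solvable[OF less.prems(2)] by blast
  next
    case False
    then obtain K where K: "subgroup K G" "K \<noteq> carrier G" "\<not> nilpotent_grp (G\<lparr>carrier := K\<rparr>)" by blast
    have Kn: "K \<lhd> G" using less.prems(3) K unfolding meta_nil_hamiltonian_def by blast
    have "card K < card (carrier G)"
      using psubset_card_mono[OF less.prems(2)] subgroup.subset[OF K(1)] K(2) by blast
    moreover have "finite K" using less.prems(2) subgroup.subset[OF K(1)] finite_subset by blast
    ultimately have 1: "solvable (G\<lparr>carrier := K\<rparr>)"
      using less.hyps[of "G\<lparr>carrier := K\<rparr>"] subgroup_imp_group[OF K(1)]
        meta_nil_hamiltonian_subgroup[OF less.prems(3) K(1)] by simp
    have "solvable (G Mod K)"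
    proof -
      define Q where "Q = G Mod K"
      define h where "h = (\<lambda>a. K #>\<^bsub>G\<^esub> a)"
      interpret q: group_hom G Q h unfolding Q_def h_def by (rule quotient_hom(1)[OF Kn])
      have surj: "h ` carrier G = carrier Q" unfolding Q_def h_def by (rule quotient_hom(2)[OF Kn])
      have "solvable Q"
      proof (rule q.H.dedekind_imp_solvable)
        fix V assume V: "subgroup V Q"
        let ?W = "{g \<in> carrier G. h g \<in> V}"
        have W: "subgroup ?W G" by (rule q.vimage_subgroup[OF V])
        have KW: "K \<subseteq> ?W"
        proof
          fix a assume a: "a \<in> K"
          then have ac: "a \<in> carrier G" using subgroup.mem_carrier[OF K(1)] by blast
          have "h a = \<one>\<^bsub>Q\<^esub>" using quotient_hom(3)[OF Kn ac] a unfolding h_def Q_def by blast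
          then show "a \<in> ?W" using ac subgroup.one_closed[OF V] by simp
        qed
        then have "\<not> nilpotent_grp (G\<lparr>carrier := ?W\<rparr>)" using nilpotent_subgroup_mono[OF W K(1) KW] K(3) by blast
        then have Wn: "?W \<lhd> G" using less.prems(3) W unfolding meta_nil_hamiltonian_def by blast
        have "V \<subseteq> h ` carrier G" using surj subgroup.subset[OF V] by simp
        then have "h ` ?W = V" by blast
        then show "V \<lhd> Q" using q.normal_img[OF surj Wn] by simp
      qed
      then show ?thesis unfolding Q_def .
    qed
    then show ?thesis by (rule solvable_extension[OF Kn 1])
  qed
qed

section \<open>Assembly of the four statements\<close>

theorem mainTheorem5:
  fixes G (structure)
  assumes "group G"
    and "finitely_generated G"
    and "\<not> nilpotent_grp G"
    and "meta_nil_hamiltonian G"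
    and "\<exists>H. subgroup H G \<and> finite_index G H \<and> solvable (G\<lparr>carrier := H\<rparr>)
              \<and> torsion_free (G\<lparr>carrier := H\<rparr>)"
  shows "(finite (derived G (carrier G)) \<and> solvable G)
    \<and> finite_index G (center G)
    \<and> (polycyclic G \<and> nilpotent_grp (G\<lparr>carrier := fitting G\<rparr>) \<and> finite_index G (fitting G))
    \<and> (finite {M. maximal_subgroup M G \<and> M <#> derived G (carrier G) = carrier G}
         \<and> (\<forall>M. maximal_subgroup M G \<and> M <#> derived G (carrier G) = carrier G
                 \<longrightarrow> nilpotent_grp (G\<lparr>carrier := M\<rparr>)))"
proof -
  interpret group G by fact
  note meta = assms(4)
  obtain H where H: "subgroup H G" "finite (rcosets H)" "solvable (G\<lparr>carrier := H\<rparr>)"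
    and tfH: "torsion_free (G\<lparr>carrier := H\<rparr>)"
    using assms(5) unfolding finite_index_def by blast
  obtain N where N: "N \<lhd> G" "N \<subseteq> H" "finite (rcosets N)" using normal_core_finite_index[OF H(1,2)] by blast
  note Ns = normal_sub(1)[OF N(1)]
  have tf: "a = \<one>" if "a \<in> N" "n > 0" "a [^] (n::nat) = \<one>" for a n
  proof -
    have "a \<in> H" using that(1) N(2) by blast
    moreover have "a [^]\<^bsub>G\<lparr>carrier := H\<rparr>\<^esub> n = \<one>" using that(3) by (simp add: nat_pow_def)
    ultimately show ?thesis using tfH that(2) unfolding torsion_free_def by auto
  qed
  have sol: "solvable G"
  proof (rule solvable_extension[OF N(1)])
    show "solvable (G\<lparr>carrier := N\<rparr>)" by (rule solvable_subgroup_mono[OF Ns H(1) N(2) H(3)])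
    interpret q: group_hom G "G Mod N" "\<lambda>a. N #> a" by (rule quotient_hom(1)[OF N(1)])
    show "solvable (G Mod N)"
    proof (rule finite_meta_nil_hamiltonian_solvable[OF q.H.is_group])
      show "finite (carrier (G Mod N))" using N(3) by (simp add: FactGroup_def)
      show "meta_nil_hamiltonian (G Mod N)"
        by (rule q.meta_nil_hamiltonian_img[OF quotient_hom(2)[OF N(1)] meta])
    qed
  qed
  have pcs: "pcs G (carrier G)" by (rule fg_solvable_imp_pcs[OF meta sol assms(2)])
  obtain i where "finite (icomm G (carrier G) (carrier G) i)" using lower_central_finite[OF pcs meta sol] by blast
  then have NZ: "N \<subseteq> center G" by (rule torsion_free_normal_central[OF pcs meta assms(3) _ N(1,3) tf])
  have der: "finite (derived G (carrier G))"
    by (rule derived_finite_if_torsion_free_central[OF Ns NZ N(3) tf])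
  have cen: "finite (rcosets (center G))" by (rule finite_index_mono[OF Ns center_subgroup NZ N(3)])
  have NF: "N \<subseteq> fitting G" by (rule normal_subset_fitting[OF N(1) central_subgroup_nilpotent[OF Ns NZ]])
  have fit: "finite (rcosets (fitting G))"
    by (rule finite_index_mono[OF Ns normal_sub(1)[OF fitting_nilpotent(2)[OF pcs]] NF N(3)])
  have "polycyclic G" unfolding polycyclic_def by (rule pcs_imp_polycyclic_seq[OF pcs])
  then show ?thesis
    using der sol cen fit fitting_nilpotent(1)[OF pcs] finite_maximal_supplements[OF cen]
      maximal_supplement_nilpotent[OF meta] unfolding finite_index_def by blast
qed

end
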